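(* Let $V:\mathbb{R}^n\to\mathbb{C}$ be a complex potential with $\operatorname{Re}(V)\ge 0$ and $\operatorname{Re}(V)(x)\to\infty$ as $|x|\to\infty$. Let $\mathcal{H}_{00}=-\Delta+\operatorname{Re}(V)$, and assume that (multiplication by) $i\operatorname{Im}(V)$ is relatively compact with respect to the operator $\mathcal{H}_{00}$. Then the operator $\mathcal{H}_0=-\Delta+V=\mathcal{H}_{00}+i\operatorname{Im}(V)$ on $L^2(\mathbb{R}^n)$ has a purely discrete spectrum.
   Context: $\Delta$ is the usual Laplacian on $\mathbb{R}^n$, and a potential acts on $L^2(\mathbb{R}^n)$ as a multiplication operator. Relative compactness: let $X$ be a Hilbert space and $T$ a linear operator in $X$ with dense domain $\mathcal{D}(T)$ and non-empty resolvent set $\rho(T)$. A linear operator $A$ in $X$ is relatively compact with respect to $T$ if $\mathcal{D}(T)\subset\mathcal{D}(A)$ and $A(z-T)^{-1}:X\to X$ is a compact operator for some $z\in\rho(T)$. Purely discrete spectrum means that the essential spectrum is empty, i.e. the spectrum consists only of isolated eigenvalues of finite multiplicity. *)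

theory Defs
  imports "HOL-Analysis.Analysis"
begin

section \<open>Complex Hilbert spaces\<close>

text \<open>The topology and the norm are those of the underlying real inner product space, whose inner
  product is the real part of the complex one. \<^term>\<open>cinner\<close> is linear in its first argument.\<close>

class complex_hilbert_space = real_inner + complete_space +
  fixes scaleC :: "complex \<Rightarrow> 'a \<Rightarrow> 'a"  (infixr "*\<^sub>C" 75)
    and cinner :: "'a \<Rightarrow> 'a \<Rightarrow> complex"
  assumes scaleC_add_right: "c *\<^sub>C (x + y) = c *\<^sub>C x + c *\<^sub>C y"
    and scaleC_add_left: "(c + d) *\<^sub>C x = c *\<^sub>C x + d *\<^sub>C x"
    and scaleC_scaleC: "c *\<^sub>C d *\<^sub>C x = (c * d) *\<^sub>C x"
    and scaleR_scaleC: "scaleR r x = complex_of_real r *\<^sub>C x"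
    and cinner_commute: "cinner x y = cnj (cinner y x)"
    and cinner_add_left: "cinner (x + y) z = cinner x z + cinner y z"
    and cinner_scaleC_left: "cinner (c *\<^sub>C x) y = c * cinner x y"
    and inner_eq_Re_cinner: "inner x y = Re (cinner x y)"

lemma vector_space_scaleC:
  "vector_space ((*\<^sub>C) :: complex \<Rightarrow> 'a::complex_hilbert_space \<Rightarrow> 'a)"
  using scaleR_scaleC[of 1, where 'a = 'a]
  by unfold_locales (simp_all add: scaleC_add_right scaleC_add_left scaleC_scaleC)

abbreviation cspan :: "'a::complex_hilbert_space set \<Rightarrow> 'a set" where
  "cspan \<equiv> module.span (*\<^sub>C)"

definition finite_cdim :: "'a::complex_hilbert_space set \<Rightarrow> bool" where
  "finite_cdim S \<longleftrightarrow> (\<exists>B. finite B \<and> S \<subseteq> cspan B)"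

section \<open>Unbounded operators\<close>

text \<open>An operator in \<open>X\<close> is represented by its graph, so that \<^const>\<open>Domain\<close>, \<^const>\<open>Range\<close>,
  \<^const>\<open>converse\<close> and \<^const>\<open>relcomp\<close> are its domain, its range, the inverse and the product
  (\<open>S O T\<close> is \<open>T\<close> after \<open>S\<close>, with its natural domain).\<close>

type_synonym 'a operator = "('a \<times> 'a) set"

definition linear_operator :: "'a::complex_hilbert_space operator \<Rightarrow> bool" where
  "linear_operator T \<longleftrightarrow>
     single_valued T \<and> (0, 0) \<in> T \<and>
     (\<forall>x y x' y'. (x, y) \<in> T \<longrightarrow> (x', y') \<in> T \<longrightarrow> (x + x', y + y') \<in> T) \<and>
     (\<forall>c x y. (x, y) \<in> T \<longrightarrow> (c *\<^sub>C x, c *\<^sub>C y) \<in> T)"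

definition op_plus :: "'a::complex_hilbert_space operator \<Rightarrow> 'a operator \<Rightarrow> 'a operator" where
  "op_plus S T = {(x, y + z) | x y z. (x, y) \<in> S \<and> (x, z) \<in> T}"

definition shifted :: "complex \<Rightarrow> 'a::complex_hilbert_space operator \<Rightarrow> 'a operator" where
  \<comment> \<open>\<open>z - T\<close>\<close>
  "shifted z T = {(x, z *\<^sub>C x - y) | x y. (x, y) \<in> T}"

definition bounded_everywhere :: "'a::complex_hilbert_space operator \<Rightarrow> bool" where
  "bounded_everywhere K \<longleftrightarrow>
     linear_operator K \<and> Domain K = UNIV \<and> (\<exists>C. \<forall>(x, y) \<in> K. norm y \<le> C * norm x)"

definition compact_operator :: "'a::complex_hilbert_space operator \<Rightarrow> bool" where
  "compact_operator K \<longleftrightarrow>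
     linear_operator K \<and> Domain K = UNIV \<and> (\<forall>B. bounded B \<longrightarrow> compact (closure (K `` B)))"

definition resolvent :: "complex \<Rightarrow> 'a::complex_hilbert_space operator \<Rightarrow> 'a operator" where
  "resolvent z T = (shifted z T)\<inverse>"

definition resolvent_set :: "'a::complex_hilbert_space operator \<Rightarrow> complex set" where
  "resolvent_set T = {z. bounded_everywhere (resolvent z T)}"

definition spectrum :: "'a::complex_hilbert_space operator \<Rightarrow> complex set" where
  "spectrum T = - resolvent_set T"

definition relatively_compact ::
    "'a::complex_hilbert_space operator \<Rightarrow> 'a operator \<Rightarrow> bool" where
  "relatively_compact A T \<longleftrightarrow>
     linear_operator T \<and> closure (Domain T) = UNIV \<and> resolvent_set T \<noteq> {} \<and>
     linear_operator A \<and> Domain T \<subseteq> Domain A \<and>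
     (\<exists>z \<in> resolvent_set T. compact_operator (resolvent z T O A))"

definition op_kernel :: "'a::complex_hilbert_space operator \<Rightarrow> 'a set" where
  "op_kernel T = {x. (x, 0) \<in> T}"

definition eigenvalue :: "'a::complex_hilbert_space operator \<Rightarrow> complex \<Rightarrow> bool" where
  "eigenvalue T z \<longleftrightarrow> (\<exists>x. x \<noteq> 0 \<and> (x, z *\<^sub>C x) \<in> T)"

text \<open>The space of generalized eigenvectors; its dimension is the algebraic multiplicity.\<close>

definition root_space :: "'a::complex_hilbert_space operator \<Rightarrow> complex \<Rightarrow> 'a set" where
  "root_space T z = (\<Union>k. op_kernel (shifted z T ^^ k))"

definition fredholm :: "'a::complex_hilbert_space operator \<Rightarrow> bool" where
  "fredholm T \<longleftrightarrow>
     finite_cdim (op_kernel T) \<and> closed (Range T) \<and>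
     (\<exists>B. finite B \<and> (\<forall>y. \<exists>r \<in> Range T. \<exists>b \<in> cspan B. y = r + b))"

definition essential_spectrum :: "'a::complex_hilbert_space operator \<Rightarrow> complex set" where
  "essential_spectrum T = {z. \<not> fredholm (shifted z T)}"

text \<open>Several inequivalent essential spectra are in use for non-selfadjoint operators. Asking for
  both conditions below makes all the usual ones empty, up to the largest (Browder's): an isolated
  point \<open>z\<close> of the spectrum has a Riesz projection of finite rank iff \<open>z - T\<close> is Fredholm.\<close>

definition purely_discrete_spectrum :: "'a::complex_hilbert_space operator \<Rightarrow> bool" where
  "purely_discrete_spectrum T \<longleftrightarrow>
     essential_spectrum T = {} \<and>
     (\<forall>z \<in> spectrum T.
        z isolated_in spectrum T \<and> eigenvalue T z \<and> finite_cdim (root_space T z))"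

section \<open>The space of square integrable functions\<close>

definition square_integrable :: "('a::euclidean_space \<Rightarrow> complex) \<Rightarrow> bool" where
  "square_integrable f \<longleftrightarrow>
     f \<in> borel_measurable lebesgue \<and> integrable lebesgue (\<lambda>x. (cmod (f x))\<^sup>2)"

lemma square_integrable_measurable [measurable_dest]:
  "square_integrable f \<Longrightarrow> f \<in> borel_measurable lebesgue"
  by (simp add: square_integrable_def)

lemma square_integrable_cmult:
  assumes "square_integrable f" shows "square_integrable (\<lambda>x. c * f x)"
  using assms by (auto simp: square_integrable_def norm_mult power_mult_distrib)

lemma square_integrable_add:
  assumes "square_integrable f" "square_integrable g"
  shows "square_integrable (\<lambda>x. f x + g x)"
proof -
  have [measurable]: "f \<in> borel_measurable lebesgue" "g \<in> borel_measurable lebesgue"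
    using assms by (auto simp: square_integrable_def)
  have "integrable lebesgue (\<lambda>x. (cmod (f x + g x))\<^sup>2)"
  proof (rule Bochner_Integration.integrable_bound)
    show "integrable lebesgue (\<lambda>x. 2 * (cmod (f x))\<^sup>2 + 2 * (cmod (g x))\<^sup>2)"
      using assms by (auto simp: square_integrable_def)
    have "(cmod (f x + g x))\<^sup>2 \<le> 2 * (cmod (f x))\<^sup>2 + 2 * (cmod (g x))\<^sup>2" for x
    proof -
      have "(cmod (f x + g x))\<^sup>2 \<le> (cmod (f x) + cmod (g x))\<^sup>2"
        by (intro power_mono norm_triangle_ineq) auto
      also have "\<dots> \<le> 2 * (cmod (f x))\<^sup>2 + 2 * (cmod (g x))\<^sup>2"
        using sum_squares_bound[of "cmod (f x)" "cmod (g x)"]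
        by (simp add: power2_sum)
      finally show ?thesis .
    qed
    then show "AE x in lebesgue. norm ((cmod (f x + g x))\<^sup>2)
        \<le> norm (2 * (cmod (f x))\<^sup>2 + 2 * (cmod (g x))\<^sup>2)"
      by (intro AE_I2) (auto simp: abs_of_nonneg)
  qed measurable
  then show ?thesis by (simp add: square_integrable_def)
qed

lemma square_integrable_mult_integrable:
  assumes "square_integrable f" "square_integrable g"
  shows "integrable lebesgue (\<lambda>x. f x * cnj (g x))"
proof (rule Bochner_Integration.integrable_bound)
  have [measurable]: "f \<in> borel_measurable lebesgue" "g \<in> borel_measurable lebesgue"
    using assms by (auto simp: square_integrable_def)
  show "integrable lebesgue (\<lambda>x. (cmod (f x))\<^sup>2 + (cmod (g x))\<^sup>2)"
    using assms by (auto simp: square_integrable_def)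
  show "(\<lambda>x. f x * cnj (g x)) \<in> borel_measurable lebesgue"
  proof (rule borel_measurable_times)
    show "(\<lambda>x. cnj (g x)) \<in> borel_measurable lebesgue"
      by (rule borel_measurable_continuous_on[of cnj])
        (auto intro: continuous_on_cnj continuous_on_id)
  qed measurable
  have "cmod (f x) * cmod (g x) \<le> (cmod (f x))\<^sup>2 + (cmod (g x))\<^sup>2" for x
  proof -
    have "2 * cmod (f x) * cmod (g x) \<le> (cmod (f x))\<^sup>2 + (cmod (g x))\<^sup>2"
      by (rule sum_squares_bound)
    moreover have "0 \<le> cmod (f x) * cmod (g x)" by simp
    ultimately show ?thesis by linarith
  qed
  then show "AE x in lebesgue. norm (f x * cnj (g x))
      \<le> norm ((cmod (f x))\<^sup>2 + (cmod (g x))\<^sup>2)"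
    by (intro AE_I2) (auto simp: norm_mult abs_of_nonneg)
qed

definition L2_rel :: "('a::euclidean_space \<Rightarrow> complex) \<Rightarrow> ('a \<Rightarrow> complex) \<Rightarrow> bool" where
  "L2_rel f g \<longleftrightarrow>
     square_integrable f \<and> square_integrable g \<and> (AE x in lebesgue. f x = g x)"

lemma part_equivp_L2_rel: "part_equivp L2_rel"
proof (rule part_equivpI)
  show "\<exists>f :: 'a \<Rightarrow> complex. L2_rel f f"
    by (rule exI[of _ "\<lambda>_. 0"]) (simp add: L2_rel_def square_integrable_def)
  show "symp (L2_rel :: ('a \<Rightarrow> complex) \<Rightarrow> _)"
    by (auto intro!: sympI simp: L2_rel_def elim: AE_mp)
  show "transp (L2_rel :: ('a \<Rightarrow> complex) \<Rightarrow> _)"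
  proof (rule transpI)
    fix f g h :: "'a \<Rightarrow> complex"
    assume *: "L2_rel f g" "L2_rel g h"
    then have "AE x in lebesgue. f x = g x" "AE x in lebesgue. g x = h x"
      by (auto simp: L2_rel_def)
    then have "AE x in lebesgue. f x = h x" by eventually_elim simp
    with * show "L2_rel f h" by (simp add: L2_rel_def)
  qed
qed

quotient_type (overloaded) 'a L2 = "'a::euclidean_space \<Rightarrow> complex" / partial: L2_rel
  by (rule part_equivp_L2_rel)

text \<open>\<open>L\<^sup>2\<close> with respect to (completed) Lebesgue measure: \<^term>\<open>rep_L2 u\<close> is some representative of the class \<open>u\<close>, and \<^term>\<open>abs_L2 f\<close> is the class
  of a square integrable function \<open>f\<close>.\<close>

lemma L2_rel_rep: "L2_rel (rep_L2 u) (rep_L2 u)"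
  using Quotient3_L2 by (rule Quotient3_rep_reflp)

lemma square_integrable_rep [simp, intro]: "square_integrable (rep_L2 u)"
  using L2_rel_rep[of u] by (simp add: L2_rel_def)

lemma rep_L2_measurable [measurable]: "rep_L2 u \<in> borel_measurable lebesgue"
  using square_integrable_rep[of u] by (simp add: square_integrable_def)

lemma abs_rep_L2 [simp]: "abs_L2 (rep_L2 u) = u"
  using Quotient3_L2 by (rule Quotient3_abs_rep)

lemma rep_abs_L2: "square_integrable f \<Longrightarrow> AE x in lebesgue. rep_L2 (abs_L2 f) x = f x"
  using rep_abs_rsp_left[OF Quotient3_L2, of f f] by (simp add: L2_rel_def)

lemma L2_eq_iff: "u = v \<longleftrightarrow> (AE x in lebesgue. rep_L2 u x = rep_L2 v x)"
  using Quotient3_rel_rep[OF Quotient3_L2, of u v] by (simp add: L2_rel_def)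

instantiation L2 :: (euclidean_space) real_vector
begin

definition zero_L2 :: "'a L2" where "0 = abs_L2 (\<lambda>x. 0)"
definition plus_L2 :: "'a L2 \<Rightarrow> 'a L2 \<Rightarrow> 'a L2" where
  "u + v = abs_L2 (\<lambda>x. rep_L2 u x + rep_L2 v x)"
definition uminus_L2 :: "'a L2 \<Rightarrow> 'a L2" where
  "- u = abs_L2 (\<lambda>x. - rep_L2 u x)"
definition minus_L2 :: "'a L2 \<Rightarrow> 'a L2 \<Rightarrow> 'a L2" where
  "u - v = abs_L2 (\<lambda>x. rep_L2 u x - rep_L2 v x)"
definition scaleR_L2 :: "real \<Rightarrow> 'a L2 \<Rightarrow> 'a L2" where
  "scaleR r u = abs_L2 (\<lambda>x. complex_of_real r * rep_L2 u x)"

lemma rep_zero_L2: "AE x in lebesgue. rep_L2 (0 :: 'a L2) x = 0"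
  unfolding zero_L2_def by (rule rep_abs_L2) (simp add: square_integrable_def)

lemma rep_plus_L2: "AE x in lebesgue. rep_L2 (u + v :: 'a L2) x = rep_L2 u x + rep_L2 v x"
  unfolding plus_L2_def by (rule rep_abs_L2) (intro square_integrable_add square_integrable_rep)

lemma rep_uminus_L2: "AE x in lebesgue. rep_L2 (- u :: 'a L2) x = - rep_L2 u x"
  unfolding uminus_L2_def
  using square_integrable_cmult[OF square_integrable_rep[of u], of "- 1"]
  by (intro rep_abs_L2) simp

lemma rep_minus_L2: "AE x in lebesgue. rep_L2 (u - v :: 'a L2) x = rep_L2 u x - rep_L2 v x"
  unfolding minus_L2_def
  using square_integrable_add[OF square_integrable_rep[of u]
      square_integrable_cmult[OF square_integrable_rep[of v], of "- 1"]]
  by (intro rep_abs_L2) simp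

lemma rep_scaleR_L2:
  "AE x in lebesgue. rep_L2 (scaleR r u :: 'a L2) x = complex_of_real r * rep_L2 u x"
  unfolding scaleR_L2_def by (rule rep_abs_L2) (intro square_integrable_cmult square_integrable_rep)

instance
proof
  fix u v w :: "'a L2" and r s :: real
  show "u + v + w = u + (v + w)"
    unfolding L2_eq_iff
    using rep_plus_L2[of "u + v" w] rep_plus_L2[of u v] rep_plus_L2[of u "v + w"] rep_plus_L2[of v w]
    by eventually_elim (simp add: algebra_simps)
  show "u + v = v + u"
    unfolding L2_eq_iff using rep_plus_L2[of u v] rep_plus_L2[of v u]
    by eventually_elim (simp add: algebra_simps)
  show "0 + u = u"
    unfolding L2_eq_iff using rep_plus_L2[of 0 u] rep_zero_L2
    by eventually_elim simp
  show "- u + u = 0"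
    unfolding L2_eq_iff using rep_plus_L2[of "- u" u] rep_zero_L2 rep_uminus_L2[of u]
    by eventually_elim simp
  show "u - v = u + - v"
    unfolding L2_eq_iff using rep_plus_L2[of u "- v"] rep_minus_L2[of u v] rep_uminus_L2[of v]
    by eventually_elim simp
  show "r *\<^sub>R (u + v) = r *\<^sub>R u + r *\<^sub>R v"
    unfolding L2_eq_iff
    using rep_scaleR_L2[of r "u + v"] rep_plus_L2[of u v] rep_plus_L2[of "r *\<^sub>R u" "r *\<^sub>R v"]
      rep_scaleR_L2[of r u] rep_scaleR_L2[of r v]
    by eventually_elim (simp add: algebra_simps)
  show "(r + s) *\<^sub>R u = r *\<^sub>R u + s *\<^sub>R u"
    unfolding L2_eq_iff
    using rep_scaleR_L2[of "r + s" u] rep_plus_L2[of "r *\<^sub>R u" "s *\<^sub>R u"]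
      rep_scaleR_L2[of r u] rep_scaleR_L2[of s u]
    by eventually_elim (simp add: algebra_simps)
  show "r *\<^sub>R s *\<^sub>R u = (r * s) *\<^sub>R u"
    unfolding L2_eq_iff
    using rep_scaleR_L2[of r "s *\<^sub>R u"] rep_scaleR_L2[of s u] rep_scaleR_L2[of "r * s" u]
    by eventually_elim (simp add: algebra_simps)
  show "1 *\<^sub>R u = u"
    unfolding L2_eq_iff using rep_scaleR_L2[of 1 u] by eventually_elim simp
qed

end

lemma integrable_rep_L2_square: "integrable lebesgue (\<lambda>x. (cmod (rep_L2 u x))\<^sup>2)"
  using square_integrable_rep[of u] by (simp add: square_integrable_def)

lemma integral_rep_L2_zero_iff: "(\<integral>x. (cmod (rep_L2 u x))\<^sup>2 \<partial>lebesgue) = 0 \<longleftrightarrow> u = 0"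
proof -
  have "(\<integral>x. (cmod (rep_L2 u x))\<^sup>2 \<partial>lebesgue) = 0
      \<longleftrightarrow> (AE x in lebesgue. (cmod (rep_L2 u x))\<^sup>2 = 0)"
    by (rule integral_nonneg_eq_0_iff_AE) (auto simp: integrable_rep_L2_square)
  also have "\<dots> \<longleftrightarrow> u = 0"
  proof
    assume "AE x in lebesgue. (cmod (rep_L2 u x))\<^sup>2 = 0"
    then show "u = 0" unfolding L2_eq_iff using rep_zero_L2 by eventually_elim simp
  next
    assume "u = 0"
    then show "AE x in lebesgue. (cmod (rep_L2 u x))\<^sup>2 = 0"
      using rep_zero_L2 by (auto elim: AE_mp)
  qed
  finally show ?thesis .
qed

lemma integral_rep_L2_add_le:
  assumes "t > 0"
  shows "(\<integral>x. (cmod (rep_L2 (u + v) x))\<^sup>2 \<partial>lebesgue)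
    \<le> (1 + t) * (\<integral>x. (cmod (rep_L2 u x))\<^sup>2 \<partial>lebesgue)
      + (1 + 1 / t) * (\<integral>x. (cmod (rep_L2 v x))\<^sup>2 \<partial>lebesgue)"
proof -
  have le: "(cmod (a + b))\<^sup>2 \<le> (1 + t) * (cmod a)\<^sup>2 + (1 + 1 / t) * (cmod b)\<^sup>2" for a b
  proof -
    have "(cmod (a + b))\<^sup>2 \<le> (cmod a + cmod b)\<^sup>2"
      by (intro power_mono norm_triangle_ineq) auto
    moreover have "0 \<le> (t * cmod a - cmod b)\<^sup>2 / t" using assms by simp
    moreover have "(t * cmod a - cmod b)\<^sup>2 / t
        = (1 + t) * (cmod a)\<^sup>2 + (1 + 1 / t) * (cmod b)\<^sup>2 - (cmod a + cmod b)\<^sup>2"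
      using assms by (simp add: field_simps power2_eq_square)
    ultimately show ?thesis by linarith
  qed
  have "(\<integral>x. (cmod (rep_L2 (u + v) x))\<^sup>2 \<partial>lebesgue)
      \<le> (\<integral>x. (1 + t) * (cmod (rep_L2 u x))\<^sup>2 + (1 + 1 / t) * (cmod (rep_L2 v x))\<^sup>2 \<partial>lebesgue)"
  proof (rule integral_mono_AE)
    show "AE x in lebesgue. (cmod (rep_L2 (u + v) x))\<^sup>2
        \<le> (1 + t) * (cmod (rep_L2 u x))\<^sup>2 + (1 + 1 / t) * (cmod (rep_L2 v x))\<^sup>2"
      using rep_plus_L2[of u v] by eventually_elim (simp only: le)
  qed (intro Bochner_Integration.integrable_add integrable_mult_right integrable_rep_L2_square)+
  also have "\<dots> = (1 + t) * (\<integral>x. (cmod (rep_L2 u x))\<^sup>2 \<partial>lebesgue)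
      + (1 + 1 / t) * (\<integral>x. (cmod (rep_L2 v x))\<^sup>2 \<partial>lebesgue)"
    by (simp add: integrable_rep_L2_square)
  finally show ?thesis .
qed

instantiation L2 :: (euclidean_space) real_normed_vector
begin

definition norm_L2 :: "'a L2 \<Rightarrow> real" where
  "norm u = sqrt (\<integral>x. (cmod (rep_L2 u x))\<^sup>2 \<partial>lebesgue)"
definition sgn_L2 :: "'a L2 \<Rightarrow> 'a L2" where
  "sgn_L2 u = u /\<^sub>R norm u"
definition dist_L2 :: "'a L2 \<Rightarrow> 'a L2 \<Rightarrow> real" where
  "dist_L2 u v = norm (u - v)"
definition uniformity_L2 :: "('a L2 \<times> 'a L2) filter" where
  "uniformity = (INF e\<in>{0<..}. principal {(u, v :: 'a L2). dist u v < e})"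
definition open_L2 :: "'a L2 set \<Rightarrow> bool" where
  "open_L2 U \<longleftrightarrow> (\<forall>u\<in>U. eventually (\<lambda>(u', v). u' = u \<longrightarrow> v \<in> U) uniformity)"

instance
proof
  fix u v :: "'a L2" and r :: real
  show "dist u v = norm (u - v)" by (rule dist_L2_def)
  show "sgn u = u /\<^sub>R norm u" by (rule sgn_L2_def)
  show "uniformity = (INF e\<in>{0<..}. principal {(u, v :: 'a L2). dist u v < e})"
    by (rule uniformity_L2_def)
  show "open U \<longleftrightarrow> (\<forall>u\<in>U. eventually (\<lambda>(u', v). u' = u \<longrightarrow> v \<in> U) uniformity)"
    for U :: "'a L2 set"
    by (rule open_L2_def)
  show "norm u = 0 \<longleftrightarrow> u = 0"
    by (simp add: norm_L2_def integral_rep_L2_zero_iff)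
  have sq: "(norm w)\<^sup>2 = (\<integral>x. (cmod (rep_L2 w x))\<^sup>2 \<partial>lebesgue)" and nonneg: "norm w \<ge> 0"
    for w :: "'a L2"
    by (simp_all add: norm_L2_def)
  show "norm (u + v) \<le> norm u + norm v"
  proof (cases "u = 0 \<or> v = 0")
    case True
    then show ?thesis using nonneg by auto
  next
    case False
    then have pos: "norm u > 0" "norm v > 0"
      by (simp_all add: norm_L2_def integral_rep_L2_zero_iff less_le)
    have "(norm (u + v))\<^sup>2
        \<le> (1 + norm v / norm u) * (norm u)\<^sup>2 + (1 + 1 / (norm v / norm u)) * (norm v)\<^sup>2"
      unfolding sq by (rule integral_rep_L2_add_le) (use pos in simp)
    also have "\<dots> = (norm u + norm v)\<^sup>2"
      using pos by (simp add: field_simps power2_eq_square)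
    finally show ?thesis by (rule power2_le_imp_le) (use pos in simp)
  qed
  have "(\<integral>x. (cmod (rep_L2 (r *\<^sub>R u) x))\<^sup>2 \<partial>lebesgue)
      = (\<integral>x. r\<^sup>2 * (cmod (rep_L2 u x))\<^sup>2 \<partial>lebesgue)"
  proof (rule integral_cong_AE)
    show "AE x in lebesgue. (cmod (rep_L2 (r *\<^sub>R u) x))\<^sup>2 = r\<^sup>2 * (cmod (rep_L2 u x))\<^sup>2"
      using rep_scaleR_L2[of r u] by eventually_elim (simp add: norm_mult power_mult_distrib)
  qed measurable
  then show "norm (r *\<^sub>R u) = \<bar>r\<bar> * norm u"
    by (simp add: norm_L2_def real_sqrt_mult)
qed

end

instantiation L2 :: (euclidean_space) real_inner
begin

definition inner_L2 :: "'a L2 \<Rightarrow> 'a L2 \<Rightarrow> real" where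
  "inner u v = Re (\<integral>x. rep_L2 u x * cnj (rep_L2 v x) \<partial>lebesgue)"

lemma inner_L2_self: "inner u u = (\<integral>x. (cmod (rep_L2 u x))\<^sup>2 \<partial>lebesgue)" for u :: "'a L2"
proof -
  have "inner u u = (\<integral>x. Re (rep_L2 u x * cnj (rep_L2 u x)) \<partial>lebesgue)"
    unfolding inner_L2_def
    by (rule integral_Re[symmetric]) (simp add: square_integrable_mult_integrable)
  also have "\<dots> = (\<integral>x. (cmod (rep_L2 u x))\<^sup>2 \<partial>lebesgue)"
    by (simp only: complex_norm_square[symmetric] Re_complex_of_real)
  finally show ?thesis .
qed

instance
proof
  fix u v w :: "'a L2" and r :: real
  show "norm u = sqrt (inner u u)" by (simp add: norm_L2_def inner_L2_self)
  show "inner u v = inner v u"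
  proof -
    have "(\<integral>x. rep_L2 u x * cnj (rep_L2 v x) \<partial>lebesgue)
        = (\<integral>x. cnj (rep_L2 v x * cnj (rep_L2 u x)) \<partial>lebesgue)"
      by (rule Bochner_Integration.integral_cong)
        (simp_all only: complex_cnj_mult complex_cnj_cnj mult.commute)
    also have "\<dots> = cnj (\<integral>x. rep_L2 v x * cnj (rep_L2 u x) \<partial>lebesgue)"
      by (rule Bochner_Integration.integral_cnj)
    finally have "(\<integral>x. rep_L2 u x * cnj (rep_L2 v x) \<partial>lebesgue)
        = cnj (\<integral>x. rep_L2 v x * cnj (rep_L2 u x) \<partial>lebesgue)" .
    then show ?thesis by (simp add: inner_L2_def)
  qed
  show "inner (u + v) w = inner u w + inner v w"
  proof -
    have "(\<integral>x. rep_L2 (u + v) x * cnj (rep_L2 w x) \<partial>lebesgue)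
        = (\<integral>x. rep_L2 u x * cnj (rep_L2 w x) + rep_L2 v x * cnj (rep_L2 w x) \<partial>lebesgue)"
    proof (rule integral_cong_AE)
      show "(\<lambda>x. rep_L2 (u + v) x * cnj (rep_L2 w x)) \<in> borel_measurable lebesgue"
        by (intro borel_measurable_integrable square_integrable_mult_integrable square_integrable_rep)
      show "(\<lambda>x. rep_L2 u x * cnj (rep_L2 w x) + rep_L2 v x * cnj (rep_L2 w x))
          \<in> borel_measurable lebesgue"
        by (intro borel_measurable_add borel_measurable_integrable
            square_integrable_mult_integrable square_integrable_rep)
      show "AE x in lebesgue. rep_L2 (u + v) x * cnj (rep_L2 w x)
          = rep_L2 u x * cnj (rep_L2 w x) + rep_L2 v x * cnj (rep_L2 w x)"
        using rep_plus_L2[of u v] by eventually_elim (simp add: algebra_simps)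
    qed
    then show ?thesis
      by (simp add: inner_L2_def square_integrable_mult_integrable)
  qed
  show "inner (r *\<^sub>R u) v = r * inner u v"
  proof -
    have "(\<integral>x. rep_L2 (r *\<^sub>R u) x * cnj (rep_L2 v x) \<partial>lebesgue)
        = (\<integral>x. complex_of_real r * (rep_L2 u x * cnj (rep_L2 v x)) \<partial>lebesgue)"
    proof (rule integral_cong_AE)
      show "(\<lambda>x. rep_L2 (r *\<^sub>R u) x * cnj (rep_L2 v x)) \<in> borel_measurable lebesgue"
        by (intro borel_measurable_integrable square_integrable_mult_integrable square_integrable_rep)
      show "(\<lambda>x. complex_of_real r * (rep_L2 u x * cnj (rep_L2 v x))) \<in> borel_measurable lebesgue"
        by (intro borel_measurable_integrable integrable_mult_right
            square_integrable_mult_integrable square_integrable_rep)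
      show "AE x in lebesgue. rep_L2 (r *\<^sub>R u) x * cnj (rep_L2 v x)
          = complex_of_real r * (rep_L2 u x * cnj (rep_L2 v x))"
        using rep_scaleR_L2[of r u] by eventually_elim simp
    qed
    then show ?thesis by (simp add: inner_L2_def)
  qed
  show "0 \<le> inner u u"
    by (simp add: inner_L2_self)
  show "inner u u = 0 \<longleftrightarrow> u = 0"
    by (simp add: inner_L2_self integral_rep_L2_zero_iff)
qed

end

lemma norm_L2_square: "(norm u)\<^sup>2 = (\<integral>x. (cmod (rep_L2 u x))\<^sup>2 \<partial>lebesgue)"
  by (simp add: power2_norm_eq_inner inner_L2_self)

lemma nn_integral_L2:
  "(\<integral>\<^sup>+x. ennreal ((cmod (rep_L2 u x))\<^sup>2) \<partial>lebesgue) = ennreal ((norm u)\<^sup>2)"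
  unfolding norm_L2_square
  using square_integrable_rep[of u]
  by (intro nn_integral_eq_integral) (auto simp: square_integrable_def)

lemma nn_integral_L2_diff:
  "(\<integral>\<^sup>+x. ennreal ((cmod (rep_L2 u x - rep_L2 v x))\<^sup>2) \<partial>lebesgue) = ennreal ((dist u v)\<^sup>2)"
proof -
  have "(\<integral>\<^sup>+x. ennreal ((cmod (rep_L2 u x - rep_L2 v x))\<^sup>2) \<partial>lebesgue)
      = (\<integral>\<^sup>+x. ennreal ((cmod (rep_L2 (u - v) x))\<^sup>2) \<partial>lebesgue)"
    using rep_minus_L2[of u v] by (intro nn_integral_cong_AE) (auto elim: AE_mp)
  then show ?thesis by (simp add: nn_integral_L2 dist_norm)
qed

text \<open>Riesz--Fischer\<close>

instance L2 :: (euclidean_space) complete_space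
proof
  fix X :: "nat \<Rightarrow> 'a L2"
  assume X: "Cauchy X"
  have "\<exists>N. \<forall>m\<ge>N. \<forall>n\<ge>N. dist (X m) (X n) < (1/2)^k" for k
    using X by (auto simp: Cauchy_def)
  then obtain N where N: "\<And>k m n. m \<ge> N k \<Longrightarrow> n \<ge> N k \<Longrightarrow> dist (X m) (X n) < (1/2)^k"
    by metis
  define r where "r = rec_nat (N 0) (\<lambda>k p. max (Suc p) (N (Suc k)))"
  have r_Suc: "r (Suc k) = max (Suc (r k)) (N (Suc k))" for k by (simp add: r_def)
  have r_mono: "strict_mono r" by (rule strict_mono_Suc_iff[THEN iffD2]) (simp add: r_Suc less_max_iff_disj)
  have r_N: "r k \<ge> N k" for k by (cases k) (auto simp: r_Suc, simp add: r_def)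
  have close: "dist (X (r m)) (X (r n)) \<le> (1/2)^k" if "m \<ge> k" "n \<ge> k" for m n k
  proof -
    have "r m \<ge> N k" "r n \<ge> N k"
      using that r_N[of k] strict_mono_leD[OF r_mono] by (meson le_trans)+
    then show ?thesis using N by (simp add: less_imp_le)
  qed
  define F where "F n = rep_L2 (X (r n))" for n
  have F_meas [measurable]: "F n \<in> borel_measurable lebesgue" for n by (simp add: F_def)
  define D where "D n x = ennreal (2^n * (cmod (F (Suc n) x - F n x))\<^sup>2)" for n x
  have D_meas [measurable]: "D n \<in> borel_measurable lebesgue" for n unfolding D_def by measurable
  have D_int: "(\<integral>\<^sup>+x. D n x \<partial>lebesgue) \<le> ennreal ((1/2)^n)" for n
  proof -
    have "(\<integral>\<^sup>+x. D n x \<partial>lebesgue)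
        = ennreal (2^n) * (\<integral>\<^sup>+x. ennreal ((cmod (F (Suc n) x - F n x))\<^sup>2) \<partial>lebesgue)"
      unfolding D_def by (subst nn_integral_cmult[symmetric]) (auto simp: ennreal_mult)
    also have "\<dots> = ennreal (2^n) * ennreal ((dist (X (r (Suc n))) (X (r n)))\<^sup>2)"
      by (simp add: F_def nn_integral_L2_diff)
    also have "\<dots> \<le> ennreal (2^n) * ennreal (((1/2)^n)\<^sup>2)"
      by (intro mult_left_mono ennreal_leI power_mono close) auto
    also have "\<dots> = ennreal ((1/2)^n)"
      by (simp add: ennreal_mult[symmetric] power2_eq_square power_one_over)
    finally show ?thesis .
  qed
  have "(\<integral>\<^sup>+x. (\<Sum>n. D n x) \<partial>lebesgue) = (\<Sum>n. \<integral>\<^sup>+x. D n x \<partial>lebesgue)"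
    by (rule nn_integral_suminf) measurable
  also have "\<dots> \<le> (\<Sum>n. ennreal ((1/2)^n))"
    by (intro suminf_le D_int) auto
  also have "\<dots> = ennreal (\<Sum>n. (1/2)^n)"
    by (intro suminf_ennreal2 summable_geometric) auto
  also have "\<dots> < \<infinity>" by simp
  finally have "AE x in lebesgue. (\<Sum>n. D n x) \<noteq> \<infinity>"
    by (intro nn_integral_noteq_infinite) auto
  then have conv: "AE x in lebesgue. convergent (\<lambda>n. F n x)"
  proof eventually_elim
    case (elim x)
    have S: "summable (\<lambda>n. 2^n * (cmod (F (Suc n) x - F n x))\<^sup>2)"
      using elim unfolding D_def by (intro summable_suminf_not_top) auto
    then obtain M where M: "\<And>n. 2^n * (cmod (F (Suc n) x - F n x))\<^sup>2 \<le> M"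
      using summable_imp_Bseq[of "\<lambda>n. 2^n * (cmod (F (Suc n) x - F n x))\<^sup>2"]
      by (force simp: Bseq_def)
    define q :: real where "q = sqrt (1/2)"
    have q: "0 \<le> q" "q < 1" by (simp_all add: q_def real_sqrt_lt_1_iff)
    have le: "norm (F (Suc n) x - F n x) \<le> sqrt M * q^n" for n
    proof -
      have "(cmod (F (Suc n) x - F n x))\<^sup>2 \<le> M * (1/2)^n"
        using M[of n] by (simp add: field_simps power_one_over)
      then have "cmod (F (Suc n) x - F n x) \<le> sqrt (M * (1/2)^n)"
        by (rule real_le_rsqrt)
      then show ?thesis unfolding q_def real_sqrt_mult real_sqrt_power .
    qed
    have "summable (\<lambda>n. sqrt M * q^n)"
      by (intro summable_mult summable_geometric) (use q in simp)
    then have "summable (\<lambda>n. F (Suc n) x - F n x)"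
      by (rule summable_comparison_test'[where N = 0]) (rule le)
    then have "convergent (\<lambda>n. \<Sum>i<n. F (Suc i) x - F i x)"
      by (simp add: summable_iff_convergent)
    then have "convergent (\<lambda>n. F n x - F 0 x)"
      by (simp only: sum_lessThan_telescope[of "\<lambda>n. F n x"])
    then have "convergent (\<lambda>n. (F n x - F 0 x) + F 0 x)"
      by (intro convergent_add convergent_const)
    then show ?case by simp
  qed
  define G where "G x = lim (\<lambda>n. F n x)" for x
  have G_meas [measurable]: "G \<in> borel_measurable lebesgue"
    unfolding G_def by (rule borel_measurable_lim_metric) measurable
  have G_close: "(\<integral>\<^sup>+x. ennreal ((cmod (G x - F k x))\<^sup>2) \<partial>lebesgue) \<le> ennreal (((1/2)^k)\<^sup>2)" for k
  proof -
    have "(\<integral>\<^sup>+x. ennreal ((cmod (G x - F k x))\<^sup>2) \<partial>lebesgue)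
        = (\<integral>\<^sup>+x. liminf (\<lambda>m. ennreal ((cmod (F m x - F k x))\<^sup>2)) \<partial>lebesgue)"
    proof (rule nn_integral_cong_AE)
      show "AE x in lebesgue. ennreal ((cmod (G x - F k x))\<^sup>2)
          = liminf (\<lambda>m. ennreal ((cmod (F m x - F k x))\<^sup>2))"
        using conv
      proof eventually_elim
        case (elim x)
        then have "(\<lambda>n. F n x) \<longlonglongrightarrow> G x" by (simp add: G_def convergent_LIMSEQ_iff)
        then have "(\<lambda>m. ennreal ((cmod (F m x - F k x))\<^sup>2)) \<longlonglongrightarrow> ennreal ((cmod (G x - F k x))\<^sup>2)"
          by (intro tendsto_ennrealI tendsto_intros)
        from lim_imp_Liminf[OF sequentially_bot this] show ?case by (rule sym)
      qed
    qed
    also have "\<dots> \<le> liminf (\<lambda>m. \<integral>\<^sup>+x. ennreal ((cmod (F m x - F k x))\<^sup>2) \<partial>lebesgue)"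
      by (rule nn_integral_liminf) measurable
    also have "\<dots> \<le> liminf (\<lambda>m::nat. ennreal (((1/2)^k)\<^sup>2))"
    proof (rule Liminf_mono)
      show "\<forall>\<^sub>F m in sequentially. (\<integral>\<^sup>+x. ennreal ((cmod (F m x - F k x))\<^sup>2) \<partial>lebesgue)
          \<le> ennreal (((1/2)^k)\<^sup>2)"
        using eventually_ge_at_top[of k]
      proof eventually_elim
        case (elim m)
        then show ?case
          unfolding F_def nn_integral_L2_diff by (intro ennreal_leI power_mono close) auto
      qed
    qed
    also have "\<dots> = ennreal (((1/2)^k)\<^sup>2)" by (simp add: Liminf_const)
    finally show ?thesis .
  qed
  have "square_integrable (\<lambda>x. G x - F 0 x)"
  proof -
    have "(\<integral>\<^sup>+x. ennreal ((cmod (G x - F 0 x))\<^sup>2) \<partial>lebesgue) < \<infinity>"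
      using G_close[of 0] by (auto intro: le_less_trans)
    then have "integrable lebesgue (\<lambda>x. (cmod (G x - F 0 x))\<^sup>2)"
      by (intro integrableI_nonneg) auto
    then show ?thesis by (simp add: square_integrable_def)
  qed
  then have "square_integrable (\<lambda>x. (G x - F 0 x) + F 0 x)"
    by (rule square_integrable_add) (simp add: F_def)
  then have G: "square_integrable G" by simp
  have "dist (X (r k)) (abs_L2 G) \<le> (1/2)^k" for k
  proof -
    have "ennreal ((dist (abs_L2 G) (X (r k)))\<^sup>2)
        = (\<integral>\<^sup>+x. ennreal ((cmod (rep_L2 (abs_L2 G) x - rep_L2 (X (r k)) x))\<^sup>2) \<partial>lebesgue)"
      by (simp add: nn_integral_L2_diff)
    also have "\<dots> = (\<integral>\<^sup>+x. ennreal ((cmod (G x - F k x))\<^sup>2) \<partial>lebesgue)"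
      using rep_abs_L2[OF G] by (intro nn_integral_cong_AE) (auto simp: F_def elim: AE_mp)
    also have "\<dots> \<le> ennreal (((1/2)^k)\<^sup>2)" by (rule G_close)
    finally have "(dist (abs_L2 G) (X (r k)))\<^sup>2 \<le> ((1/2)^k)\<^sup>2"
      by (simp add: ennreal_le_iff)
    then have "dist (abs_L2 G) (X (r k)) \<le> (1/2)^k"
      by (rule power2_le_imp_le) simp
    then show ?thesis by (simp add: dist_commute)
  qed
  then have "(\<lambda>k. dist (X (r k)) (abs_L2 G)) \<longlonglongrightarrow> 0"
    by (intro tendsto_sandwich[OF _ _ tendsto_const LIMSEQ_power_zero[of "1/2 :: real"]]) auto
  then have "(X \<circ> r) \<longlonglongrightarrow> abs_L2 G"
    by (simp add: tendsto_dist_iff[symmetric] o_def)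
  then have "X \<longlonglongrightarrow> abs_L2 G"
    using Cauchy_converges_subseq[OF X r_mono] by simp
  then show "convergent X" by (rule convergentI)
qed

instantiation L2 :: (euclidean_space) complex_hilbert_space
begin

definition scaleC_L2 :: "complex \<Rightarrow> 'a L2 \<Rightarrow> 'a L2" where
  "c *\<^sub>C u = abs_L2 (\<lambda>x. c * rep_L2 u x)"

definition cinner_L2 :: "'a L2 \<Rightarrow> 'a L2 \<Rightarrow> complex" where
  "cinner u v = (\<integral>x. rep_L2 u x * cnj (rep_L2 v x) \<partial>lebesgue)"

lemma rep_scaleC_L2: "AE x in lebesgue. rep_L2 (c *\<^sub>C u :: 'a L2) x = c * rep_L2 u x"
  unfolding scaleC_L2_def by (rule rep_abs_L2) (intro square_integrable_cmult square_integrable_rep)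

instance
proof
  fix u v w :: "'a L2" and c d :: complex and r :: real
  show "c *\<^sub>C (u + v) = c *\<^sub>C u + c *\<^sub>C v"
    unfolding L2_eq_iff
    using rep_scaleC_L2[of c "u + v"] rep_plus_L2[of u v] rep_plus_L2[of "c *\<^sub>C u" "c *\<^sub>C v"]
      rep_scaleC_L2[of c u] rep_scaleC_L2[of c v]
    by eventually_elim (simp add: algebra_simps)
  show "(c + d) *\<^sub>C u = c *\<^sub>C u + d *\<^sub>C u"
    unfolding L2_eq_iff
    using rep_scaleC_L2[of "c + d" u] rep_plus_L2[of "c *\<^sub>C u" "d *\<^sub>C u"]
      rep_scaleC_L2[of c u] rep_scaleC_L2[of d u]
    by eventually_elim (simp add: algebra_simps)
  show "c *\<^sub>C d *\<^sub>C u = (c * d) *\<^sub>C u"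
    unfolding L2_eq_iff
    using rep_scaleC_L2[of c "d *\<^sub>C u"] rep_scaleC_L2[of d u] rep_scaleC_L2[of "c * d" u]
    by eventually_elim (simp add: algebra_simps)
  show "r *\<^sub>R u = complex_of_real r *\<^sub>C u"
    by (simp add: scaleR_L2_def scaleC_L2_def)
  show "cinner u v = cnj (cinner v u)"
  proof -
    have "cinner u v = (\<integral>x. cnj (rep_L2 v x * cnj (rep_L2 u x)) \<partial>lebesgue)"
      unfolding cinner_L2_def
      by (rule Bochner_Integration.integral_cong)
        (simp_all only: complex_cnj_mult complex_cnj_cnj mult.commute)
    also have "\<dots> = cnj (cinner v u)"
      unfolding cinner_L2_def by (rule Bochner_Integration.integral_cnj)
    finally show ?thesis .
  qed
  show "cinner (u + v) w = cinner u w + cinner v w"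
  proof -
    have "cinner (u + v) w
        = (\<integral>x. rep_L2 u x * cnj (rep_L2 w x) + rep_L2 v x * cnj (rep_L2 w x) \<partial>lebesgue)"
      unfolding cinner_L2_def
    proof (rule integral_cong_AE)
      show "(\<lambda>x. rep_L2 (u + v) x * cnj (rep_L2 w x)) \<in> borel_measurable lebesgue"
        by (intro borel_measurable_integrable square_integrable_mult_integrable square_integrable_rep)
      show "(\<lambda>x. rep_L2 u x * cnj (rep_L2 w x) + rep_L2 v x * cnj (rep_L2 w x))
          \<in> borel_measurable lebesgue"
        by (intro borel_measurable_add borel_measurable_integrable
            square_integrable_mult_integrable square_integrable_rep)
      show "AE x in lebesgue. rep_L2 (u + v) x * cnj (rep_L2 w x)
          = rep_L2 u x * cnj (rep_L2 w x) + rep_L2 v x * cnj (rep_L2 w x)"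
        using rep_plus_L2[of u v] by eventually_elim (simp add: algebra_simps)
    qed
    then show ?thesis
      by (simp add: cinner_L2_def square_integrable_mult_integrable)
  qed
  show "cinner (c *\<^sub>C u) v = c * cinner u v"
  proof -
    have "cinner (c *\<^sub>C u) v = (\<integral>x. c * (rep_L2 u x * cnj (rep_L2 v x)) \<partial>lebesgue)"
      unfolding cinner_L2_def
    proof (rule integral_cong_AE)
      show "(\<lambda>x. rep_L2 (c *\<^sub>C u) x * cnj (rep_L2 v x)) \<in> borel_measurable lebesgue"
        by (intro borel_measurable_integrable square_integrable_mult_integrable square_integrable_rep)
      show "(\<lambda>x. c * (rep_L2 u x * cnj (rep_L2 v x))) \<in> borel_measurable lebesgue"
        by (intro borel_measurable_integrable integrable_mult_right
            square_integrable_mult_integrable square_integrable_rep)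
      show "AE x in lebesgue. rep_L2 (c *\<^sub>C u) x * cnj (rep_L2 v x)
          = c * (rep_L2 u x * cnj (rep_L2 v x))"
        using rep_scaleC_L2[of c u] by eventually_elim simp
    qed
    then show ?thesis by (simp add: cinner_L2_def)
  qed
  show "inner u v = Re (cinner u v)"
    by (simp add: inner_L2_def cinner_L2_def)
qed

end

section \<open>Schroedinger operators\<close>

primrec Ck :: "nat \<Rightarrow> ('a::euclidean_space \<Rightarrow> complex) \<Rightarrow> bool" where
  "Ck 0 f \<longleftrightarrow> continuous_on UNIV f"
| "Ck (Suc k) f \<longleftrightarrow>
     (\<forall>x. f differentiable (at x)) \<and> (\<forall>b\<in>Basis. Ck k (\<lambda>x. frechet_derivative f (at x) b))"

definition test_functions :: "('a::euclidean_space \<Rightarrow> complex) set" where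
  "test_functions = {\<phi>. (\<forall>k. Ck k \<phi>) \<and> compact (closure {x. \<phi> x \<noteq> 0})}"

definition weak_partial :: "'a::euclidean_space \<Rightarrow> 'a L2 \<Rightarrow> 'a L2 \<Rightarrow> bool" where
  \<comment> \<open>\<open>g\<close> is the distributional derivative of \<open>u\<close> in the direction \<open>b\<close>\<close>
  "weak_partial b u g \<longleftrightarrow>
     (\<forall>\<phi>\<in>test_functions.
        (\<integral>x. rep_L2 u x * frechet_derivative \<phi> (at x) b \<partial>lebesgue)
          = - (\<integral>x. rep_L2 g x * \<phi> x \<partial>lebesgue))"

definition sobolev_H1 :: "'a::euclidean_space L2 set" where
  "sobolev_H1 = {u. \<forall>b\<in>Basis. \<exists>g. weak_partial b u g}"

definition dpartial :: "'a::euclidean_space \<Rightarrow> 'a L2 \<Rightarrow> 'a L2" where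
  "dpartial b u = (THE g. weak_partial b u g)"

definition dirichlet_form :: "'a::euclidean_space L2 \<Rightarrow> 'a L2 \<Rightarrow> complex" where
  "dirichlet_form u v = (\<Sum>b\<in>Basis. cinner (dpartial b u) (dpartial b v))"

definition potential_form_domain :: "('a::euclidean_space \<Rightarrow> real) \<Rightarrow> 'a L2 set" where
  "potential_form_domain W = {u. integrable lebesgue (\<lambda>x. W x * (cmod (rep_L2 u x))\<^sup>2)}"

definition potential_form ::
    "('a::euclidean_space \<Rightarrow> real) \<Rightarrow> 'a L2 \<Rightarrow> 'a L2 \<Rightarrow> complex" where
  "potential_form W u v =
     (\<integral>x. complex_of_real (W x) * (rep_L2 u x * cnj (rep_L2 v x)) \<partial>lebesgue)"

text \<open>The operator associated with a sesquilinear form \<open>q\<close> with domain \<open>Q\<close>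
  (Kato's representation theorem).\<close>

definition form_operator ::
    "'a::complex_hilbert_space set \<Rightarrow> ('a \<Rightarrow> 'a \<Rightarrow> complex) \<Rightarrow> 'a operator" where
  "form_operator Q q = {(u, f). u \<in> Q \<and> (\<forall>v\<in>Q. q u v = cinner f v)}"

text \<open>\<open>-\<Delta> + W\<close> for a real potential \<open>W \<ge> 0\<close>, as the sum of the quadratic forms of \<open>-\<Delta>\<close> and of
  \<open>W\<close>. For locally integrable \<open>W\<close> this is also the maximal distributional realization (Kato), and
  for \<open>W = 0\<close> it is \<open>-\<Delta>\<close> on the Sobolev space of order two. If the literal sum, on the
  intersection of the domains of \<open>-\<Delta>\<close> and \<open>W\<close>, is densely defined with non-empty resolvent set,
  then it is selfadjoint and equal to this operator.\<close>

definition schroedinger :: "('a::euclidean_space \<Rightarrow> real) \<Rightarrow> 'a L2 operator" where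
  "schroedinger W =
     form_operator (sobolev_H1 \<inter> potential_form_domain W)
       (\<lambda>u v. dirichlet_form u v + potential_form W u v)"

text \<open>Multiplication by \<open>m\<close> on its maximal domain.\<close>

definition mult_op :: "('a::euclidean_space \<Rightarrow> complex) \<Rightarrow> 'a L2 operator" where
  "mult_op m = {(u, f). AE x in lebesgue. rep_L2 f x = m x * rep_L2 u x}"

end

theory Submission
  imports Defs
begin

text \<open>
  The operator \<open>T = - \<Delta> + Re V\<close> has compact resolvent because the potential is confining: a bounded set
  of the form domain consists of functions with bounded gradients and with little mass where \<open>Re V\<close> is
  large, and such a set is relatively compact in \<open>L\<^sup>2\<close> (\<open>compact_closure_energy_ball\<close>). The resolvent of \<open>T\<close>
  maps bounded sets to such sets, at any point of the resolvent set; such a point exists by the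
  definition of relative compactness.

  The perturbation \<open>A = i Im V\<close> is skew-symmetric, so \<open>T + A\<close> is accretive and \<open>1 + T + A\<close> is injective. Relative
  compactness makes \<open>- 1 - (T + A)\<close> equal to \<open>(1 - C) (z - T)\<close> with a compact \<open>C\<close>, and the Fredholm
  alternative turns injectivity into invertibility. Hence \<open>- 1\<close> is in the resolvent set of \<open>T + A\<close>, with a compact
  resolvent \<open>K\<close> (\<open>purely_discrete_spectrum_accretive_perturbation\<close>).

  A compact resolvent implies a purely discrete spectrum by the Riesz theory of compact maps, because
  \<open>z - (T + A)\<close> is \<open>1 - \<mu> K\<close>, \<open>\<mu> = - 1 - z\<close>, composed with an invertible operator. Finite dimension
  of root spaces, finite codimension of ranges and discreteness of eigenvalues all follow from one fact
  (\<open>no_triangular_sequence\<close>): a compact map does not admit a strictly increasing chain of closed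
  subspaces, each mapped into the previous one by \<open>1 - \<mu> k K\<close> with bounded \<open>\<mu> k\<close>.

  For the compactness of energy balls, a weak derivative \<open>g\<close> of \<open>u\<close> in direction \<open>v\<close> bounds the
  difference between \<open>u\<close> and its translate by \<open>v\<close> in \<open>L\<^sup>2\<close> (\<open>translation_estimate\<close>). Averaging over translations gives a Poincare
  inequality on small cubes (\<open>piecewise_poincare\<close>), so functions of bounded energy are uniformly close
  to step functions from a bounded set in a finite-dimensional space. Weak derivatives only speak about
  test functions; products of one-dimensional bumps approximate indicators of boxes, and therefore
  test functions detect almost everywhere equality (\<open>fundamental_lemma\<close>).
\<close>

section \<open>Complex Hilbert spaces\<close>

interpretation cvs: vector_space "(*\<^sub>C) :: complex \<Rightarrow> 'a::complex_hilbert_space \<Rightarrow> 'a"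
  by (rule vector_space_scaleC)

lemma norm_scaleC: "norm (c *\<^sub>C (x::'a::complex_hilbert_space)) = cmod c * norm x"
proof -
  have "cinner (c *\<^sub>C x) (c *\<^sub>C x) = c * cnj c * cinner x x"
    using cinner_commute[of x "c *\<^sub>C x"] cinner_commute[of x x]
    by (simp add: cinner_scaleC_left)
  also have "\<dots> = complex_of_real ((cmod c)\<^sup>2) * cinner x x"
    by (simp only: complex_norm_square)
  finally have "(norm (c *\<^sub>C x))\<^sup>2 = (cmod c * norm x)\<^sup>2"
    by (simp add: power2_norm_eq_inner inner_eq_Re_cinner power_mult_distrib)
  then show ?thesis by simp
qed

lemma Re_cinner_le: "Re (cinner x y) \<le> norm x * norm (y::'a::complex_hilbert_space)"
  using norm_cauchy_schwarz[of x y] by (simp add: inner_eq_Re_cinner)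

lemma bounded_linear_scaleC_right: "bounded_linear ((*\<^sub>C) c :: 'a::complex_hilbert_space \<Rightarrow> 'a)"
  by (rule bounded_linear_intro[of _ "cmod c"])
    (simp_all add: scaleC_add_right scaleR_scaleC scaleC_scaleC norm_scaleC mult.commute)

lemma bounded_linear_scaleC_left:
  "bounded_linear (\<lambda>c. c *\<^sub>C (x::'a::complex_hilbert_space))"
  by (rule bounded_linear_intro[of _ "norm x"])
    (simp_all add: scaleC_add_left scaleR_scaleC scaleC_scaleC norm_scaleC scaleR_conv_of_real)

lemma subspace_of_csubspace: "cvs.subspace N \<Longrightarrow> subspace N"
  by (auto simp: cvs.subspace_def subspace_def scaleR_scaleC)

text \<open>In an infinite-dimensional space the nearest point of a subspace need not be at hand, but an almost
nearest one suffices: subtract from \<^term>\<open>x\<close> a point of \<^term>\<open>N\<close> whose distance to it is within a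
factor two of the infimum, and normalize. Iterated along a chain of closed subspaces, this
produces bounded sequences with no convergent subsequence.\<close>

lemma riesz_lemma:
  fixes N M :: "'a::real_normed_vector set"
  assumes "closed N" "subspace N" "subspace M" "N \<subseteq> M" "x \<in> M" "x \<notin> N"
  obtains y where "y \<in> M" "norm y = 1" "\<And>n. n \<in> N \<Longrightarrow> 1/2 \<le> norm (y - n)"
proof -
  define d where "d = infdist x N"
  have ne: "N \<noteq> {}" using assms(2) subspace_0 by auto
  have d: "d > 0"
    unfolding d_def using infdist_pos_not_in_closed[OF assms(1) ne assms(6)] .
  have le: "d \<le> dist x n" if "n \<in> N" for n
    unfolding d_def using that by (rule infdist_le)
  have "\<exists>n0\<in>N. dist x n0 < 2 * d"
  proof (rule ccontr)
    assume "\<not> ?thesis"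
    then have "2 * d \<le> infdist x N"
      unfolding infdist_notempty[OF ne] by (intro cINF_greatest[OF ne]) auto
    with d show False by (simp add: d_def)
  qed
  then obtain n0 where n0: "n0 \<in> N" "dist x n0 < 2 * d" by blast
  define r where "r = norm (x - n0)"
  have r: "0 < r" "r < 2 * d"
    using n0 assms(6) by (auto simp: r_def dist_norm)
  show thesis
  proof
    show "(1/r) *\<^sub>R (x - n0) \<in> M"
      using assms n0 by (intro subspace_scale subspace_diff) auto
    show "norm ((1/r) *\<^sub>R (x - n0)) = 1" using r by (simp add: r_def)
    fix n assume n: "n \<in> N"
    have "n0 + r *\<^sub>R n \<in> N" using n n0 assms by (intro subspace_add subspace_scale)
    then have "d \<le> norm (x - (n0 + r *\<^sub>R n))" using le by (simp add: dist_norm)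
    also have "x - (n0 + r *\<^sub>R n) = r *\<^sub>R ((1/r) *\<^sub>R (x - n0) - n)"
      using r by (simp add: algebra_simps)
    also have "norm \<dots> = r * norm ((1/r) *\<^sub>R (x - n0) - n)" using r by simp
    finally have "r < 2 * (r * norm ((1/r) *\<^sub>R (x - n0) - n))" using r by linarith
    then have "r * 1 < r * (2 * norm ((1/r) *\<^sub>R (x - n0) - n))" by (simp only: mult_ac mult_1_right)
    then show "1/2 \<le> norm ((1/r) *\<^sub>R (x - n0) - n)" using r by (simp add: mult_less_cancel_left_pos)
  qed
qed

section \<open>Compact maps and chains of subspaces\<close>

text \<open>Compactness is phrased by subsequences, which is how it is used; continuity is a consequence.\<close>

definition compact_map :: "('a::complex_hilbert_space \<Rightarrow> 'a) \<Rightarrow> bool" where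
  "compact_map K \<longleftrightarrow>
     (\<forall>x y. K (x + y) = K x + K y) \<and> (\<forall>c x. K (c *\<^sub>C x) = c *\<^sub>C K x) \<and>
     (\<forall>v. bounded (range v) \<longrightarrow> (\<exists>l r. strict_mono (r :: nat \<Rightarrow> nat) \<and> (\<lambda>n. K (v (r n))) \<longlonglongrightarrow> l))"

context
  fixes K :: "'a::complex_hilbert_space \<Rightarrow> 'a"
  assumes K: "compact_map K"
begin

lemma compact_map_add: "K (x + y) = K x + K y"
  using K by (simp add: compact_map_def)

lemma compact_map_scaleC: "K (c *\<^sub>C x) = c *\<^sub>C K x"
  using K by (simp add: compact_map_def)

lemma compact_map_subseq:
  assumes "bounded (range v)"
  obtains l r where "strict_mono (r :: nat \<Rightarrow> nat)" "(\<lambda>n. K (v (r n))) \<longlonglongrightarrow> l"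
  using K assms by (auto simp: compact_map_def)

lemma bounded_linear_compact_map: "bounded_linear K"
proof -
  have "\<exists>C. \<forall>x. norm x \<le> 1 \<longrightarrow> norm (K x) \<le> C"
  proof (rule ccontr)
    assume "\<not> ?thesis"
    then have "\<forall>n::nat. \<exists>x. norm x \<le> 1 \<and> real n < norm (K x)" by (force simp: not_le)
    then obtain v where v: "\<And>n. norm (v n) \<le> 1" "\<And>n. real n < norm (K (v n))" by metis
    then have "bounded (range v)" by (auto simp: bounded_iff)
    then obtain l r where r: "strict_mono (r :: nat \<Rightarrow> nat)" and l: "(\<lambda>n. K (v (r n))) \<longlonglongrightarrow> l"
      by (rule compact_map_subseq)
    from convergent_imp_bounded[OF l] obtain B where B: "\<And>n. norm (K (v (r n))) \<le> B"
      by (auto simp: bounded_iff)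
    obtain n where n: "B < real n" using reals_Archimedean2 by blast
    have "real n \<le> real (r n)" using seq_suble[OF r, of n] by simp
    also have "\<dots> < norm (K (v (r n)))" by (rule v)
    also have "\<dots> \<le> B" by (rule B)
    finally show False using n by simp
  qed
  then obtain C where C: "\<And>x. norm x \<le> 1 \<Longrightarrow> norm (K x) \<le> C" by blast
  have scaleR: "K (r *\<^sub>R x) = r *\<^sub>R K x" for r x
    by (simp add: scaleR_scaleC compact_map_scaleC)
  show ?thesis
  proof (rule bounded_linear_intro[of _ C])
    fix x
    show "norm (K x) \<le> norm x * C"
    proof (cases "x = 0")
      case True
      then show ?thesis using scaleR[of 0 0] by simp
    next
      case False
      then have "norm (K ((1/norm x) *\<^sub>R x)) \<le> C" by (intro C) simp
      then show ?thesis using False by (simp add: scaleR field_simps)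
    qed
  qed (simp_all add: compact_map_add scaleR)
qed

text \<open>Arguments with chains of subspaces reach a contradiction with compactness in this form: Riesz' lemma
produces a bounded sequence whose images are separated.\<close>

lemma not_separated_compact_map:
  assumes "bounded (range v)" and "d > 0"
    and sep: "\<And>j k :: nat. j < k \<Longrightarrow> d \<le> norm (K (v k) - K (v j))"
  shows False
proof -
  obtain l r where r: "strict_mono (r :: nat \<Rightarrow> nat)" and l: "(\<lambda>n. K (v (r n))) \<longlonglongrightarrow> l"
    using assms(1) by (rule compact_map_subseq)
  from l have "Cauchy (\<lambda>n. K (v (r n)))" by (rule LIMSEQ_imp_Cauchy)
  then obtain n where n: "\<And>i j. i \<ge> n \<Longrightarrow> j \<ge> n \<Longrightarrow> dist (K (v (r i))) (K (v (r j))) < d"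
    using assms(2) unfolding Cauchy_def by blast
  have "r n < r (Suc n)" using r by (simp add: strict_mono_def)
  from sep[OF this] n[of "Suc n" n] show False by (simp add: dist_norm)
qed

end

lemma compact_map_scale:
  assumes "compact_map K" shows "compact_map (\<lambda>x. c *\<^sub>C K x)"
  unfolding compact_map_def
proof (intro conjI allI impI)
  fix v :: "nat \<Rightarrow> 'a" assume "bounded (range v)"
  with assms obtain l r where "strict_mono (r :: nat \<Rightarrow> nat)" "(\<lambda>n. K (v (r n))) \<longlonglongrightarrow> l"
    by (rule compact_map_subseq)
  then show "\<exists>l r. strict_mono (r :: nat \<Rightarrow> nat) \<and> (\<lambda>n. c *\<^sub>C K (v (r n))) \<longlonglongrightarrow> l"
    using bounded_linear.tendsto[OF bounded_linear_scaleC_right] by blast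
qed (simp_all add: compact_map_add[OF assms] compact_map_scaleC[OF assms]
      scaleC_add_right scaleC_scaleC mult.commute)

lemma compact_map_sum:
  assumes K: "compact_map K" and L: "compact_map L" shows "compact_map (\<lambda>x. K x + L x)"
  unfolding compact_map_def
proof (intro conjI allI impI)
  fix v :: "nat \<Rightarrow> 'a" assume v: "bounded (range v)"
  obtain l r where 1: "strict_mono (r :: nat \<Rightarrow> nat)" "(\<lambda>n. K (v (r n))) \<longlonglongrightarrow> l"
    using K v by (rule compact_map_subseq)
  have "bounded (range (\<lambda>n. v (r n)))" by (rule bounded_subset[OF v]) auto
  with L obtain l' r' where 2: "strict_mono (r' :: nat \<Rightarrow> nat)" "(\<lambda>n. L (v (r (r' n)))) \<longlonglongrightarrow> l'"
    by (rule compact_map_subseq)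
  have "(\<lambda>n. K (v (r (r' n)))) \<longlonglongrightarrow> l"
    using LIMSEQ_subseq_LIMSEQ[OF 1(2) 2(1)] by (simp add: o_def)
  with 1 2 show "\<exists>l r. strict_mono (r :: nat \<Rightarrow> nat) \<and> (\<lambda>n. K (v (r n)) + L (v (r n))) \<longlonglongrightarrow> l"
    by (intro exI[of _ "l + l'"] exI[of _ "r \<circ> r'"] conjI strict_mono_o)
      (auto simp: o_def intro: tendsto_add)
qed (simp_all add: compact_map_add[OF K] compact_map_scaleC[OF K] compact_map_add[OF L]
      compact_map_scaleC[OF L] scaleC_add_right)

text \<open>If \<^term>\<open>x\<close> has distance \<open>d > 0\<close> from \<^term>\<open>N\<close>, then the coefficient of \<^term>\<open>x\<close> in a vector \<open>y\<close>
of the span is bounded by \<open>\<parallel>y\<parallel> / d\<close>, so coefficients of a convergent sequence converge.\<close>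

lemma closed_csubspace_insert:
  fixes N :: "'a::complex_hilbert_space set"
  assumes "closed N" "cvs.subspace N"
  shows "closed (cvs.span (insert x N))"
proof (cases "x \<in> N")
  case True
  then show ?thesis
    unfolding insert_absorb[OF True] cvs.span_eq_iff[THEN iffD2, OF assms(2)] using assms by simp
next
  case False
  have span: "cvs.span (insert x N) = {y. \<exists>k. y - k *\<^sub>C x \<in> N}"
    using assms by (simp add: cvs.span_insert cvs.span_eq_iff[THEN iffD2])
  define d where "d = infdist x N"
  have ne: "N \<noteq> {}" using assms(2) cvs.subspace_0 by auto
  have d: "d > 0"
    unfolding d_def using infdist_pos_not_in_closed[OF assms(1) ne False] .
  have le: "cmod k * d \<le> norm y" if "y - k *\<^sub>C x \<in> N" for y k
  proof (cases "k = 0")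
    case False
    have "(- 1 / k) *\<^sub>C (y - k *\<^sub>C x) \<in> N" using assms that by (intro cvs.subspace_scale)
    then have "d \<le> norm (x - (- 1 / k) *\<^sub>C (y - k *\<^sub>C x))"
      unfolding d_def by (metis infdist_le dist_norm)
    also have "x - (- 1 / k) *\<^sub>C (y - k *\<^sub>C x) = (1/k) *\<^sub>C y"
      using False by (simp add: cvs.scale_right_diff_distrib)
    finally show ?thesis using False by (simp add: norm_scaleC norm_divide field_simps)
  qed simp
  show ?thesis
    unfolding closed_sequential_limits
  proof (intro allI impI, elim conjE)
    fix z l assume z: "\<forall>n. z n \<in> cvs.span (insert x N)" and l: "z \<longlonglongrightarrow> l"
    then have "\<forall>n. \<exists>k. z n - k *\<^sub>C x \<in> N" unfolding span by blast
    then obtain k where k: "\<And>n. z n - k n *\<^sub>C x \<in> N" by metis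
    have diff: "cmod (k m - k n) * d \<le> norm (z m - z n)" for m n
    proof (rule le)
      have "(z m - k m *\<^sub>C x) - (z n - k n *\<^sub>C x) \<in> N"
        by (rule cvs.subspace_diff[OF assms(2) k k])
      then show "z m - z n - (k m - k n) *\<^sub>C x \<in> N"
        by (simp add: cvs.scale_left_diff_distrib algebra_simps)
    qed
    have "Cauchy k"
    proof (rule CauchyI)
      fix e :: real assume "e > 0"
      then have "e * d > 0" using d by simp
      then obtain M where M: "\<And>m n. m \<ge> M \<Longrightarrow> n \<ge> M \<Longrightarrow> norm (z m - z n) < e * d"
        using CauchyD[OF LIMSEQ_imp_Cauchy[OF l]] by blast
      have "norm (k m - k n) < e" if "m \<ge> M" "n \<ge> M" for m n
        using diff[of m n] M[OF that] d by (meson le_less_trans mult_less_cancel_right_pos)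
      then show "\<exists>M. \<forall>m\<ge>M. \<forall>n\<ge>M. norm (k m - k n) < e" by blast
    qed
    then obtain c where c: "k \<longlonglongrightarrow> c" using Cauchy_convergent convergent_def by blast
    have "(\<lambda>n. z n - k n *\<^sub>C x) \<longlonglongrightarrow> l - c *\<^sub>C x"
      by (intro tendsto_diff l bounded_linear.tendsto[OF bounded_linear_scaleC_left c])
    from closed_sequentially[OF assms(1) k this] have "l - c *\<^sub>C x \<in> N" .
    then show "l \<in> cvs.span (insert x N)" unfolding span by blast
  qed
qed

text \<open>The subspaces \<open>M k\<close> spanned by \<^term>\<open>N\<close> and the first \<open>k\<close> vectors increase strictly, while
\<open>1 - \<mu> k *\<^sub>C K\<close> maps \<open>M (k + 1)\<close> into \<open>M k\<close>. Choosing by Riesz' lemma unit vectors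
\<open>y k\<close> in \<open>M (k + 1)\<close> far from \<open>M k\<close>, the difference of \<open>K (\<mu> k *\<^sub>C y k)\<close> and
\<open>K (\<mu> j *\<^sub>C y j)\<close> for \<open>j < k\<close> is \<open>y k\<close> up to an element of \<open>M k\<close>, so these images are
separated, which a compact map does not allow. Three finiteness results are instances: generalized
eigenvectors (\<open>N = {0}\<close>, constant \<open>\<mu>\<close>), the codimension of the range (\<open>N\<close> the range itself), and
discreteness of the characteristic values (\<open>N = {0}\<close>, distinct \<open>\<mu> k\<close>).\<close>

lemma no_triangular_sequence:
  fixes K :: "'a::complex_hilbert_space \<Rightarrow> 'a" and x :: "nat \<Rightarrow> 'a"
  assumes K: "compact_map K" and N: "closed N" "cvs.subspace N" and KN: "\<And>n. n \<in> N \<Longrightarrow> K n \<in> N"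
    and mu: "bounded (range \<mu>)"
    and new: "\<And>k. x k \<notin> cvs.span (N \<union> x ` {..<k})"
    and tri: "\<And>k. x k - \<mu> k *\<^sub>C K (x k) \<in> cvs.span (N \<union> x ` {..<k})"
  shows False
proof -
  define M where "M k = cvs.span (N \<union> x ` {..<k})" for k
  have M_sub [simp]: "cvs.subspace (M k)" for k by (simp add: M_def)
  have M_Suc: "M (Suc k) = cvs.span (insert (x k) (M k))" for k
  proof -
    have "M (Suc k) = cvs.span (insert (x k) (N \<union> x ` {..<k}))"
      by (simp add: M_def lessThan_Suc)
    also have "\<dots> = cvs.span (insert (x k) (M k))"
      unfolding cvs.span_insert M_def cvs.span_span by simp
    finally show ?thesis .
  qed
  have M_mono: "M j \<subseteq> M k" if "j \<le> k" for j k
    unfolding M_def using that by (intro cvs.span_mono) auto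
  have M_closed: "closed (M k)" for k
  proof (induction k)
    case 0
    show ?case using N by (simp add: M_def cvs.span_eq_iff[THEN iffD2])
  next
    case (Suc k)
    then show ?case unfolding M_Suc by (intro closed_csubspace_insert) auto
  qed
  have M_SucE: "\<exists>a m. m \<in> M k \<and> y = a *\<^sub>C x k + m" if "y \<in> M (Suc k)" for y k
  proof -
    have "cvs.span (M k) = M k" by (simp add: M_def)
    then have "\<exists>a. y - a *\<^sub>C x k \<in> M k" using that unfolding M_Suc cvs.span_insert by (simp add: M_def cvs.span_span)
    then obtain a where "y - a *\<^sub>C x k \<in> M k" by blast
    then show ?thesis by (intro exI[of _ a] exI[of _ "y - a *\<^sub>C x k"]) simp
  qed
  have new': "x k \<notin> M k" and tri': "x k - \<mu> k *\<^sub>C K (x k) \<in> M k" for k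
    using new tri by (auto simp: M_def)
  have mu0: "\<mu> k \<noteq> 0" for k using new'[of k] tri'[of k] by auto
  have KM: "K y \<in> M k" if "y \<in> M k" for y k
    using that
  proof (induction k arbitrary: y)
    case 0
    then show ?case using N KN by (simp add: M_def cvs.span_eq_iff[THEN iffD2])
  next
    case (Suc k)
    then obtain a m where m: "m \<in> M k" and y: "y = a *\<^sub>C x k + m" using M_SucE by blast
    have "x k \<in> M (Suc k)" unfolding M_def by (intro cvs.span_base) auto
    moreover have "x k - \<mu> k *\<^sub>C K (x k) \<in> M (Suc k)" using tri'[of k] M_mono[of k "Suc k"] by auto
    ultimately have "(1 / \<mu> k) *\<^sub>C (x k - (x k - \<mu> k *\<^sub>C K (x k))) \<in> M (Suc k)"
      by (rule cvs.subspace_scale[OF M_sub cvs.subspace_diff[OF M_sub]])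
    then have "K (x k) \<in> M (Suc k)" using mu0[of k] by simp
    moreover have "K m \<in> M (Suc k)" using Suc.IH[OF m] M_mono[of k "Suc k"] by auto
    ultimately show ?case
      unfolding y by (auto simp: compact_map_add[OF K] compact_map_scaleC[OF K]
          intro!: cvs.subspace_add cvs.subspace_scale)
  qed
  have LM: "y - \<mu> k *\<^sub>C K y \<in> M k" if yM: "y \<in> M (Suc k)" for y k
  proof -
    obtain a m where m: "m \<in> M k" and y: "y = a *\<^sub>C x k + m" using M_SucE[OF yM] by blast
    have "a *\<^sub>C (x k - \<mu> k *\<^sub>C K (x k)) + (m - \<mu> k *\<^sub>C K m) \<in> M k"
      by (rule cvs.subspace_add[OF M_sub cvs.subspace_scale[OF M_sub tri']
            cvs.subspace_diff[OF M_sub m cvs.subspace_scale[OF M_sub KM[OF m]]]])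
    moreover have "y - \<mu> k *\<^sub>C K y = a *\<^sub>C (x k - \<mu> k *\<^sub>C K (x k)) + (m - \<mu> k *\<^sub>C K m)"
      unfolding y by (simp add: compact_map_add[OF K] compact_map_scaleC[OF K]
          cvs.scale_right_diff_distrib scaleC_add_right scaleC_scaleC mult.commute)
    ultimately show ?thesis by simp
  qed
  have "\<exists>y\<in>M (Suc k). norm y = 1 \<and> (\<forall>m\<in>M k. 1/2 \<le> norm (y - m))" for k
  proof -
    have "x k \<in> M (Suc k)" unfolding M_def by (intro cvs.span_base) auto
    then show ?thesis
      using riesz_lemma[of "M k" "M (Suc k)" "x k"] M_closed new' M_mono[of k "Suc k"]
        subspace_of_csubspace[OF M_sub] by (metis le_SucI order_refl)
  qed
  then obtain y where y: "\<And>k. y k \<in> M (Suc k)" "\<And>k. norm (y k) = 1"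
    "\<And>k m. m \<in> M k \<Longrightarrow> 1/2 \<le> norm (y k - m)" by metis
  show False
  proof (rule not_separated_compact_map[OF K, of "\<lambda>k. \<mu> k *\<^sub>C y k" "1/2"])
    from mu obtain B where "\<And>k. cmod (\<mu> k) \<le> B" by (auto simp: bounded_iff)
    then show "bounded (range (\<lambda>k. \<mu> k *\<^sub>C y k))"
      by (auto simp: bounded_iff norm_scaleC y)
    fix j k :: nat assume jk: "j < k"
    have "y j - (y j - \<mu> j *\<^sub>C K (y j)) \<in> M (Suc j)"
      by (rule cvs.subspace_diff[OF M_sub y(1) subsetD[OF M_mono[OF le_SucI[OF order_refl]] LM[OF y(1)]]])
    then have "\<mu> j *\<^sub>C K (y j) \<in> M k" using M_mono[of "Suc j" k] jk by auto
    then have "(y k - \<mu> k *\<^sub>C K (y k)) + \<mu> j *\<^sub>C K (y j) \<in> M k"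
      using LM y by (intro cvs.subspace_add M_sub) auto
    from y(3)[OF this] show "1/2 \<le> norm (K (\<mu> k *\<^sub>C y k) - K (\<mu> j *\<^sub>C y j))"
      by (simp add: compact_map_scaleC[OF K] algebra_simps)
  qed simp
qed

text \<open>Dependent choice of a sequence, each term depending on the set of the earlier ones; the recursion
runs over the lists of earlier terms.\<close>

lemma choose_sequence_over_finite_sets:
  assumes "\<And>B. finite B \<Longrightarrow> B \<subseteq> Z \<Longrightarrow> \<exists>x\<in>Z. P B x"
  shows "\<exists>x :: nat \<Rightarrow> 'a. \<forall>k. x k \<in> Z \<and> P (x ` {..<k}) (x k)"
proof -
  obtain f where f: "\<And>n. set (f n) \<subseteq> Z" "\<And>n. \<exists>x\<in>Z. f (Suc n) = x # f n \<and> P (set (f n)) x"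
    and f0: "f 0 = []"
  proof -
    have "\<exists>f. \<forall>n. ((n = 0 \<longrightarrow> f n = []) \<and> set (f n) \<subseteq> Z) \<and> (\<exists>x\<in>Z. f (Suc n) = x # f n \<and> P (set (f n)) x)"
    proof (rule dependent_nat_choice)
      show "\<exists>l. (0 = (0::nat) \<longrightarrow> l = []) \<and> set l \<subseteq> Z" by (rule exI[of _ "[]"]) simp
      fix l and n :: nat assume "(n = 0 \<longrightarrow> l = []) \<and> set l \<subseteq> Z"
      then show "\<exists>l'. ((Suc n = 0 \<longrightarrow> l' = []) \<and> set l' \<subseteq> Z) \<and> (\<exists>x\<in>Z. l' = x # l \<and> P (set l) x)"
        using assms[of "set l"] by (metis List.finite_set insert_subset list.simps(15) nat.distinct(1))
    qed
    then show thesis using that by blast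
  qed
  define x where "x n = hd (f (Suc n))" for n
  have x: "x n \<in> Z" "f (Suc n) = x n # f n" "P (set (f n)) (x n)" for n
    using f(2)[of n] by (auto simp: x_def)
  have "set (f n) = x ` {..<n}" for n
    by (induction n) (simp_all add: f0 x lessThan_Suc)
  then show ?thesis using x by (intro exI[of _ x]) simp
qed

section \<open>Riesz theory\<close>

text \<open>Given finitely many vectors that do not span the space of generalized eigenvectors, follow the orbit
of a vector outside the span \<open>S\<close> under \<open>1 - K\<close>. It reaches 0, hence it enters \<open>S\<close>, and
the last point before that is outside \<open>S\<close> but is mapped into \<open>S\<close>. So an infinite dimension
would yield a triangular sequence.\<close>

lemma finite_cdim_generalized_eigenvectors:
  assumes K: "compact_map K"
  shows "finite_cdim {x. \<exists>k. ((\<lambda>x. x - K x) ^^ k) x = 0}" (is "finite_cdim ?Z")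
proof (rule ccontr)
  let ?L = "\<lambda>x. x - K x"
  assume inf: "\<not> finite_cdim ?Z"
  have "\<exists>x\<in>?Z. x \<notin> cvs.span B \<and> x - K x \<in> cvs.span B" if B: "finite B" "B \<subseteq> ?Z" for B
  proof -
    from inf B obtain x k where x: "x \<notin> cvs.span B" "(?L ^^ k) x = 0"
      unfolding finite_cdim_def by blast
    \<comment> \<open>The first iterate that lies in the span of \<open>B\<close>.\<close>
    define i where "i = (LEAST i. (?L ^^ i) x \<in> cvs.span B)"
    have ex: "(?L ^^ k) x \<in> cvs.span B" unfolding x(2) by (rule cvs.span_zero)
    have i: "(?L ^^ i) x \<in> cvs.span B" unfolding i_def by (rule LeastI[of "\<lambda>i. (?L ^^ i) x \<in> cvs.span B", OF ex])
    have "i \<le> k" unfolding i_def by (rule Least_le[of "\<lambda>i. (?L ^^ i) x \<in> cvs.span B", OF ex])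
    have "i \<noteq> 0" using i x by (cases i) auto
    then obtain j where j: "i = Suc j" by (cases i) auto
    let ?x = "(?L ^^ j) x"
    have "?x \<notin> cvs.span B" using not_less_Least[of j "\<lambda>i. (?L ^^ i) x \<in> cvs.span B"] j
      by (simp add: i_def[symmetric])
    moreover have "(?L ^^ (k - j)) ?x = 0"
      using \<open>i \<le> k\<close> j x(2) by (simp add: funpow_add[symmetric, THEN fun_cong, unfolded o_def])
    moreover have "?x - K ?x \<in> cvs.span B" using i j by simp
    ultimately show ?thesis by blast
  qed
  from choose_sequence_over_finite_sets[of ?Z "\<lambda>B x. x \<notin> cvs.span B \<and> x - K x \<in> cvs.span B", OF this]
  obtain x :: "nat \<Rightarrow> 'a" where "\<forall>k. x k \<in> ?Z \<and> x k \<notin> cvs.span (x ` {..<k}) \<and> x k - K (x k) \<in> cvs.span (x ` {..<k})"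
    by (rule exE)
  then have x: "\<And>k. x k \<notin> cvs.span (x ` {..<k})" "\<And>k. x k - K (x k) \<in> cvs.span (x ` {..<k})"
    by simp_all
  have span0: "cvs.span ({0} \<union> B) = cvs.span B" for B :: "'a set"
    by (simp add: cvs.span_insert_0)
  show False
    by (rule no_triangular_sequence[OF K, of "{0}" "\<lambda>_. 1" x])
      (use x in \<open>simp_all add: span0 cvs.subspace_def compact_map_scaleC[OF K, of 0 0, simplified]\<close>)
qed

lemma finite_cdim_mono: "finite_cdim T \<Longrightarrow> S \<subseteq> T \<Longrightarrow> finite_cdim S"
  by (auto simp: finite_cdim_def)

text \<open>Although \<open>1 - K\<close> may have a kernel, preimages can be chosen with norm controlled by the image:
on unit vectors that stay away from the kernel, \<open>1 - K\<close> is bounded below, since otherwise a limit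
of such vectors would be a kernel element close to them. Closedness of the range, boundedness
of resolvents and the Fredholm alternative all rest on this bound.\<close>

lemma bounded_preimages:
  assumes K: "compact_map K"
  obtains C where "C \<ge> 0" "\<And>x. \<exists>x'. x' - K x' = x - K x \<and> norm x' \<le> C * norm (x - K x)"
proof -
  interpret K: bounded_linear K by (rule bounded_linear_compact_map[OF K])
  define N where "N = {x. x - K x = 0}"
  have N: "closed N" "subspace N"
  proof -
    have "continuous_on UNIV (\<lambda>x. x - K x)"
      by (intro continuous_intros K.continuous_on)
    then show "closed N" unfolding N_def
      using continuous_closed_vimage[of "{0}" "\<lambda>x. x - K x"]
      by (auto simp: vimage_def continuous_on_eq_continuous_at)
    show "subspace N" by (auto simp: N_def subspace_def K.add K.scaleR algebra_simps)
  qed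
  \<comment> \<open>The kernel is \<open>N\<close>; Riesz' lemma provides elements of \<open>S\<close> in the span of \<open>N\<close> and any \<open>x\<close> outside it.\<close>
  define S where "S = {w. norm w = 1 \<and> (\<forall>n\<in>N. 1/2 \<le> norm (w - n))}"
  have "\<exists>c>0. \<forall>w\<in>S. c \<le> norm (w - K w)"
  proof (rule ccontr)
    assume *: "\<not> ?thesis"
    have "\<exists>w\<in>S. norm (w - K w) < 1 / real (Suc n)" for n
      using * by (auto simp: not_le dest!: spec[of _ "1 / real (Suc n)"])
    then obtain w where w: "\<And>n. w n \<in> S" "\<And>n. norm (w n - K (w n)) < 1 / real (Suc n)" by metis
    have "bounded (range w)" using w by (auto simp: bounded_iff S_def)
    with K obtain l r where r: "strict_mono (r :: nat \<Rightarrow> nat)" and l: "(\<lambda>n. K (w (r n))) \<longlonglongrightarrow> l"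
      by (rule compact_map_subseq)
    have "(\<lambda>n. w n - K (w n)) \<longlonglongrightarrow> 0"
      by (rule Lim_null_comparison[OF _ LIMSEQ_inverse_real_of_nat])
        (use w in \<open>auto intro!: always_eventually less_imp_le simp: inverse_eq_divide\<close>)
    then have lim0: "(\<lambda>n. w (r n) - K (w (r n))) \<longlonglongrightarrow> 0"
      using LIMSEQ_subseq_LIMSEQ[OF _ r] by (auto simp: o_def)
    from tendsto_add[OF this l] have wl: "(\<lambda>n. w (r n)) \<longlonglongrightarrow> l" by simp
    have "(\<lambda>n. w (r n) - K (w (r n))) \<longlonglongrightarrow> l - K l" by (intro tendsto_diff wl K.tendsto)
    with lim0 have "l \<in> N" unfolding N_def using LIMSEQ_unique by blast
    then have "1/2 \<le> norm (w (r n) - l)" for n using w(1) by (auto simp: S_def)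
    moreover have "(\<lambda>n. norm (w (r n) - l)) \<longlonglongrightarrow> 0"
      using wl by (simp add: tendsto_norm_zero_iff LIM_zero_iff)
    ultimately have "1/2 \<le> (0::real)" by (intro LIMSEQ_le_const) auto
    then show False by simp
  qed
  then obtain c where c: "c > 0" "\<And>w. w \<in> S \<Longrightarrow> c \<le> norm (w - K w)" by blast
  show thesis
  proof
    show "0 \<le> 1 / c" using c by simp
    fix x
    show "\<exists>x'. x' - K x' = x - K x \<and> norm x' \<le> 1 / c * norm (x - K x)"
    proof (cases "x \<in> N")
      case True
      then show ?thesis by (intro exI[of _ 0]) (auto simp: N_def K.zero)
    next
      case False
      have M: "subspace (span (insert x N))" "N \<subseteq> span (insert x N)" "x \<in> span (insert x N)"
        by (auto intro: span_base)
      obtain y where y: "y \<in> span (insert x N)" "norm y = 1" "\<And>n. n \<in> N \<Longrightarrow> 1/2 \<le> norm (y - n)"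
        using riesz_lemma[OF N M False] by blast
      then obtain t where t: "y - t *\<^sub>R x \<in> N"
        using N(2) by (auto simp: span_insert span_eq_iff[THEN iffD2])
      have yS: "y \<in> S" using y by (simp add: S_def)
      have Ly: "y - K y = t *\<^sub>R (x - K x)"
        using t by (simp add: N_def K.diff K.scaleR algebra_simps)
      have t0: "t \<noteq> 0" using c(2)[OF yS] c(1) unfolding Ly by auto
      show ?thesis
      proof (intro exI conjI)
        show "(1/t) *\<^sub>R y - K ((1/t) *\<^sub>R y) = x - K x"
          using Ly t0 by (simp add: K.scaleR scaleR_diff_right[symmetric])
        have "c \<le> \<bar>t\<bar> * norm (x - K x)" using c(2)[OF yS] unfolding Ly by simp
        then show "norm ((1/t) *\<^sub>R y) \<le> 1 / c * norm (x - K x)"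
          using t0 c(1) by (simp add: y field_simps)
      qed
    qed
  qed
qed

lemma closed_range_one_minus_compact:
  assumes K: "compact_map K"
  shows "closed (range (\<lambda>x. x - K x))"
  unfolding closed_sequential_limits
proof (intro allI impI, elim conjE)
  interpret K: bounded_linear K by (rule bounded_linear_compact_map[OF K])
  fix y l assume "\<forall>n. y n \<in> range (\<lambda>x. x - K x)" and l: "y \<longlonglongrightarrow> l"
  then have "\<forall>n. \<exists>x. y n = x - K x" by auto
  moreover obtain C where C: "C \<ge> 0" "\<And>x. \<exists>x'. x' - K x' = x - K x \<and> norm x' \<le> C * norm (x - K x)"
    using bounded_preimages[OF K] by blast
  ultimately have "\<forall>n. \<exists>x. x - K x = y n \<and> norm x \<le> C * norm (y n)" by metis
  then obtain x where x: "\<And>n. x n - K (x n) = y n" "\<And>n. norm (x n) \<le> C * norm (y n)" by metis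
  from convergent_imp_bounded[OF l] obtain B where "\<And>n. norm (y n) \<le> B"
    by (auto simp: bounded_iff)
  then have "norm (x n) \<le> C * B" for n
    using x(2)[of n] C(1) by (meson mult_left_mono order_trans)
  then have "bounded (range x)" by (auto simp: bounded_iff)
  with K obtain m r where r: "strict_mono (r :: nat \<Rightarrow> nat)" and m: "(\<lambda>n. K (x (r n))) \<longlonglongrightarrow> m"
    by (rule compact_map_subseq)
  have yr: "(\<lambda>n. x (r n) - K (x (r n))) \<longlonglongrightarrow> l"
    unfolding x using LIMSEQ_subseq_LIMSEQ[OF l r] by (simp add: o_def)
  from tendsto_add[OF this m] have xl: "(\<lambda>n. x (r n)) \<longlonglongrightarrow> l + m" by simp
  have "(\<lambda>n. x (r n) - K (x (r n))) \<longlonglongrightarrow> (l + m) - K (l + m)" by (intro tendsto_diff xl K.tendsto)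
  with yr have "l = (l + m) - K (l + m)" by (rule LIMSEQ_unique)
  then show "l \<in> range (\<lambda>x. x - K x)" by blast
qed

text \<open>Vectors that are independent modulo the range of \<open>1 - K\<close> are mapped into this range by \<open>1 - K\<close>, so
infinitely many of them would be a triangular sequence over it.\<close>

lemma finite_codim_range_one_minus_compact:
  assumes K: "compact_map K"
  obtains B where "finite B" "\<And>y. \<exists>x. \<exists>b\<in>cvs.span B. y = (x - K x) + b"
proof (rule ccontr)
  interpret K: bounded_linear K by (rule bounded_linear_compact_map[OF K])
  let ?N = "range (\<lambda>x. x - K x)"
  assume "\<not> thesis"
  with that have inf: "\<And>B. finite B \<Longrightarrow> \<exists>y. \<forall>x. \<forall>b\<in>cvs.span B. y \<noteq> (x - K x) + b" by metis
  have sub: "cvs.subspace ?N"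
    unfolding cvs.subspace_def
  proof (intro conjI ballI allI)
    show "0 \<in> ?N" by (rule image_eqI[of _ _ 0]) (simp_all add: K.zero)
  next
    fix x y assume "x \<in> ?N" "y \<in> ?N"
    then obtain a b where "x = a - K a" "y = b - K b" by blast
    then show "x + y \<in> ?N" by (intro image_eqI[of _ _ "a + b"]) (simp_all add: K.add)
  next
    fix c x assume "x \<in> ?N"
    then obtain a where "x = a - K a" by blast
    then show "c *\<^sub>C x \<in> ?N"
      by (intro image_eqI[of _ _ "c *\<^sub>C a"]) (simp_all add: compact_map_scaleC[OF K] cvs.scale_right_diff_distrib)
  qed
  have "\<exists>x\<in>UNIV. x \<notin> cvs.span (?N \<union> B)" if B: "finite B" for B
  proof -
    from inf[OF B] obtain y where y: "\<And>x b. b \<in> cvs.span B \<Longrightarrow> y \<noteq> (x - K x) + b" by blast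
    have "y \<notin> cvs.span (?N \<union> B)"
      unfolding cvs.span_Un using y sub by (auto simp: cvs.span_eq_iff[THEN iffD2])
    then show ?thesis by blast
  qed
  from choose_sequence_over_finite_sets[of UNIV "\<lambda>B x. x \<notin> cvs.span (?N \<union> B)", OF this]
  obtain x :: "nat \<Rightarrow> 'a" where "\<forall>k. x k \<in> UNIV \<and> x k \<notin> cvs.span (?N \<union> x ` {..<k})" by (rule exE)
  then have x: "\<And>k. x k \<notin> cvs.span (?N \<union> x ` {..<k})" by simp
  show False
  proof (rule no_triangular_sequence[OF K closed_range_one_minus_compact[OF K] sub _ _ x])
    show "bounded (range (\<lambda>_::nat. 1::complex))" by simp
    fix n assume "n \<in> ?N"
    then obtain a where "n = a - K a" by blast
    then show "K n \<in> ?N" by (intro image_eqI[of _ _ "K a"]) (simp_all add: K.diff)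
  next
    fix k
    show "x k - 1 *\<^sub>C K (x k) \<in> cvs.span (?N \<union> x ` {..<k})"
      by (intro cvs.span_base) simp
  qed
qed

text \<open>The Fredholm alternative. If \<open>1 - K\<close> is injective but misses \<open>y\<close>, then the ranges of its
powers form a strictly decreasing chain of closed subspaces, with the powers applied to \<open>y\<close> as
witnesses. Riesz' lemma along this chain again gives a sequence with separated images.\<close>

lemma surj_one_minus_compact:
  assumes K: "compact_map K" and inj: "\<And>x. x - K x = 0 \<Longrightarrow> x = 0"
  shows "\<exists>x. x - K x = y"
proof (rule ccontr)
  interpret K: bounded_linear K by (rule bounded_linear_compact_map[OF K])
  let ?L = "\<lambda>x. x - K x"
  assume y: "\<nexists>x. x - K x = y"
  have inj': "x = x'" if "?L x = ?L x'" for x x'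
    using inj[of "x - x'"] that by (simp add: K.diff algebra_simps)
  obtain C where C: "C \<ge> 0" "\<And>x. \<exists>x'. ?L x' = ?L x \<and> norm x' \<le> C * norm (?L x)"
    using bounded_preimages[OF K] by blast
  have bdd: "norm x \<le> C * norm (?L x)" for x
    using C(2)[of x] inj' by blast
  have bl: "bounded_linear ?L" by (intro bounded_linear_sub bounded_linear_ident K.bounded_linear_axioms)
  then interpret L: bounded_linear ?L .
  define M where "M k = (?L ^^ k) ` UNIV" for k
  have M_Suc: "M (Suc k) = ?L ` M k" for k by (simp add: M_def image_comp)
  have M: "subspace (M k) \<and> closed (M k) \<and> M (Suc k) \<subseteq> M k" for k
  proof (induction k)
    case 0
    then show ?case by (simp add: M_def)
  next
    case (Suc k)
    have "subspace (M (Suc k))"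
      unfolding M_Suc using linear_subspace_image[OF L.linear_axioms, of "M k"] Suc by blast
    moreover have "closed (M (Suc k))"
      unfolding M_Suc closed_sequential_limits
    proof (intro allI impI, elim conjE)
      fix z l assume "\<forall>n. z n \<in> ?L ` M k" and l: "z \<longlonglongrightarrow> l"
      then have "\<forall>n. \<exists>x. x \<in> M k \<and> z n = ?L x" by (auto simp: image_iff)
      then obtain x where x: "\<And>n. x n \<in> M k" "\<And>n. z n = ?L (x n)" by metis
      have "Cauchy x"
      proof (rule CauchyI)
        fix e :: real assume "e > 0"
        then have "e / (C + 1) > 0" using C by simp
        then obtain A where A: "\<And>m n. m \<ge> A \<Longrightarrow> n \<ge> A \<Longrightarrow> norm (z m - z n) < e / (C + 1)"
          using CauchyD[OF LIMSEQ_imp_Cauchy[OF l]] by blast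
        have "norm (x m - x n) < e" if "m \<ge> A" "n \<ge> A" for m n
        proof -
          have "norm (x m - x n) \<le> C * norm (z m - z n)"
            using bdd[of "x m - x n"] by (simp add: x K.diff algebra_simps)
          also have "\<dots> \<le> (C + 1) * norm (z m - z n)" by (simp add: mult_right_mono)
          also have "\<dots> < e" using A[OF that] C by (simp add: field_simps)
          finally show ?thesis .
        qed
        then show "\<exists>M. \<forall>m\<ge>M. \<forall>n\<ge>M. norm (x m - x n) < e" by blast
      qed
      then obtain a where a: "x \<longlonglongrightarrow> a" using Cauchy_convergent convergent_def by blast
      have "z \<longlonglongrightarrow> ?L a" unfolding x(2) by (intro tendsto_diff a K.tendsto)
      then have "l = ?L a" using l by (intro LIMSEQ_unique)
      moreover have "a \<in> M k" using closed_sequentially[OF _ x(1) a] Suc by blast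
      ultimately show "l \<in> ?L ` M k" by blast
    qed
    moreover have "M (Suc (Suc k)) \<subseteq> M (Suc k)" using Suc M_Suc by blast
    ultimately show ?case by blast
  qed
  have anti: "M k \<subseteq> M j" if "j \<le> k" for j k
    using lift_Suc_antimono_le[of M] M that by blast
  have strict: "(?L ^^ k) y \<in> M k - M (Suc k)" for k
  proof (induction k)
    case 0
    then show ?case using y by (auto simp: M_def)
  next
    case (Suc k)
    then have "?L ((?L ^^ k) y) \<in> ?L ` M k" "?L ((?L ^^ k) y) \<notin> ?L ` M (Suc k)" using inj' by blast+
    then show ?case by (simp add: M_Suc)
  qed
  have "\<exists>v\<in>M k. norm v = 1 \<and> (\<forall>m\<in>M (Suc k). 1/2 \<le> norm (v - m))" for k
    using riesz_lemma[of "M (Suc k)" "M k" "(?L ^^ k) y"] M[of k] M[of "Suc k"] strict[of k] by (metis Diff_iff)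
  then obtain v where v: "\<And>k. v k \<in> M k" "\<And>k. norm (v k) = 1"
    "\<And>k m. m \<in> M (Suc k) \<Longrightarrow> 1/2 \<le> norm (v k - m)" by metis
  show False
  proof (rule not_separated_compact_map[OF K, of v "1/2"])
    show "bounded (range v)" using v by (auto simp: bounded_iff)
    fix j k :: nat assume jk: "j < k"
    have "?L (v j) \<in> M (Suc j)" "?L (v k) \<in> M (Suc j)" "v k \<in> M (Suc j)"
      using v(1) M_Suc anti[of "Suc j" "Suc k"] anti[of "Suc j" k] jk by auto
    then have "?L (v j) + v k - ?L (v k) \<in> M (Suc j)"
      using M subspace_add subspace_diff by blast
    from v(3)[OF this] have "1/2 \<le> norm (K (v j) - K (v k))"
      by (simp add: algebra_simps)
    then show "1/2 \<le> norm (K (v k) - K (v j))" by (simp add: norm_minus_commute)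
  qed simp
qed

text \<open>Eigenvectors for distinct eigenvalues are linearly independent, so infinitely many of them,
with bounded \<open>\<mu>\<close>, would be a triangular sequence.\<close>

lemma finite_bounded_characteristic_values:
  assumes K: "compact_map K"
  shows "finite {\<mu>. cmod \<mu> \<le> r \<and> (\<exists>x. x \<noteq> 0 \<and> \<mu> *\<^sub>C K x = x)}" (is "finite ?S")
proof (rule ccontr)
  assume "infinite ?S"
  from infinite_countable_subset[OF this]
  obtain \<mu> :: "nat \<Rightarrow> complex" where \<mu>: "inj \<mu>" "range \<mu> \<subseteq> ?S"
    by (elim exE conjE)
  then have "\<forall>k. \<exists>x. x \<noteq> 0 \<and> \<mu> k *\<^sub>C K x = x" by blast
  then obtain x where x0: "\<And>k. x k \<noteq> 0" and x: "\<And>k. \<mu> k *\<^sub>C K (x k) = x k" by metis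
  have mu0: "\<mu> k \<noteq> 0" for k using x0[of k] x[of k] by (metis cvs.scale_zero_left)
  have Kx: "K (x k) = (1 / \<mu> k) *\<^sub>C x k" for k
    using arg_cong[OF x[of k], of "\<lambda>y. (1 / \<mu> k) *\<^sub>C y"] mu0[of k] by simp
  have indep: "v = 0" if "v \<in> cvs.span (x ` {..<m})" "K v = (1 / \<mu> k) *\<^sub>C v" "m \<le> k" for v m k
    using that
  proof (induction m arbitrary: v)
    case 0
    then show ?case by simp
  next
    case (Suc m)
    then have "\<exists>a. v - a *\<^sub>C x m \<in> cvs.span (x ` {..<m})"
      by (simp add: lessThan_Suc cvs.span_insert)
    then obtain a where a: "v - a *\<^sub>C x m \<in> cvs.span (x ` {..<m})" by blast
    let ?w = "v - a *\<^sub>C x m"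
    have inv: "K w \<in> cvs.span (x ` {..<m})" if "w \<in> cvs.span (x ` {..<m})" for w
      using that
    proof (induction rule: cvs.span_induct_alt)
      case base
      then show ?case using compact_map_scaleC[OF K, of 0 0] by (simp add: cvs.span_zero)
    next
      case (step c y z)
      then obtain j where "j < m" "y = x j" by auto
      then have "c *\<^sub>C K y \<in> cvs.span (x ` {..<m})"
        unfolding Kx \<open>y = x j\<close> by (intro cvs.span_scale cvs.span_base) simp
      then show ?case using step
        by (simp add: compact_map_add[OF K] compact_map_scaleC[OF K] cvs.span_add)
    qed
    \<comment> \<open>Applying \<open>K - 1 / \<mu> m\<close> removes the component along \<open>x m\<close> and multiplies \<open>v\<close> by a nonzero scalar.\<close>
    have "K ?w - (1 / \<mu> m) *\<^sub>C ?w \<in> cvs.span (x ` {..<m})"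
      by (rule cvs.span_diff[OF inv[OF a] cvs.span_scale[OF a]])
    also have "K ?w - (1 / \<mu> m) *\<^sub>C ?w = (1 / \<mu> k - 1 / \<mu> m) *\<^sub>C v"
    proof -
      have "K ?w = K v - a *\<^sub>C K (x m)"
        using compact_map_add[OF K, of ?w "a *\<^sub>C x m"] by (simp add: compact_map_scaleC[OF K])
      then show ?thesis using Suc.prems Kx[of m]
        by (simp add: cvs.scale_right_diff_distrib cvs.scale_left_diff_distrib mult.commute)
    qed
    finally have "(1 / (1 / \<mu> k - 1 / \<mu> m)) *\<^sub>C (1 / \<mu> k - 1 / \<mu> m) *\<^sub>C v \<in> cvs.span (x ` {..<m})"
      by (rule cvs.span_scale)
    moreover have "\<mu> k \<noteq> \<mu> m" using Suc.prems \<mu>(1) by (auto dest: injD)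
    then have "1 / \<mu> k - 1 / \<mu> m \<noteq> 0" using mu0 by (simp add: field_simps)
    ultimately have "v \<in> cvs.span (x ` {..<m})" by simp
    then show ?case using Suc by simp
  qed
  have span0: "cvs.span ({0} \<union> B) = cvs.span B" for B :: "'a set"
    by (simp add: cvs.span_insert_0)
  show False
  proof (rule no_triangular_sequence[OF K, of "{0}" \<mu> x])
    show "bounded (range \<mu>)" using \<mu> by (auto simp: bounded_iff intro!: exI[of _ r])
    show "x k \<notin> cvs.span ({0} \<union> x ` {..<k})" for k
      using indep[of "x k" k k] x0[of k] Kx[of k] unfolding span0 by auto
  qed (use x in \<open>simp_all add: cvs.span_zero cvs.subspace_def compact_map_scaleC[OF K, of 0 0, simplified]\<close>)
qed

section \<open>Operators with compact resolvent\<close>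

lemma compact_operatorE:
  assumes "compact_operator G"
  obtains K where "compact_map K" "\<And>x y. (x, y) \<in> G \<longleftrightarrow> y = K x"
proof -
  from assms have lin: "linear_operator G" and dom: "Domain G = UNIV"
    and cpt: "\<And>B. bounded B \<Longrightarrow> compact (closure (G `` B))"
    by (auto simp: compact_operator_def)
  from lin have sv: "single_valued G"
    and add: "\<And>x y x' y'. (x, y) \<in> G \<Longrightarrow> (x', y') \<in> G \<Longrightarrow> (x + x', y + y') \<in> G"
    and scale: "\<And>c x y. (x, y) \<in> G \<Longrightarrow> (c *\<^sub>C x, c *\<^sub>C y) \<in> G"
    unfolding linear_operator_def by blast+
  have "\<forall>x. \<exists>y. (x, y) \<in> G" using dom by blast
  then obtain K where K: "\<And>x. (x, K x) \<in> G" by metis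
  have iff: "(x, y) \<in> G \<longleftrightarrow> y = K x" for x y
    using sv K by (auto dest: single_valuedD)
  have "compact_map K"
    unfolding compact_map_def
  proof (intro conjI allI impI)
    show "K (x + y) = K x + K y" for x y using add[OF K K, of x y] iff by simp
    show "K (c *\<^sub>C x) = c *\<^sub>C K x" for c x using scale[OF K, of c x] iff by simp
    fix v :: "nat \<Rightarrow> 'a" assume v: "bounded (range v)"
    have "K (v n) \<in> closure (G `` range v)" for n
      by (rule subsetD[OF closure_subset], rule ImageI[OF K]) simp
    then have "\<exists>l\<in>closure (G `` range v). \<exists>r. strict_mono r \<and> ((\<lambda>n. K (v n)) \<circ> r) \<longlonglongrightarrow> l"
      using compact_imp_seq_compact[OF cpt[OF v]] by (simp add: seq_compact_def)
    then show "\<exists>l r. strict_mono (r :: nat \<Rightarrow> nat) \<and> (\<lambda>n. K (v (r n))) \<longlonglongrightarrow> l"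
      unfolding o_def by blast
  qed
  then show thesis using that iff by blast
qed

text \<open>The equation for \<^term>\<open>T\<close> expresses that \<^term>\<open>K\<close> is the resolvent \<open>(z0 - T)\<inverse>\<close>; in this form it
determines \<^term>\<open>T\<close>, and every statement about \<open>z - T\<close> becomes one about the bounded map
\<open>1 - (z0 - z) *\<^sub>C K\<close>, which is \<open>(z - T)\<close> after \<^term>\<open>K\<close>.\<close>

locale compact_resolvent =
  fixes K :: "'a::complex_hilbert_space \<Rightarrow> 'a" and T :: "'a operator" and z0 :: complex
  assumes K: "compact_map K"
    and inj: "\<And>f. K f = 0 \<Longrightarrow> f = 0"
    and T_iff: "\<And>u y. (u, y) \<in> T \<longleftrightarrow> u = K (z0 *\<^sub>C u - y)"
begin

sublocale K: bounded_linear K by (rule bounded_linear_compact_map[OF K])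

abbreviation pencil :: "complex \<Rightarrow> 'a \<Rightarrow> 'a" where
  "pencil z u \<equiv> u - (z0 - z) *\<^sub>C K u"

lemma compact_map_pencil: "compact_map (\<lambda>x. (z0 - z) *\<^sub>C K x)"
  by (rule compact_map_scale[OF K])

lemma shifted_iff: "(u, f) \<in> shifted z T \<longleftrightarrow> pencil z u = K f"
proof -
  have "(u, f) \<in> shifted z T \<longleftrightarrow> (u, z *\<^sub>C u - f) \<in> T"
  proof
    assume "(u, f) \<in> shifted z T"
    then show "(u, z *\<^sub>C u - f) \<in> T" by (auto simp: shifted_def)
  next
    assume "(u, z *\<^sub>C u - f) \<in> T"
    then have "(u, z *\<^sub>C u - (z *\<^sub>C u - f)) \<in> shifted z T" unfolding shifted_def by blast
    then show "(u, f) \<in> shifted z T" by simp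
  qed
  also have "\<dots> \<longleftrightarrow> u = K ((z0 - z) *\<^sub>C u + f)"
  proof -
    have "z0 *\<^sub>C u - (z *\<^sub>C u - f) = (z0 - z) *\<^sub>C u + f"
      by (simp add: cvs.scale_left_diff_distrib)
    then show ?thesis by (simp only: T_iff)
  qed
  also have "\<dots> \<longleftrightarrow> pencil z u = K f"
    by (simp only: K.add compact_map_scaleC[OF K]) (auto simp: algebra_simps)
  finally show ?thesis .
qed

lemma K_pencil: "K (pencil z u) = pencil z (K u)"
  by (simp add: K.diff compact_map_scaleC[OF K])

text \<open>As \<open>pencil z\<close> is \<open>(z - T) K\<close> and \<^term>\<open>K\<close> maps onto the domain of \<^term>\<open>T\<close>, both have the same range.\<close>

lemma Range_shifted: "Range (shifted z T) = range (pencil z)"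
proof (intro equalityI subsetI)
  fix f assume "f \<in> Range (shifted z T)"
  then obtain u where u: "pencil z u = K f" using shifted_iff by blast
  define g where "g = (z0 - z) *\<^sub>C u + f"
  have "K g = (z0 - z) *\<^sub>C K u + K f" by (simp only: g_def K.add compact_map_scaleC[OF K])
  then have "u = K g" unfolding u[symmetric] by simp
  then have "K (pencil z g) = K f" using K_pencil u by simp
  then have "K (pencil z g - f) = 0" by (simp add: K.diff)
  then show "f \<in> range (pencil z)" using inj by fastforce
next
  fix f assume "f \<in> range (pencil z)"
  then obtain g where "f = pencil z g" by blast
  then have "(K g, f) \<in> shifted z T" by (simp only: shifted_iff K_pencil)
  then show "f \<in> Range (shifted z T)" by blast
qed

text \<open>Since \<open>pencil z\<close> and \<^term>\<open>K\<close> commute, each application of \<open>z - T\<close> can be traded for one of \<open>pencil z\<close> at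
the cost of one \<^term>\<open>K\<close>; for \<open>y = 0\<close> this bounds the root space of \<^term>\<open>T\<close> by generalized
eigenvectors of a compact map.\<close>

lemma shifted_power: "(x, y) \<in> shifted z T ^^ k \<Longrightarrow> (pencil z ^^ k) x = (K ^^ k) y"
proof (induction k arbitrary: y)
  case 0
  then show ?case by simp
next
  case (Suc k)
  then obtain w where w: "(x, w) \<in> shifted z T ^^ k" "(w, y) \<in> shifted z T" by auto
  have comm: "pencil z ((K ^^ j) v) = (K ^^ j) (pencil z v)" for j v
    by (induction j) (simp_all only: funpow.simps o_apply id_apply K_pencil[symmetric])
  have "(pencil z ^^ Suc k) x = pencil z ((K ^^ k) w)"
    unfolding Suc.IH[OF w(1), symmetric] by simp
  also have "\<dots> = (K ^^ k) (K y)"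
    using w(2) by (simp only: comm shifted_iff)
  also have "\<dots> = (K ^^ Suc k) y" by (simp add: funpow_swap1)
  finally show ?case .
qed

lemma finite_cdim_root_space: "finite_cdim (root_space T z)"
proof (rule finite_cdim_mono[OF finite_cdim_generalized_eigenvectors[OF compact_map_pencil[of z]]])
  have "(K ^^ k) 0 = 0" for k by (induction k) (simp_all add: K.zero)
  then show "root_space T z \<subseteq> {x. \<exists>k. (pencil z ^^ k) x = 0}"
    by (auto simp: root_space_def op_kernel_def dest!: shifted_power)
qed

lemma fredholm_shifted: "fredholm (shifted z T)"
  unfolding fredholm_def Range_shifted
proof (intro conjI)
  have "op_kernel (shifted z T) = op_kernel (shifted z T ^^ 1)" by simp
  then have "op_kernel (shifted z T) \<subseteq> root_space T z" unfolding root_space_def by blast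
  then show "finite_cdim (op_kernel (shifted z T))"
    by (rule finite_cdim_mono[OF finite_cdim_root_space])
  show "closed (range (pencil z))"
    by (rule closed_range_one_minus_compact[OF compact_map_pencil])
  obtain B where B: "finite B" "\<And>y. \<exists>x. \<exists>b\<in>cvs.span B. y = pencil z x + b"
    using finite_codim_range_one_minus_compact[OF compact_map_pencil] by blast
  have "\<forall>y. \<exists>r\<in>range (pencil z). \<exists>b\<in>cvs.span B. y = r + b"
  proof
    fix y
    from B(2)[of y] obtain x b where "b \<in> cvs.span B" "y = pencil z x + b" by (elim exE bexE)
    then show "\<exists>r\<in>range (pencil z). \<exists>b\<in>cvs.span B. y = r + b" by blast
  qed
  then show "\<exists>B. finite B \<and> (\<forall>y. \<exists>r\<in>range (pencil z). \<exists>b\<in>cvs.span B. y = r + b)"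
    using B(1) by blast
qed

text \<open>If \<open>pencil z\<close> is injective, then it is onto by the Fredholm alternative and has a bounded
inverse, which yields the resolvent at \<open>z\<close>.\<close>

lemma spectrum_imp_eigenvector:
  assumes "z \<in> spectrum T" shows "\<exists>x. x \<noteq> 0 \<and> pencil z x = 0"
proof (rule ccontr)
  assume "\<not> ?thesis"
  then have inj_pencil: "\<And>x. pencil z x = 0 \<Longrightarrow> x = 0" by blast
  have res: "(f, u) \<in> resolvent z T \<longleftrightarrow> pencil z u = K f" for f u
    by (simp add: resolvent_def shifted_iff)
  have uniq: "u = u'" if "pencil z u = pencil z u'" for u u'
    using inj_pencil[of "u - u'"] that by (simp add: K.diff cvs.scale_right_diff_distrib algebra_simps)
  obtain C where C: "C \<ge> 0" "\<And>x. \<exists>x'. pencil z x' = pencil z x \<and> norm x' \<le> C * norm (pencil z x)"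
    using bounded_preimages[OF compact_map_pencil[of z]] by blast
  obtain D where D: "\<And>x. norm (K x) \<le> norm x * D" "D > 0" using K.pos_bounded by blast
  have "bounded_everywhere (resolvent z T)"
    unfolding bounded_everywhere_def linear_operator_def
  proof (intro conjI allI impI)
    show "single_valued (resolvent z T)"
      by (rule single_valuedI) (auto simp: res intro: uniq)
    show "(0, 0) \<in> resolvent z T" by (simp add: res K.zero)
    show "(x + x', y + y') \<in> resolvent z T" if "(x, y) \<in> resolvent z T" "(x', y') \<in> resolvent z T" for x y x' y'
    proof -
      have "pencil z (y + y') = pencil z y + pencil z y'"
        by (simp add: K.add scaleC_add_right)
      then show ?thesis using that by (simp only: res K.add)
    qed
    show "(c *\<^sub>C x, c *\<^sub>C y) \<in> resolvent z T" if "(x, y) \<in> resolvent z T" for c x y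
    proof -
      have "pencil z (c *\<^sub>C y) = c *\<^sub>C pencil z y"
        by (simp add: compact_map_scaleC[OF K] cvs.scale_right_diff_distrib mult.commute)
      then show ?thesis using that by (simp add: res compact_map_scaleC[OF K])
    qed
    show "Domain (resolvent z T) = UNIV"
    proof (intro equalityI subsetI UNIV_I)
      fix f
      obtain u where "pencil z u = K f"
        using surj_one_minus_compact[OF compact_map_pencil inj_pencil] by blast
      then show "f \<in> Domain (resolvent z T)" using res by blast
    qed
    show "\<exists>C. \<forall>(x, y)\<in>resolvent z T. norm y \<le> C * norm x"
    proof (intro exI ballI, clarify)
      fix f u assume "(f, u) \<in> resolvent z T"
      then have u: "pencil z u = K f" by (simp add: res)
      then have "norm u \<le> C * norm (K f)" using C(2)[of u] uniq by metis
      also have "\<dots> \<le> C * (norm f * D)" by (intro mult_left_mono D C)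
      finally show "norm u \<le> (C * D) * norm f" by (simp add: mult_ac)
    qed
  qed
  then show False using assms by (simp add: spectrum_def resolvent_set_def)
qed

text \<open>Spectral points near \<open>z\<close> correspond to characteristic values of \<^term>\<open>K\<close> in a bounded set.\<close>

lemma isolated_in_spectrum:
  assumes "z \<in> spectrum T" shows "z isolated_in spectrum T"
proof -
  let ?E = "{\<mu>. cmod \<mu> \<le> cmod (z0 - z) + 1 \<and> (\<exists>x. x \<noteq> 0 \<and> \<mu> *\<^sub>C K x = x)}"
  have "spectrum T \<inter> ball z 1 \<subseteq> (\<lambda>\<mu>. z0 - \<mu>) ` ?E"
  proof
    fix w assume w: "w \<in> spectrum T \<inter> ball z 1"
    then obtain x where "x \<noteq> 0" "pencil w x = 0" using spectrum_imp_eigenvector by blast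
    moreover have "cmod (z0 - w) \<le> cmod (z0 - z) + 1"
      using w norm_triangle_ineq[of "z0 - z" "z - w"] by (simp add: dist_norm)
    ultimately have "z0 - w \<in> ?E" by auto
    then show "w \<in> (\<lambda>\<mu>. z0 - \<mu>) ` ?E" by (rule image_eqI[rotated]) simp
  qed
  then have "finite (spectrum T \<inter> ball z 1)"
    using finite_bounded_characteristic_values[OF K] finite_surj by blast
  then have "\<not> z islimpt spectrum T"
    unfolding islimpt_eq_infinite_ball by (metis zero_less_one)
  with assms show ?thesis by (simp add: isolated_in_islimpt_iff)
qed

theorem purely_discrete_spectrum: "purely_discrete_spectrum T"
  unfolding purely_discrete_spectrum_def
proof (intro conjI ballI)
  show "essential_spectrum T = {}" by (simp add: essential_spectrum_def fredholm_shifted)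
  fix z assume z: "z \<in> spectrum T"
  show "z isolated_in spectrum T" using z by (rule isolated_in_spectrum)
  show "finite_cdim (root_space T z)" by (rule finite_cdim_root_space)
  from spectrum_imp_eigenvector[OF z] obtain x where x: "x \<noteq> 0" "pencil z x = 0" by blast
  have "(x, z *\<^sub>C x) \<in> T"
    using x(2) by (simp add: T_iff cvs.scale_left_diff_distrib K.diff compact_map_scaleC[OF K])
  with x(1) show "eigenvalue T z" unfolding eigenvalue_def by blast
qed

end

section \<open>Accretive perturbations\<close>

text \<open>With \<open>R = (z - T)\<inverse>\<close> and \<open>B = A R\<close>, one has \<open>- 1 - (T + A) = (1 - C) (z - T)\<close> where
\<open>C = B + (z + 1) *\<^sub>C R\<close> is compact. Accretivity makes \<open>1 + T + A\<close> injective, hence \<open>1 - C\<close> is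
injective, hence invertible, and \<open>R (1 - C)\<inverse>\<close> is a compact resolvent of \<open>T + A\<close> at \<open>- 1\<close>.\<close>

theorem purely_discrete_spectrum_accretive_perturbation:
  fixes T A :: "'a::complex_hilbert_space operator"
  assumes T: "linear_operator T" and A: "linear_operator A"
    and R: "compact_operator (resolvent z T)" and AR: "compact_operator (resolvent z T O A)"
    and accretive: "\<And>u f. (u, f) \<in> op_plus T A \<Longrightarrow> Re (cinner f u) \<ge> 0"
  shows "purely_discrete_spectrum (op_plus T A)"
proof -
  obtain R where cR: "compact_map R" and R_iff: "\<And>x y. (x, y) \<in> resolvent z T \<longleftrightarrow> y = R x"
    using compact_operatorE[OF R] by blast
  obtain B where cB: "compact_map B" and B_iff: "\<And>x y. (x, y) \<in> resolvent z T O A \<longleftrightarrow> y = B x"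
    using compact_operatorE[OF AR] by blast
  interpret R: bounded_linear R by (rule bounded_linear_compact_map[OF cR])
  interpret B: bounded_linear B by (rule bounded_linear_compact_map[OF cB])
  have A_iff: "(R f, g) \<in> A \<longleftrightarrow> g = B f" for f g
    using B_iff[of f g] R_iff[of f] by (auto simp: relcomp_unfold)
  have T_iff: "(u, y) \<in> T \<longleftrightarrow> u = R (z *\<^sub>C u - y)" for u y
  proof -
    have "(u, y) \<in> T \<longleftrightarrow> (z *\<^sub>C u - y, u) \<in> resolvent z T"
      by (auto simp: resolvent_def shifted_def)
    then show ?thesis by (simp add: R_iff)
  qed
  have H_iff: "(u, h) \<in> op_plus T A \<longleftrightarrow> (\<exists>f. u = R f \<and> h = (z *\<^sub>C u - f) + B f)" for u h
  proof
    assume "(u, h) \<in> op_plus T A"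
    then obtain y g where yg: "(u, y) \<in> T" "(u, g) \<in> A" "h = y + g" by (auto simp: op_plus_def)
    have u: "u = R (z *\<^sub>C u - y)" using yg by (simp add: T_iff)
    then have "g = B (z *\<^sub>C u - y)" using yg A_iff by metis
    then show "\<exists>f. u = R f \<and> h = (z *\<^sub>C u - f) + B f"
      using u yg by (intro exI[of _ "z *\<^sub>C u - y"]) auto
  next
    assume "\<exists>f. u = R f \<and> h = (z *\<^sub>C u - f) + B f"
    then obtain f where f: "u = R f" "h = (z *\<^sub>C u - f) + B f" by blast
    then have "(u, z *\<^sub>C u - f) \<in> T" "(u, B f) \<in> A" by (simp_all add: T_iff A_iff)
    then show "(u, h) \<in> op_plus T A" using f(2) unfolding op_plus_def by blast
  qed
  define C where "C f = B f + (z + 1) *\<^sub>C R f" for f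
  have cC: "compact_map C"
    unfolding C_def by (intro compact_map_sum cB compact_map_scale cR)
  interpret C: bounded_linear C by (rule bounded_linear_compact_map[OF cC])
  have H_iff': "(u, h) \<in> op_plus T A \<longleftrightarrow> (\<exists>f. u = R f \<and> f - C f = - u - h)" for u h
    unfolding H_iff C_def by (intro arg_cong[of _ _ Ex] ext) (auto simp: algebra_simps scaleC_add_left)
  have R_inj: "f = 0" if "R f = 0" for f
  proof -
    have "(0, - f) \<in> T" using that by (simp add: T_iff)
    moreover have "(0, 0) \<in> T" "single_valued T" using T by (auto simp: linear_operator_def)
    ultimately show ?thesis by (auto dest: single_valuedD)
  qed
  have C_inj: "f = 0" if "f - C f = 0" for f
  proof -
    have "(R f, - R f) \<in> op_plus T A" unfolding H_iff' using that by auto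
    then have "0 \<le> Re (cinner (- R f) (R f))" by (rule accretive)
    then have "0 \<le> inner (- R f) (R f)" by (simp only: inner_eq_Re_cinner)
    then have "inner (R f) (R f) \<le> 0" by simp
    then have "R f = 0" using inner_ge_zero[of "R f"] by (metis antisym inner_eq_zero_iff)
    then show ?thesis by (rule R_inj)
  qed
  have C_inj': "f = g" if "f - C f = g - C g" for f g
    using C_inj[of "f - g"] that by (simp add: C.diff algebra_simps)
  \<comment> \<open>\<open>D\<close> is the inverse of \<open>1 - C\<close>, and \<open>R D\<close> will be the resolvent of \<open>T + A\<close> at \<open>- 1\<close>.\<close>
  obtain D where D: "\<And>f. D f - C (D f) = f"
    using surj_one_minus_compact[OF cC C_inj] by metis
  have D_eqI: "D g = f" if "f - C f = g" for f g using C_inj'[of "D g" f] D that by simp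
  obtain c where c: "c \<ge> 0" "\<And>x. \<exists>x'. x' - C x' = x - C x \<and> norm x' \<le> c * norm (x - C x)"
    using bounded_preimages[OF cC] by blast
  have D_bound: "norm (D f) \<le> c * norm f" for f using c(2)[of "D f"] D C_inj' by metis
  have H_iff'': "(u, h) \<in> op_plus T A \<longleftrightarrow> u = R (D ((- 1) *\<^sub>C u - h))" for u h
  proof
    assume "(u, h) \<in> op_plus T A"
    then obtain f where f: "u = R f" "f - C f = - u - h" unfolding H_iff' by blast
    have "D (- u - h) = f" by (rule D_eqI[OF f(2)])
    then show "u = R (D ((- 1) *\<^sub>C u - h))" using f(1) by simp
  next
    assume "u = R (D ((- 1) *\<^sub>C u - h))"
    then show "(u, h) \<in> op_plus T A"
      unfolding H_iff' by (intro exI[of _ "D (- u - h)"] conjI D) simp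
  qed
  have "compact_map (\<lambda>f. R (D f))"
    unfolding compact_map_def
  proof (intro conjI allI impI)
    show "R (D (x + y)) = R (D x) + R (D y)" for x y
    proof -
      have "D (x + y) = D x + D y"
        by (rule D_eqI) (use D[of x] D[of y] in \<open>simp add: C.add algebra_simps\<close>)
      then show ?thesis by (simp add: R.add)
    qed
    show "R (D (a *\<^sub>C x)) = a *\<^sub>C R (D x)" for a x
    proof -
      have "D (a *\<^sub>C x) = a *\<^sub>C D x"
        by (rule D_eqI) (simp add: compact_map_scaleC[OF cC] cvs.scale_right_diff_distrib[symmetric] D)
      then show ?thesis by (simp add: compact_map_scaleC[OF cR])
    qed
    fix v :: "nat \<Rightarrow> 'a" assume "bounded (range v)"
    then obtain b where b: "\<And>n. norm (v n) \<le> b" by (auto simp: bounded_iff)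
    have "norm (D (v n)) \<le> c * b" for n
      using D_bound[of "v n"] mult_left_mono[OF b[of n] c(1)] by linarith
    then have "bounded (range (\<lambda>n. D (v n)))" by (auto simp: bounded_iff)
    then show "\<exists>l r. strict_mono (r :: nat \<Rightarrow> nat) \<and> (\<lambda>n. R (D (v (r n)))) \<longlonglongrightarrow> l"
      using compact_map_subseq[OF cR, of "\<lambda>n. D (v n)"] by blast
  qed
  moreover have "f = 0" if "R (D f) = 0" for f
    using R_inj[OF that] D[of f] by (simp add: C.zero)
  ultimately interpret compact_resolvent "\<lambda>f. R (D f)" "op_plus T A" "- 1"
    by unfold_locales (simp_all only: H_iff'')
  show ?thesis by (rule purely_discrete_spectrum)
qed

section \<open>Smooth bump functions\<close>

text \<open>Differentiability of finite order, by recursion on the order: closure under sums and products then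
is a plain induction on the order.\<close>

primrec times_differentiable :: "nat \<Rightarrow> (real \<Rightarrow> real) \<Rightarrow> bool" where
  "times_differentiable 0 f \<longleftrightarrow> True"
| "times_differentiable (Suc n) f \<longleftrightarrow>
     (\<exists>f'. (\<forall>x. (f has_real_derivative f' x) (at x)) \<and> times_differentiable n f')"

definition smooth :: "(real \<Rightarrow> real) \<Rightarrow> bool" where
  "smooth f \<longleftrightarrow> (\<forall>n. times_differentiable n f)"

lemma times_differentiable_SucD: "times_differentiable (Suc n) f \<Longrightarrow> times_differentiable n f"
  by (induction n arbitrary: f) auto

lemma times_differentiable_const: "times_differentiable n (\<lambda>_. c)"
  by (induction n arbitrary: c) (auto intro!: exI[of _ "\<lambda>_. 0"])

lemma times_differentiable_add:
  "times_differentiable n f \<Longrightarrow> times_differentiable n g \<Longrightarrow> times_differentiable n (\<lambda>x. f x + g x)"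
proof (induction n arbitrary: f g)
  case (Suc n)
  then obtain f' g' where "\<And>x. (f has_real_derivative f' x) (at x)" "times_differentiable n f'"
    "\<And>x. (g has_real_derivative g' x) (at x)" "times_differentiable n g'" by auto
  with Suc.IH show ?case
    by (auto intro!: exI[of _ "\<lambda>x. f' x + g' x"] derivative_intros)
qed simp

lemma times_differentiable_mult:
  "times_differentiable n f \<Longrightarrow> times_differentiable n g \<Longrightarrow> times_differentiable n (\<lambda>x. f x * g x)"
proof (induction n arbitrary: f g)
  case (Suc n)
  then obtain f' g' where fg: "\<And>x. (f has_real_derivative f' x) (at x)" "times_differentiable n f'"
    "\<And>x. (g has_real_derivative g' x) (at x)" "times_differentiable n g'" by auto
  have "times_differentiable n (\<lambda>x. f' x * g x + g' x * f x)"
    using fg Suc times_differentiable_SucD by (intro times_differentiable_add Suc.IH) auto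
  with fg show ?case
    by (auto intro!: exI[of _ "\<lambda>x. f' x * g x + g' x * f x"] DERIV_mult)
qed simp

lemma times_differentiable_affine:
  "times_differentiable n f \<Longrightarrow> times_differentiable n (\<lambda>x. f (c * x + d))"
proof (induction n arbitrary: f)
  case (Suc n)
  then obtain f' where f': "\<And>x. (f has_real_derivative f' x) (at x)" "times_differentiable n f'"
    by auto
  have "times_differentiable n (\<lambda>x. f' (c * x + d) * c)"
    using Suc.IH[OF f'(2)] times_differentiable_const by (rule times_differentiable_mult)
  moreover have "((\<lambda>x. f (c * x + d)) has_real_derivative f' (c * x + d) * c) (at x)" for x
    by (rule DERIV_chain2[OF f'(1)]) (auto intro!: derivative_eq_intros)
  ultimately show ?case
    unfolding times_differentiable.simps by (intro exI[of _ "\<lambda>x. f' (c * x + d) * c"]) blast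
qed simp

lemma smooth_derivative:
  assumes "smooth f"
  obtains f' where "smooth f'" "\<And>x. (f has_real_derivative f' x) (at x)"
proof -
  from assms have "times_differentiable (Suc n) f" for n by (simp add: smooth_def)
  then obtain F where F: "\<And>n x. (f has_real_derivative F n x) (at x)" "\<And>n. times_differentiable n (F n)"
    unfolding times_differentiable.simps by metis
  \<comment> \<open>The derivatives obtained for the different orders coincide.\<close>
  have "F n = F 0" for n using F(1) DERIV_unique by blast
  then have "smooth (F 0)" using F(2) unfolding smooth_def by metis
  then show thesis using F(1) that by blast
qed

text \<open>The derivatives of \<open>exp (- 1/s)\<close> are combinations of the functions \<open>s\<^sup>-\<^sup>k * exp (- 1/s)\<close>, so it
is this whole family, extended by 0, that is closed under differentiation.\<close>

definition flat :: "nat \<Rightarrow> real \<Rightarrow> real" where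
  "flat k s = (if s > 0 then (1/s)^k * exp (- 1/s) else 0)"

text \<open>The bound makes every \<^term>\<open>flat k\<close> differentiable at 0, with derivative 0.\<close>

lemma flat_le_square: "\<bar>flat k s\<bar> \<le> real (k + 2) ^ (k + 2) * s\<^sup>2"
proof (cases "s > 0")
  case True
  let ?n = "k + 2"
  \<comment> \<open>The exponent \<open>k + 2\<close> leaves a factor \<open>s\<^sup>2\<close> over.\<close>
  have "(1/s / real ?n) ^ ?n \<le> (1 + 1/s / real ?n) ^ ?n"
    using True by (intro power_mono) auto
  also have "\<dots> \<le> exp (1/s)"
    using True by (intro exp_ge_one_plus_x_over_n_power_n) (auto intro: order_trans[of _ 0])
  finally have le: "(1/s / real ?n) ^ ?n \<le> exp (1/s)" .
  define c where "c = real ?n ^ ?n"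
  have "c > 0" by (simp add: c_def)
  from le have "(1/s) ^ ?n / c \<le> exp (1/s)" by (simp only: power_divide c_def)
  with \<open>c > 0\<close> have "(1/s) ^ ?n \<le> c * exp (1/s)"
    by (simp only: pos_divide_le_eq mult.commute)
  then have "(1/s) ^ k * exp (- 1/s) \<le> c * s\<^sup>2"
    using True by (simp add: power_add power2_eq_square exp_minus field_simps)
  then have "(1/s) ^ k * exp (- 1/s) \<le> real ?n ^ ?n * s\<^sup>2" unfolding c_def .
  then show ?thesis using True by (simp add: flat_def)
next
  case False
  then show ?thesis by (simp add: flat_def)
qed

lemma flat_has_derivative:
  "(flat k has_real_derivative flat (k + 2) s - real k * flat (k + 1) s) (at s)"
proof (cases s "0::real" rule: linorder_cases)
  case less
  have "((\<lambda>_. 0) has_real_derivative 0) (at s)" by simp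
  then have "(flat k has_real_derivative 0) (at s)"
    by (rule has_field_derivative_transform_within_open[of _ _ _ "{..<0}"])
      (use less in \<open>auto simp: flat_def\<close>)
  with less show ?thesis by (simp add: flat_def)
next
  case equal
  have "((\<lambda>h. (flat k h - flat k 0) / (h - 0)) \<longlongrightarrow> 0) (at 0)"
  proof (rule Lim_null_comparison)
    show "\<forall>\<^sub>F h in at 0. norm ((flat k h - flat k 0) / (h - 0)) \<le> real (k + 2) ^ (k + 2) * \<bar>h\<bar>"
    proof (rule eventually_at_filter[THEN iffD2], rule always_eventually, intro allI impI)
      fix h :: real assume "h \<noteq> 0"
      then show "norm ((flat k h - flat k 0) / (h - 0)) \<le> real (k + 2) ^ (k + 2) * \<bar>h\<bar>"
        using flat_le_square[of k h]
        by (simp add: flat_def[of k 0] abs_divide divide_le_eq power2_eq_square mult.assoc del: of_nat_add)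
    qed
    show "((\<lambda>h. real (k + 2) ^ (k + 2) * \<bar>h\<bar>) \<longlongrightarrow> 0) (at 0)"
      by (auto intro!: tendsto_eq_intros)
  qed
  then have "(flat k has_real_derivative 0) (at 0)"
    by (simp add: has_field_derivative_iff)
  with equal show ?thesis by (simp add: flat_def)
next
  case greater
  have "((\<lambda>s. (1/s)^k * exp (- 1/s)) has_real_derivative flat (k + 2) s - real k * flat (k + 1) s) (at s)"
    using greater
    apply (auto intro!: derivative_eq_intros simp: flat_def)
    apply (cases k; simp add: field_simps power2_eq_square)
    done
  then show ?thesis
    by (rule has_field_derivative_transform_within_open[of _ _ _ "{0<..}"])
      (use greater in \<open>auto simp: flat_def\<close>)
qed

lemma times_differentiable_flat: "times_differentiable n (flat k)"
proof (induction n arbitrary: k)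
  case (Suc n)
  have "times_differentiable n (\<lambda>s. flat (k + 2) s + (- real k) * flat (k + 1) s)"
    by (intro times_differentiable_add times_differentiable_mult times_differentiable_const Suc.IH)
  then have "times_differentiable n (\<lambda>s. flat (k + 2) s - real k * flat (k + 1) s)" by simp
  then show ?case using flat_has_derivative[of k] unfolding times_differentiable.simps
    by (intro exI[of _ "\<lambda>s. flat (k + 2) s - real k * flat (k + 1) s"]) blast
qed simp

text \<open>The parameter \<^term>\<open>n\<close> dilates: as it grows, the bumps converge to the indicator of the open
interval and are bounded by it.\<close>

definition bump :: "real \<Rightarrow> real \<Rightarrow> nat \<Rightarrow> real \<Rightarrow> real" where
  "bump a b n t = flat 0 (real n * (t - a)) * flat 0 (real n * (b - t))"

lemma smooth_bump: "smooth (bump a b n)"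
proof -
  have "times_differentiable m (\<lambda>t. flat 0 (real n * t + (- real n * a)) * flat 0 ((- real n) * t + real n * b))" for m
    by (intro times_differentiable_mult times_differentiable_affine times_differentiable_flat)
  moreover have "bump a b n = (\<lambda>t. flat 0 (real n * t + (- real n * a)) * flat 0 ((- real n) * t + real n * b))"
    unfolding bump_def by (intro ext arg_cong2[of _ _ _ _ times] arg_cong[of _ _ "flat 0"]) (simp_all add: algebra_simps)
  ultimately show ?thesis unfolding smooth_def by simp
qed

lemma bump_bounds: "0 \<le> bump a b n t" "bump a b n t \<le> 1"
  by (auto simp: bump_def flat_def intro!: mult_le_one)

lemma bump_eq_0: "t \<notin> {a<..<b} \<Longrightarrow> bump a b n t = 0"
  by (auto simp: bump_def flat_def zero_less_mult_iff)

lemma bump_tendsto: "(\<lambda>n. bump a b n t) \<longlonglongrightarrow> indicator {a<..<b} t"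
proof (cases "t \<in> {a<..<b}")
  case True
  have lim: "(\<lambda>n. flat 0 (real n * s)) \<longlonglongrightarrow> 1" if "s > 0" for s
  proof -
    have "(\<lambda>n. exp (- (1 / s) * (1 / real n))) \<longlonglongrightarrow> exp (- (1 / s) * 0)"
      by (intro tendsto_intros lim_1_over_n)
    moreover have "\<forall>\<^sub>F n in sequentially. exp (- (1 / s) * (1 / real n)) = flat 0 (real n * s)"
      using eventually_gt_at_top[of 0] by eventually_elim (use that in \<open>simp add: flat_def mult.commute\<close>)
    ultimately show ?thesis by (simp add: tendsto_cong)
  qed
  show ?thesis
    using tendsto_mult[OF lim lim, of "t - a" "b - t"] True by (simp add: bump_def)
next
  case False
  then show ?thesis by (simp add: bump_eq_0)
qed

definition product_function :: "('a \<Rightarrow> real \<Rightarrow> real) \<Rightarrow> 'a::euclidean_space \<Rightarrow> complex" where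
  "product_function p x = complex_of_real (\<Prod>b\<in>Basis. p b (x \<bullet> b))"

text \<open>Each factor depends on a single coordinate, so a partial derivative replaces one factor by its
derivative, and products of smooth factors are closed under partial derivatives.\<close>

lemma product_function_derivative:
  assumes p: "\<And>b x. b \<in> Basis \<Longrightarrow> (p b has_real_derivative p' b x) (at x)"
  shows "(product_function p has_derivative
     (\<lambda>h. \<Sum>b\<in>Basis. complex_of_real (h \<bullet> b) * product_function (p(b := p' b)) x)) (at x)"
proof -
  have "((\<lambda>x. p b (x \<bullet> b)) has_derivative (\<lambda>h. (h \<bullet> b) * p' b (x \<bullet> b))) (at x)" if "b \<in> Basis" for b
    using has_derivative_compose[of "\<lambda>x. x \<bullet> b" "\<lambda>h. h \<bullet> b" x UNIV "p b" "\<lambda>h. p' b (x \<bullet> b) * h"]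
      p[OF that, of "x \<bullet> b"] bounded_linear_imp_has_derivative[OF bounded_linear_inner_left, of b "at x"]
    by (simp add: has_field_derivative_def mult.commute[of _ "p' b (x \<bullet> b)"])
  then have "((\<lambda>x. \<Prod>b\<in>Basis. p b (x \<bullet> b)) has_derivative
      (\<lambda>h. \<Sum>b\<in>Basis. (h \<bullet> b) * p' b (x \<bullet> b) * (\<Prod>c\<in>Basis - {b}. p c (x \<bullet> c)))) (at x)"
    by (rule has_derivative_prod)
  then have "(product_function p has_derivative
      (\<lambda>h. complex_of_real (\<Sum>b\<in>Basis. (h \<bullet> b) * p' b (x \<bullet> b) * (\<Prod>c\<in>Basis - {b}. p c (x \<bullet> c))))) (at x)"
    unfolding product_function_def[abs_def] by (rule has_derivative_of_real)
  moreover have "p' b (x \<bullet> b) * (\<Prod>c\<in>Basis - {b}. p c (x \<bullet> c)) = (\<Prod>c\<in>Basis. (p(b := p' b)) c (x \<bullet> c))"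
    if "b \<in> Basis" for b
    by (subst prod.remove[OF finite_Basis that]) (auto intro: prod.cong)
  ultimately show ?thesis
    by (simp add: product_function_def mult.assoc)
qed

lemma Ck_product_function:
  assumes "\<And>b. b \<in> Basis \<Longrightarrow> smooth (p b)"
  shows "Ck k (product_function p :: 'a::euclidean_space \<Rightarrow> complex)"
  using assms
proof (induction k arbitrary: p)
  case (0 p)
  then have "\<forall>b\<in>Basis. \<exists>p'. \<forall>x. (p b has_real_derivative p' x) (at x)"
    using smooth_derivative by metis
  then obtain p' where "\<And>b x. b \<in> Basis \<Longrightarrow> (p b has_real_derivative p' b x) (at x)" by metis
  from product_function_derivative[of p p', OF this] show ?case
    by (auto intro!: continuous_at_imp_continuous_on has_derivative_continuous)
next
  case (Suc k p)
  then have "\<forall>b\<in>Basis. \<exists>p'. smooth p' \<and> (\<forall>x. (p b has_real_derivative p' x) (at x))"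
    using smooth_derivative by metis
  then obtain p' where p': "\<And>b. b \<in> Basis \<Longrightarrow> smooth (p' b)"
    "\<And>b x. b \<in> Basis \<Longrightarrow> (p b has_real_derivative p' b x) (at x)" by metis
  note deriv = product_function_derivative[of p p', OF p'(2)]
  have "(\<lambda>x. frechet_derivative (product_function p) (at x) b) = product_function (p(b := p' b))"
    if b: "b \<in> Basis" for b
  proof
    fix x :: 'a
    have "frechet_derivative (product_function p) (at x) b
        = (\<Sum>c\<in>Basis. complex_of_real (b \<bullet> c) * product_function (p(c := p' c)) x)"
      using frechet_derivative_at[OF deriv[of x]] by (simp add: fun_eq_iff)
    also have "\<dots> = (\<Sum>c\<in>Basis. if c = b then product_function (p(c := p' c)) x else 0)"
      using b by (intro sum.cong) (auto simp: inner_Basis)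
    also have "\<dots> = product_function (p(b := p' b)) x"
      using b by simp
    finally show "frechet_derivative (product_function p) (at x) b = product_function (p(b := p' b)) x" .
  qed
  moreover have "Ck k (product_function (p(b := p' b)) :: 'a \<Rightarrow> complex)" if "b \<in> Basis" for b
    using Suc.prems p' that by (intro Suc.IH) auto
  moreover have "product_function p differentiable (at x)" for x :: 'a
    using deriv[of x] by (auto simp: differentiable_def)
  ultimately show ?case by simp
qed

definition box_bump :: "'a::euclidean_space \<Rightarrow> 'a \<Rightarrow> nat \<Rightarrow> 'a \<Rightarrow> complex" where
  "box_bump a b n = product_function (\<lambda>c. bump (a \<bullet> c) (b \<bullet> c) n)"

lemma box_bump_eq_0:
  assumes "x \<notin> box a b" shows "box_bump a b n x = 0"
proof -
  from assms obtain c where "c \<in> Basis" "x \<bullet> c \<notin> {a \<bullet> c<..<b \<bullet> c}" by (auto simp: mem_box)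
  then show ?thesis by (auto simp: box_bump_def product_function_def bump_eq_0 intro!: bexI[of _ c])
qed

lemma box_bump_test_function: "box_bump a b n \<in> test_functions"
proof -
  have "Ck k (box_bump a b n)" for k
    unfolding box_bump_def by (intro Ck_product_function smooth_bump)
  moreover have "closure {x. box_bump a b n x \<noteq> 0} \<subseteq> cbox a b"
    using box_bump_eq_0 box_subset_cbox by (intro closure_minimal closed_cbox) fastforce
  then have "compact (closure {x. box_bump a b n x \<noteq> 0})"
    using compact_cbox closed_Int_compact[OF closed_closure compact_cbox]
    by (metis Int_absorb2)
  ultimately show ?thesis by (simp add: test_functions_def)
qed

lemma norm_box_bump_le: "norm (box_bump a b n x) \<le> indicator (box a b) x"
proof (cases "x \<in> box a b")
  case True
  have "\<bar>\<Prod>c\<in>Basis. bump (a \<bullet> c) (b \<bullet> c) n (x \<bullet> c)\<bar> \<le> 1"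
    by (subst abs_prod, rule prod_le_1) (auto simp: bump_bounds abs_of_nonneg)
  then show ?thesis
    using True unfolding box_bump_def product_function_def norm_of_real by simp
qed (simp add: box_bump_eq_0)

lemma box_bump_tendsto: "(\<lambda>n. box_bump a b n x) \<longlonglongrightarrow> indicator (box a b) x"
proof -
  have "(\<lambda>n. complex_of_real (\<Prod>c\<in>Basis. bump (a \<bullet> c) (b \<bullet> c) n (x \<bullet> c)))
      \<longlonglongrightarrow> complex_of_real (\<Prod>c\<in>Basis. indicator {a \<bullet> c<..<b \<bullet> c} (x \<bullet> c))"
    by (intro tendsto_of_real tendsto_prod bump_tendsto)
  also have "(\<Prod>c\<in>Basis. indicator {a \<bullet> c<..<b \<bullet> c} (x \<bullet> c)) = (indicator (box a b) x :: real)"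
    by (auto simp: indicator_def mem_box prod_zero_iff)
  finally show ?thesis
    unfolding box_bump_def product_function_def by (cases "x \<in> box a b") simp_all
qed

lemma continuous_test_function: "\<phi> \<in> test_functions \<Longrightarrow> continuous_on UNIV \<phi>"
  by (auto simp: test_functions_def dest: spec[of _ 0])

section \<open>The fundamental lemma of the calculus of variations\<close>

text \<open>The positive and the negative part of \<^term>\<open>h\<close> are densities of measures that agree on boxes, hence agree.\<close>

lemma AE_eq_0_of_box_integrals:
  fixes h :: "'a::euclidean_space \<Rightarrow> real"
  assumes [measurable]: "h \<in> borel_measurable borel"
    and int: "\<And>a b. integrable lborel (\<lambda>x. indicator (box a b) x * h x)"
    and zero: "\<And>a b. (\<integral>x. indicator (box a b) x * h x \<partial>lborel) = 0"
  shows "AE x in lborel. h x = 0"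
proof -
  let ?p = "\<lambda>x. ennreal (max 0 (h x))" and ?m = "\<lambda>x. ennreal (max 0 (- h x))"
  have eq: "emeasure (density lborel ?p) (box a b) = emeasure (density lborel ?m) (box a b)"
    and fin: "emeasure (density lborel ?p) (box a b) \<noteq> \<infinity>" for a b :: 'a
  proof -
    let ?I = "indicator (box a b) :: 'a \<Rightarrow> real"
    have ip: "integrable lborel (\<lambda>x. max 0 (?I x * h x))" and im: "integrable lborel (\<lambda>x. max 0 (- (?I x * h x)))"
      by (intro Bochner_Integration.integrable_max Bochner_Integration.integrable_minus int integrable_zero)+
    have p: "emeasure (density lborel ?p) (box a b) = ennreal (\<integral>x. max 0 (?I x * h x) \<partial>lborel)"
      by (subst emeasure_density, simp, simp, subst nn_integral_eq_integral[OF ip, symmetric])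
        (auto intro!: nn_integral_cong simp: indicator_def)
    have m: "emeasure (density lborel ?m) (box a b) = ennreal (\<integral>x. max 0 (- (?I x * h x)) \<partial>lborel)"
      by (subst emeasure_density, simp, simp, subst nn_integral_eq_integral[OF im, symmetric])
        (auto intro!: nn_integral_cong simp: indicator_def)
    have "(\<integral>x. max 0 (?I x * h x) \<partial>lborel) - (\<integral>x. max 0 (- (?I x * h x)) \<partial>lborel)
        = (\<integral>x. max 0 (?I x * h x) - max 0 (- (?I x * h x)) \<partial>lborel)"
      by (rule Bochner_Integration.integral_diff[OF ip im, symmetric])
    also have "\<dots> = (\<integral>x. ?I x * h x \<partial>lborel)"
      by (intro Bochner_Integration.integral_cong) (auto simp: max_def)
    also have "\<dots> = 0" by (rule zero)
    finally show "emeasure (density lborel ?p) (box a b) = emeasure (density lborel ?m) (box a b)"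
      unfolding p m by simp
    show "emeasure (density lborel ?p) (box a b) \<noteq> \<infinity>" unfolding p by simp
  qed
  have "density lborel ?p = density lborel ?m"
  proof (rule measure_eqI_generator_eq)
    let ?E = "range (\<lambda>(a, b). box a b::'a set)"
    show "Int_stable ?E" by (auto simp: Int_stable_def box_Int_box)
    show "?E \<subseteq> Pow UNIV" "sets (density lborel ?p) = sigma_sets UNIV ?E"
      "sets (density lborel ?m) = sigma_sets UNIV ?E"
      by (simp_all add: borel_eq_box)
    let ?A = "\<lambda>n::nat. box (- (real n *\<^sub>R One)) (real n *\<^sub>R One) :: 'a set"
    show "range ?A \<subseteq> ?E" "(\<Union>i. ?A i) = UNIV" unfolding UN_box_eq_UNIV by auto
    show "emeasure (density lborel ?p) (?A i) \<noteq> \<infinity>" for i by (rule fin)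
    show "emeasure (density lborel ?p) X = emeasure (density lborel ?m) X" if "X \<in> ?E" for X
      using that eq by auto
  qed
  then have "AE x in lborel. ?p x = ?m x"
    by (intro sigma_finite_measure.density_unique[OF sigma_finite_lborel]) auto
  then show ?thesis
    by eventually_elim (auto simp: max_def split: if_splits)
qed

text \<open>The fundamental lemma of the calculus of variations. Box bumps converge to indicators of boxes and
are dominated by them, so the integral over every box vanishes.\<close>

lemma fundamental_lemma:
  fixes f :: "'a::euclidean_space \<Rightarrow> complex"
  assumes [measurable]: "f \<in> borel_measurable borel"
    and int: "\<And>a b. integrable lborel (\<lambda>x. indicator (box a b) x *\<^sub>R f x)"
    and zero: "\<And>\<phi>. \<phi> \<in> test_functions \<Longrightarrow> (\<integral>x. f x * \<phi> x \<partial>lborel) = 0"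
  shows "AE x in lborel. f x = 0"
proof -
  have box0: "(\<integral>x. indicator (box a b) x *\<^sub>R f x \<partial>lborel) = 0" for a b
  proof -
    have "(\<lambda>n. \<integral>x. f x * box_bump a b n x \<partial>lborel) \<longlonglongrightarrow> (\<integral>x. indicator (box a b) x *\<^sub>R f x \<partial>lborel)"
    proof (rule integral_dominated_convergence)
      have [measurable]: "box_bump a b n \<in> borel_measurable borel" for n
        by (intro borel_measurable_continuous_onI continuous_test_function box_bump_test_function)
      show "(\<lambda>x. f x * box_bump a b n x) \<in> borel_measurable lborel" for n by measurable
      show "(\<lambda>x. indicator (box a b) x *\<^sub>R f x) \<in> borel_measurable lborel" by measurable
      show "integrable lborel (\<lambda>x. norm (indicator (box a b) x *\<^sub>R f x))" using int by (rule integrable_norm)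
      show "AE x in lborel. norm (f x * box_bump a b n x) \<le> norm (indicator (box a b) x *\<^sub>R f x)" for n
        by (intro AE_I2) (auto simp: norm_mult mult.commute[of "cmod (f _)"] intro!: mult_right_mono norm_box_bump_le)
      show "AE x in lborel. (\<lambda>n. f x * box_bump a b n x) \<longlonglongrightarrow> indicator (box a b) x *\<^sub>R f x"
      proof (intro AE_I2)
        fix x
        have "(\<lambda>n. f x * box_bump a b n x) \<longlonglongrightarrow> f x * indicator (box a b) x"
          by (intro tendsto_mult tendsto_const box_bump_tendsto)
        also have "f x * indicator (box a b) x = indicator (box a b) x *\<^sub>R f x" by (simp add: indicator_def)
        finally show "(\<lambda>n. f x * box_bump a b n x) \<longlonglongrightarrow> indicator (box a b) x *\<^sub>R f x" .
      qed
    qed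
    then show ?thesis
      by (simp add: zero box_bump_test_function LIMSEQ_const_iff)
  qed
  have "AE x in lborel. Re (f x) = 0"
  proof (rule AE_eq_0_of_box_integrals)
    show "integrable lborel (\<lambda>x. indicator (box a b) x * Re (f x))" for a b
      using integrable_Re[OF int[of a b]] by simp
    show "(\<integral>x. indicator (box a b) x * Re (f x) \<partial>lborel) = 0" for a b
      using integral_Re[OF int[of a b]] by (simp add: box0)
  qed measurable
  moreover have "AE x in lborel. Im (f x) = 0"
  proof (rule AE_eq_0_of_box_integrals)
    show "integrable lborel (\<lambda>x. indicator (box a b) x * Im (f x))" for a b
      using integrable_Im[OF int[of a b]] by simp
    show "(\<integral>x. indicator (box a b) x * Im (f x) \<partial>lborel) = 0" for a b
      using integral_Im[OF int[of a b]] by (simp add: box0)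
  qed measurable
  ultimately show ?thesis by eventually_elim (simp add: complex_eq_iff)
qed

section \<open>Translations and weak derivatives\<close>

text \<open>Borel functions, rather than Lebesgue measurable ones, because they can be composed with maps such as
\<open>(x, s) \<mapsto> x + s *\<^sub>R v\<close> and fed to Fubini's theorem.\<close>

definition borel_L2 :: "('a::euclidean_space \<Rightarrow> complex) \<Rightarrow> bool" where
  "borel_L2 f \<longleftrightarrow> f \<in> borel_measurable borel \<and> (\<integral>\<^sup>+x. ennreal ((cmod (f x))\<^sup>2) \<partial>lborel) < \<infinity>"

lemma nn_integral_lborel_translate:
  fixes f :: "'a::euclidean_space \<Rightarrow> ennreal"
  assumes [measurable]: "f \<in> borel_measurable borel"
  shows "(\<integral>\<^sup>+x. f (x + c) \<partial>lborel) = (\<integral>\<^sup>+x. f x \<partial>lborel)"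
proof -
  have "(\<integral>\<^sup>+x. f x \<partial>lborel) = (\<integral>\<^sup>+x. f x \<partial>distr lborel borel ((+) c))"
    by (simp add: lborel_distr_plus)
  also have "\<dots> = (\<integral>\<^sup>+x. f (c + x) \<partial>lborel)"
    by (rule nn_integral_distr) measurable
  finally show ?thesis by (simp add: add.commute)
qed

lemma integral_lborel_translate:
  fixes f :: "'a::euclidean_space \<Rightarrow> complex"
  assumes [measurable]: "f \<in> borel_measurable borel"
  shows "(\<integral>x. f (x + c) \<partial>lborel) = (\<integral>x. f x \<partial>lborel)"
proof -
  have "(\<integral>x. f x \<partial>lborel) = (\<integral>x. f x \<partial>distr lborel borel ((+) c))"
    by (simp add: lborel_distr_plus)
  also have "\<dots> = (\<integral>x. f (c + x) \<partial>lborel)"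
    by (rule integral_distr) measurable
  finally show ?thesis by (simp add: add.commute)
qed

lemma borel_L2_translate:
  assumes "borel_L2 f" shows "borel_L2 (\<lambda>x. f (x + c))"
proof -
  have [measurable]: "f \<in> borel_measurable borel" using assms by (simp add: borel_L2_def)
  show ?thesis
    using assms nn_integral_lborel_translate[of "\<lambda>x. ennreal ((cmod (f x))\<^sup>2)" c]
    by (simp add: borel_L2_def)
qed

lemma nn_integral_mult_le:
  assumes "borel_L2 f" "borel_L2 g"
  shows "(\<integral>\<^sup>+x. ennreal (cmod (f x * g x)) \<partial>lborel)
    \<le> (\<integral>\<^sup>+x. ennreal ((cmod (f x))\<^sup>2) \<partial>lborel) + (\<integral>\<^sup>+x. ennreal ((cmod (g x))\<^sup>2) \<partial>lborel)"
proof -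
  have [measurable]: "f \<in> borel_measurable borel" "g \<in> borel_measurable borel"
    using assms by (simp_all add: borel_L2_def)
  have le: "cmod (f x * g x) \<le> (cmod (f x))\<^sup>2 + (cmod (g x))\<^sup>2" for x
    using sum_squares_bound[of "cmod (f x)" "cmod (g x)"]
      mult_nonneg_nonneg[OF norm_ge_zero[of "f x"] norm_ge_zero[of "g x"]]
    unfolding norm_mult by linarith
  have "(\<integral>\<^sup>+x. ennreal (cmod (f x * g x)) \<partial>lborel)
      \<le> (\<integral>\<^sup>+x. ennreal ((cmod (f x))\<^sup>2) + ennreal ((cmod (g x))\<^sup>2) \<partial>lborel)"
    by (intro nn_integral_mono) (simp add: ennreal_plus[symmetric] le del: ennreal_plus)
  also have "\<dots> = (\<integral>\<^sup>+x. ennreal ((cmod (f x))\<^sup>2) \<partial>lborel) + (\<integral>\<^sup>+x. ennreal ((cmod (g x))\<^sup>2) \<partial>lborel)"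
    by (rule nn_integral_add) measurable
  finally show ?thesis .
qed

lemma integrable_borel_L2_mult:
  assumes "borel_L2 f" "borel_L2 g"
  shows "integrable lborel (\<lambda>x. f x * g x)"
proof (rule integrableI_bounded)
  have [measurable]: "f \<in> borel_measurable borel" "g \<in> borel_measurable borel"
    using assms by (simp_all add: borel_L2_def)
  show "(\<lambda>x. f x * g x) \<in> borel_measurable lborel" by measurable
  show "(\<integral>\<^sup>+x. ennreal (norm (f x * g x)) \<partial>lborel) < \<infinity>"
    using nn_integral_mult_le[OF assms] assms
    by (auto simp: borel_L2_def intro: le_less_trans)
qed

lemma borel_L2_indicator_box: "borel_L2 (indicator (box a b))"
proof -
  have "(\<integral>\<^sup>+x. ennreal ((cmod (indicator (box a b) x))\<^sup>2) \<partial>lborel) = (\<integral>\<^sup>+x. indicator (box a b) x \<partial>lborel)"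
    by (intro nn_integral_cong) (auto simp: indicator_def)
  also have "\<dots> < \<infinity>" using emeasure_bounded_finite[OF bounded_box[of a b]] by simp
  finally show ?thesis by (simp add: borel_L2_def)
qed

lemma borel_L2_compact_support:
  assumes "continuous_on UNIV \<psi>" "compact S" "\<And>x. x \<notin> S \<Longrightarrow> \<psi> x = 0"
  shows "borel_L2 (\<psi> :: 'a::euclidean_space \<Rightarrow> complex)"
proof -
  have [measurable]: "\<psi> \<in> borel_measurable borel" using assms(1) by (rule borel_measurable_continuous_onI)
  have "compact (\<psi> ` S)" using assms by (intro compact_continuous_image) (auto intro: continuous_on_subset)
  then have "\<exists>M. \<forall>x\<in>S. cmod (\<psi> x) \<le> M"
    by (auto simp: bounded_iff dest!: compact_imp_bounded)
  then obtain M where M: "\<And>x. x \<in> S \<Longrightarrow> cmod (\<psi> x) \<le> M" by blast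
  have [measurable]: "S \<in> sets borel" using assms(2) by (simp add: compact_imp_closed)
  have "(\<integral>\<^sup>+x. ennreal ((cmod (\<psi> x))\<^sup>2) \<partial>lborel) \<le> (\<integral>\<^sup>+x. ennreal (M\<^sup>2) * indicator S x \<partial>lborel)"
    using M assms(3) by (intro nn_integral_mono) (auto simp: indicator_def intro!: ennreal_leI power_mono)
  also have "\<dots> = ennreal (M\<^sup>2) * emeasure lborel S"
    by (subst nn_integral_cmult_indicator) auto
  also have "\<dots> < \<infinity>"
    using emeasure_compact_finite[OF assms(2)] by (simp add: ennreal_mult_less_top)
  finally show ?thesis by (simp add: borel_L2_def)
qed

lemma Ck_translate: "Ck k \<phi> \<Longrightarrow> Ck k (\<lambda>x. \<phi> (x + c))"
proof (induction k arbitrary: \<phi>)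
  case 0
  then show ?case
    by (auto intro!: continuous_on_compose2[of UNIV \<phi>] continuous_intros)
next
  case (Suc k)
  have der: "((\<lambda>x. \<phi> (x + c)) has_derivative frechet_derivative \<phi> (at (x + c))) (at x)" for x
  proof -
    have "(\<phi> has_derivative frechet_derivative \<phi> (at (x + c))) (at (x + c))"
      using Suc.prems by (simp add: frechet_derivative_works[symmetric])
    then show ?thesis
      by (rule has_derivative_compose[rotated, of \<phi> _ "\<lambda>x. x + c" x "\<lambda>h. h"])
        (auto intro!: derivative_eq_intros)
  qed
  have "frechet_derivative (\<lambda>x. \<phi> (x + c)) (at x) = frechet_derivative \<phi> (at (x + c))" for x
    using frechet_derivative_at[OF der[of x]] by simp
  moreover have "Ck k (\<lambda>x. frechet_derivative \<phi> (at (x + c)) b)" if "b \<in> Basis" for b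
    using Suc.IH[of "\<lambda>x. frechet_derivative \<phi> (at x) b"] Suc.prems that by simp
  ultimately show ?case using der by (auto simp: differentiable_def)
qed

lemma frechet_derivative_translate:
  assumes "\<And>x. \<phi> differentiable (at x)"
  shows "frechet_derivative (\<lambda>x. \<phi> (x + c)) (at x) = frechet_derivative \<phi> (at (x + c))"
proof -
  have "((\<lambda>x. \<phi> (x + c)) has_derivative frechet_derivative \<phi> (at (x + c))) (at x)"
    using assms by (intro has_derivative_compose[of "\<lambda>x. x + c" "\<lambda>h. h" x UNIV \<phi>])
      (auto intro!: derivative_eq_intros simp: frechet_derivative_works[symmetric])
  from frechet_derivative_at[OF this] show ?thesis by simp
qed

lemma test_function_translate:
  assumes "\<phi> \<in> test_functions" shows "(\<lambda>x. \<phi> (x + c)) \<in> test_functions"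
proof -
  have "{x. \<phi> (x + c) \<noteq> 0} = (+) (- c) ` {x. \<phi> x \<noteq> 0}"
    by (auto simp: image_iff intro!: exI[of _ "_ + c"])
  then have "closure {x. \<phi> (x + c) \<noteq> 0} = (+) (- c) ` closure {x. \<phi> x \<noteq> 0}"
    by (simp only: closure_translation)
  then have "compact (closure {x. \<phi> (x + c) \<noteq> 0})"
    using compact_translation[of "closure {x. \<phi> x \<noteq> 0}" "- c"] assms
    by (simp only: test_functions_def mem_Collect_eq)
  then show ?thesis using assms Ck_translate unfolding test_functions_def by blast
qed

context
  fixes \<phi> :: "'a::euclidean_space \<Rightarrow> complex"
  assumes \<phi>: "\<phi> \<in> test_functions"
begin

lemma test_function_differentiable: "\<phi> differentiable (at x)"
  using \<phi> by (auto simp: test_functions_def dest: spec[of _ "Suc 0"])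

lemma test_function_has_derivative: "(\<phi> has_derivative frechet_derivative \<phi> (at x)) (at x)"
  using test_function_differentiable by (simp add: frechet_derivative_works[symmetric])

lemma directional_derivative_sum:
  "frechet_derivative \<phi> (at x) v = (\<Sum>b\<in>Basis. (v \<bullet> b) *\<^sub>R frechet_derivative \<phi> (at x) b)"
proof -
  interpret D: bounded_linear "frechet_derivative \<phi> (at x)"
    by (rule has_derivative_bounded_linear[OF test_function_has_derivative])
  have "frechet_derivative \<phi> (at x) v = frechet_derivative \<phi> (at x) (\<Sum>b\<in>Basis. (v \<bullet> b) *\<^sub>R b)"
    by (simp add: euclidean_representation)
  then show ?thesis by (simp add: D.sum D.scaleR)
qed

lemma continuous_directional_derivative: "continuous_on UNIV (\<lambda>x. frechet_derivative \<phi> (at x) v)"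
  unfolding directional_derivative_sum[of _ v]
  using \<phi> by (intro continuous_intros) (auto simp: test_functions_def dest: spec[of _ "Suc 0"])

lemma borel_L2_test_function: "borel_L2 \<phi>"
proof (rule borel_L2_compact_support)
  show "continuous_on UNIV \<phi>" using \<phi> by (rule continuous_test_function)
  show "compact (closure {x. \<phi> x \<noteq> 0})" using \<phi> by (simp add: test_functions_def)
  show "\<phi> x = 0" if "x \<notin> closure {x. \<phi> x \<noteq> 0}" for x
    using that closure_subset[of "{x. \<phi> x \<noteq> 0}"] by auto
qed

lemma borel_L2_directional_derivative: "borel_L2 (\<lambda>x. frechet_derivative \<phi> (at x) v)"
proof (rule borel_L2_compact_support)
  show "continuous_on UNIV (\<lambda>x. frechet_derivative \<phi> (at x) v)"
    by (rule continuous_directional_derivative)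
  let ?S = "closure {x. \<phi> x \<noteq> 0}"
  show "compact ?S" using \<phi> by (simp add: test_functions_def)
  fix x assume x: "x \<notin> ?S"
  have "(\<phi> has_derivative (\<lambda>_. 0)) (at x)"
  proof (rule has_derivative_transform_within_open)
    show "((\<lambda>_. 0) has_derivative (\<lambda>_. 0)) (at x)" by simp
    show "open (- ?S)" "x \<in> - ?S" using x by auto
    show "0 = \<phi> y" if "y \<in> - ?S" for y using that closure_subset[of "{x. \<phi> x \<noteq> 0}"] by auto
  qed
  then show "frechet_derivative \<phi> (at x) v = 0"
    by (simp add: frechet_derivative_at[symmetric])
qed

text \<open>The fundamental theorem of calculus along the segment from \<^term>\<open>y\<close> to \<^term>\<open>y - v\<close>; the
direction is the one in which test functions are shifted when \<open>u\<close> is shifted by \<^term>\<open>v\<close>.\<close>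

lemma line_integral_directional_derivative:
  "(\<integral>s. indicator {0..1} s *\<^sub>R frechet_derivative \<phi> (at (y + s *\<^sub>R (- v))) v \<partial>lborel) = \<phi> y - \<phi> (y - v)"
proof -
  have "(\<integral>s. indicator {0..1} s *\<^sub>R frechet_derivative \<phi> (at (y + s *\<^sub>R (- v))) v \<partial>lborel)
      = - \<phi> (y + 1 *\<^sub>R (- v)) - (- \<phi> (y + 0 *\<^sub>R (- v)))"
  proof (rule integral_FTC_atLeastAtMost)
    show "continuous_on {0..1} (\<lambda>s. frechet_derivative \<phi> (at (y + s *\<^sub>R (- v))) v)"
      by (rule continuous_on_compose2[OF continuous_directional_derivative]) (auto intro!: continuous_intros)
    fix s :: real
    interpret D: bounded_linear "frechet_derivative \<phi> (at (y + s *\<^sub>R (- v)))"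
      by (rule has_derivative_bounded_linear[OF test_function_has_derivative])
    have eq: "frechet_derivative \<phi> (at (y + s *\<^sub>R (- v))) (h *\<^sub>R (- v))
        = - (h *\<^sub>R frechet_derivative \<phi> (at (y + s *\<^sub>R (- v))) v)" for h
      by (subst D.scaleR, subst D.neg, rule scaleR_minus_right)
    have "((\<lambda>s. y + s *\<^sub>R (- v)) has_derivative (\<lambda>h. h *\<^sub>R (- v))) (at s within {0..1})"
      by (auto intro!: derivative_eq_intros)
    from has_derivative_compose[OF this test_function_has_derivative]
    have "((\<lambda>s. - \<phi> (y + s *\<^sub>R (- v))) has_derivative
        (\<lambda>h. - frechet_derivative \<phi> (at (y + s *\<^sub>R (- v))) (h *\<^sub>R (- v)))) (at s within {0..1})"
      by (rule has_derivative_minus)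
    then show "((\<lambda>s. - \<phi> (y + s *\<^sub>R (- v))) has_vector_derivative
        frechet_derivative \<phi> (at (y + s *\<^sub>R (- v))) v) (at s within {0..1})"
      unfolding has_vector_derivative_def eq minus_minus .
  qed simp
  then show ?thesis by simp
qed

end

text \<open>This justifies both applications of Fubini's theorem in the translation estimate: the \<open>L\<^sup>2\<close> norms of the
factors do not depend on the shift.\<close>

lemma integrable_pair_translates:
  fixes f g :: "'a::euclidean_space \<Rightarrow> complex"
  assumes f: "borel_L2 f" and g: "borel_L2 g"
  shows "integrable (lborel \<Otimes>\<^sub>M lborel)
    (\<lambda>(x, s). indicator {0..1::real} s *\<^sub>R (f (x + s *\<^sub>R p) * g (x + s *\<^sub>R q)))"
proof (rule integrableI_bounded)
  have [measurable]: "f \<in> borel_measurable borel" "g \<in> borel_measurable borel"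
    using assms by (simp_all add: borel_L2_def)
  let ?F = "\<lambda>(x, s). indicator {0..1::real} s *\<^sub>R (f (x + s *\<^sub>R p) * g (x + s *\<^sub>R q))"
  let ?C = "(\<integral>\<^sup>+x. ennreal ((cmod (f x))\<^sup>2) \<partial>lborel) + (\<integral>\<^sup>+x. ennreal ((cmod (g x))\<^sup>2) \<partial>lborel)"
  show meas [measurable]: "?F \<in> borel_measurable (lborel \<Otimes>\<^sub>M lborel)" by measurable
  have "(\<integral>\<^sup>+z. ennreal (norm (?F z)) \<partial>(lborel \<Otimes>\<^sub>M lborel))
      = (\<integral>\<^sup>+s. (\<integral>\<^sup>+x. ennreal (norm (?F (x, s))) \<partial>lborel) \<partial>lborel)"
    by (rule lborel_pair.nn_integral_snd[symmetric]) measurable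
  also have "\<dots> \<le> (\<integral>\<^sup>+s. ?C * indicator {0..1::real} s \<partial>lborel)"
  proof (intro nn_integral_mono)
    fix s :: real
    have "(\<integral>\<^sup>+x. ennreal (cmod (f (x + s *\<^sub>R p) * g (x + s *\<^sub>R q))) \<partial>lborel) \<le> ?C"
      using nn_integral_mult_le[OF borel_L2_translate[OF f, of "s *\<^sub>R p"] borel_L2_translate[OF g, of "s *\<^sub>R q"]]
        nn_integral_lborel_translate[of "\<lambda>x. ennreal ((cmod (f x))\<^sup>2)" "s *\<^sub>R p"]
        nn_integral_lborel_translate[of "\<lambda>x. ennreal ((cmod (g x))\<^sup>2)" "s *\<^sub>R q"]
      by simp
    then show "(\<integral>\<^sup>+x. ennreal (norm (?F (x, s))) \<partial>lborel) \<le> ?C * indicator {0..1::real} s"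
      by (auto simp: indicator_def)
  qed
  also have "\<dots> = ?C * emeasure lborel {0..1::real}"
    by (rule nn_integral_cmult_indicator) simp
  also have "\<dots> < \<infinity>" using assms by (simp add: borel_L2_def)
  finally show "(\<integral>\<^sup>+z. ennreal (norm (?F z)) \<partial>(lborel \<Otimes>\<^sub>M lborel)) < \<infinity>" .
qed

lemma nn_integral_segment_average_le:
  fixes g :: "'a::euclidean_space \<Rightarrow> complex"
  assumes "borel_L2 g"
  shows "(\<integral>\<^sup>+x. ennreal ((cmod (\<integral>s. indicator {0..1::real} s *\<^sub>R g (x + s *\<^sub>R v) \<partial>lborel))\<^sup>2) \<partial>lborel)
    \<le> (\<integral>\<^sup>+x. ennreal ((cmod (g x))\<^sup>2) \<partial>lborel)"
proof -
  have [measurable]: "g \<in> borel_measurable borel"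
    using assms by (simp_all add: borel_L2_def)
  let ?I = "\<lambda>s. indicator {0..1::real} s :: ennreal"
  have le: "ennreal ((cmod (\<integral>s. indicator {0..1::real} s *\<^sub>R g (x + s *\<^sub>R v) \<partial>lborel))\<^sup>2)
      \<le> (\<integral>\<^sup>+s. ?I s * ennreal ((cmod (g (x + s *\<^sub>R v)))\<^sup>2) \<partial>lborel)" for x
  proof (cases "integrable lborel (\<lambda>s. indicator {0..1::real} s *\<^sub>R g (x + s *\<^sub>R v))")
    case True
    have "ennreal (cmod (\<integral>s. indicator {0..1::real} s *\<^sub>R g (x + s *\<^sub>R v) \<partial>lborel))
        \<le> (\<integral>\<^sup>+s. ?I s * (?I s * ennreal (cmod (g (x + s *\<^sub>R v)))) \<partial>lborel)"
      by (rule order_trans[OF integral_norm_bound_ennreal[OF True]])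
        (auto intro!: nn_integral_mono simp: indicator_def)
    then have "(ennreal (cmod (\<integral>s. indicator {0..1::real} s *\<^sub>R g (x + s *\<^sub>R v) \<partial>lborel)))\<^sup>2
        \<le> (\<integral>\<^sup>+s. ?I s * (?I s * ennreal (cmod (g (x + s *\<^sub>R v)))) \<partial>lborel)\<^sup>2"
      by (intro power_mono) auto
    also have "\<dots> \<le> (\<integral>\<^sup>+s. (?I s)\<^sup>2 \<partial>lborel) * (\<integral>\<^sup>+s. (?I s * ennreal (cmod (g (x + s *\<^sub>R v))))\<^sup>2 \<partial>lborel)"
      by (rule Cauchy_Schwarz_nn_integral) measurable
    also have "(\<integral>\<^sup>+s. (?I s)\<^sup>2 \<partial>lborel) = (\<integral>\<^sup>+s. ?I s \<partial>lborel)"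
      by (intro nn_integral_cong) (auto simp: indicator_def)
    also have "\<dots> = 1" by simp
    also have "(\<integral>\<^sup>+s. (?I s * ennreal (cmod (g (x + s *\<^sub>R v))))\<^sup>2 \<partial>lborel)
        = (\<integral>\<^sup>+s. ?I s * ennreal ((cmod (g (x + s *\<^sub>R v)))\<^sup>2) \<partial>lborel)"
      by (intro nn_integral_cong) (auto simp: indicator_def ennreal_power)
    finally show ?thesis by (simp add: ennreal_power)
  qed (simp add: not_integrable_integral_eq)
  have "(\<integral>\<^sup>+x. ennreal ((cmod (\<integral>s. indicator {0..1::real} s *\<^sub>R g (x + s *\<^sub>R v) \<partial>lborel))\<^sup>2) \<partial>lborel)
      \<le> (\<integral>\<^sup>+x. (\<integral>\<^sup>+s. ?I s * ennreal ((cmod (g (x + s *\<^sub>R v)))\<^sup>2) \<partial>lborel) \<partial>lborel)"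
    by (intro nn_integral_mono le)
  also have "\<dots> = (\<integral>\<^sup>+s. (\<integral>\<^sup>+x. ?I s * ennreal ((cmod (g (x + s *\<^sub>R v)))\<^sup>2) \<partial>lborel) \<partial>lborel)"
    by (rule lborel_pair.Fubini'[symmetric]) measurable
  also have "\<dots> = (\<integral>\<^sup>+s. (\<integral>\<^sup>+x. ennreal ((cmod (g x))\<^sup>2) \<partial>lborel) * ?I s \<partial>lborel)"
  proof (intro nn_integral_cong)
    fix s :: real
    show "(\<integral>\<^sup>+x. ?I s * ennreal ((cmod (g (x + s *\<^sub>R v)))\<^sup>2) \<partial>lborel)
        = (\<integral>\<^sup>+x. ennreal ((cmod (g x))\<^sup>2) \<partial>lborel) * ?I s"
      using nn_integral_lborel_translate[of "\<lambda>x. ennreal ((cmod (g x))\<^sup>2)" "s *\<^sub>R v"]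
      by (simp add: nn_integral_cmult mult.commute)
  qed
  also have "\<dots> = (\<integral>\<^sup>+x. ennreal ((cmod (g x))\<^sup>2) \<partial>lborel)"
    by (subst nn_integral_cmult_indicator) auto
  finally show ?thesis .
qed

text \<open>For smooth \<open>u\<close>, \<open>u (x + v) - u x\<close> is the integral of the derivative over the segment from
\<open>x\<close> to \<open>x + v\<close>, and by the Cauchy-Schwarz inequality its \<open>L\<^sup>2\<close> norm is at most that of the
derivative. For a weak derivative the same formula holds almost everywhere: by Fubini's
theorem both sides agree when integrated against any test function, as shifts and the integration
over the segment can be moved to the test function.\<close>

lemma translation_estimate:
  fixes u g :: "'a::euclidean_space \<Rightarrow> complex"
  assumes u: "borel_L2 u" and g: "borel_L2 g"
    and weak: "\<And>\<phi>. \<phi> \<in> test_functions \<Longrightarrow>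
      (\<integral>x. u x * frechet_derivative \<phi> (at x) v \<partial>lborel) = - (\<integral>x. g x * \<phi> x \<partial>lborel)"
  shows "(\<integral>\<^sup>+x. ennreal ((cmod (u (x + v) - u x))\<^sup>2) \<partial>lborel) \<le> (\<integral>\<^sup>+x. ennreal ((cmod (g x))\<^sup>2) \<partial>lborel)"
proof -
  have [measurable]: "u \<in> borel_measurable borel" "g \<in> borel_measurable borel"
    using assms by (simp_all add: borel_L2_def)
  let ?I = "\<lambda>s. indicator {0..1::real} s :: real"
  \<comment> \<open>The claimed value of \<open>u (x + v) - u x\<close>.\<close>
  define h where "h x = (\<integral>s. ?I s *\<^sub>R g (x + s *\<^sub>R v) \<partial>lborel)" for x
  have h_meas [measurable]: "h \<in> borel_measurable borel"
  proof -
    have "(\<lambda>x. \<integral>s. ?I s *\<^sub>R g (x + s *\<^sub>R v) \<partial>lborel) \<in> borel_measurable lborel"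
      by (rule lborel.borel_measurable_lebesgue_integral) measurable
    then show ?thesis by (simp add: h_def[abs_def])
  qed
  have h_mult: "h x * c = (\<integral>s. ?I s *\<^sub>R (g (x + s *\<^sub>R v) * c) \<partial>lborel)" for x c
    unfolding h_def by (simp flip: integral_mult_left_zero)
  have h_int: "integrable lborel (\<lambda>x. h x * k x)" if "borel_L2 k" for k
    using lborel_pair.integrable_fst[OF integrable_pair_translates[OF g that, of v 0]]
    by (simp add: h_mult)
  have uv: "borel_L2 (\<lambda>x. u (x + v))" using u by (rule borel_L2_translate)
  have "AE x in lborel. u (x + v) - u x - h x = 0"
  proof (rule fundamental_lemma)
    show "(\<lambda>x. u (x + v) - u x - h x) \<in> borel_measurable borel" by measurable
    fix a b :: 'a
    have "integrable lborel (\<lambda>x. u (x + v) * indicator (box a b) x - u x * indicator (box a b) x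
        - h x * indicator (box a b) x)"
      by (intro Bochner_Integration.integrable_diff integrable_borel_L2_mult uv u h_int borel_L2_indicator_box)
    then show "integrable lborel (\<lambda>x. indicator (box a b) x *\<^sub>R (u (x + v) - u x - h x))"
      by (rule Bochner_Integration.integrable_cong[THEN iffD1, rotated -1]) (auto simp: indicator_def)
  next
    fix \<phi> :: "'a \<Rightarrow> complex" assume \<phi>: "\<phi> \<in> test_functions"
    note \<phi>2 = borel_L2_test_function[OF \<phi>]
    have [measurable]: "\<phi> \<in> borel_measurable borel" using \<phi>2 by (simp add: borel_L2_def)
    define d where "d x = frechet_derivative \<phi> (at x) v" for x
    have d: "borel_L2 d" unfolding d_def[abs_def] by (rule borel_L2_directional_derivative[OF \<phi>])
    have [measurable]: "d \<in> borel_measurable borel" using d by (simp add: borel_L2_def)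
    have inner: "(\<integral>x. g (x + s *\<^sub>R v) * \<phi> x \<partial>lborel) = - (\<integral>y. u y * d (y + s *\<^sub>R (- v)) \<partial>lborel)" for s
    proof -
      have "(\<integral>x. g (x + s *\<^sub>R v) * \<phi> x \<partial>lborel) = (\<integral>y. g y * \<phi> (y + s *\<^sub>R (- v)) \<partial>lborel)"
        using integral_lborel_translate[of "\<lambda>y. g y * \<phi> (y + s *\<^sub>R (- v))" "s *\<^sub>R v"] by simp
      also have "\<dots> = - (\<integral>y. u y * frechet_derivative (\<lambda>y. \<phi> (y + s *\<^sub>R (- v))) (at y) v \<partial>lborel)"
        using weak[OF test_function_translate[OF \<phi>, of "s *\<^sub>R (- v)"]] by simp
      also have "\<dots> = - (\<integral>y. u y * d (y + s *\<^sub>R (- v)) \<partial>lborel)"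
        unfolding d_def frechet_derivative_translate[OF test_function_differentiable[OF \<phi>]] ..
      finally show ?thesis .
    qed
    have "(\<integral>x. h x * \<phi> x \<partial>lborel) = (\<integral>x. (\<integral>s. ?I s *\<^sub>R (g (x + s *\<^sub>R v) * \<phi> (x + s *\<^sub>R 0)) \<partial>lborel) \<partial>lborel)"
      by (simp add: h_mult)
    also have "\<dots> = (\<integral>s. (\<integral>x. ?I s *\<^sub>R (g (x + s *\<^sub>R v) * \<phi> (x + s *\<^sub>R 0)) \<partial>lborel) \<partial>lborel)"
      by (rule lborel_pair.Fubini_integral[symmetric]) (rule integrable_pair_translates[OF g \<phi>2])
    also have "\<dots> = (\<integral>s. - (\<integral>y. ?I s *\<^sub>R (u (y + s *\<^sub>R 0) * d (y + s *\<^sub>R (- v))) \<partial>lborel) \<partial>lborel)"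
      using inner by simp
    also have "\<dots> = - (\<integral>s. (\<integral>y. ?I s *\<^sub>R (u (y + s *\<^sub>R 0) * d (y + s *\<^sub>R (- v))) \<partial>lborel) \<partial>lborel)"
      by (rule Bochner_Integration.integral_minus)
    also have "(\<integral>s. (\<integral>y. ?I s *\<^sub>R (u (y + s *\<^sub>R 0) * d (y + s *\<^sub>R (- v))) \<partial>lborel) \<partial>lborel)
        = (\<integral>y. (\<integral>s. ?I s *\<^sub>R (u (y + s *\<^sub>R 0) * d (y + s *\<^sub>R (- v))) \<partial>lborel) \<partial>lborel)"
      by (rule lborel_pair.Fubini_integral) (rule integrable_pair_translates[OF u d])
    also have "\<dots> = (\<integral>y. u y * (\<phi> y - \<phi> (y - v)) \<partial>lborel)"
    proof (rule Bochner_Integration.integral_cong[OF refl])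
      fix y
      have "(\<integral>s. ?I s *\<^sub>R (u (y + s *\<^sub>R 0) * d (y + s *\<^sub>R (- v))) \<partial>lborel)
          = (\<integral>s. u y * (?I s *\<^sub>R d (y + s *\<^sub>R (- v))) \<partial>lborel)"
        by (intro Bochner_Integration.integral_cong) (auto simp: indicator_def)
      also have "\<dots> = u y * (\<integral>s. ?I s *\<^sub>R d (y + s *\<^sub>R (- v)) \<partial>lborel)"
        by (rule integral_mult_right_zero)
      finally show "(\<integral>s. ?I s *\<^sub>R (u (y + s *\<^sub>R 0) * d (y + s *\<^sub>R (- v))) \<partial>lborel) = u y * (\<phi> y - \<phi> (y - v))"
        unfolding d_def line_integral_directional_derivative[OF \<phi>] .
    qed
    also have "\<dots> = (\<integral>y. u y * \<phi> y \<partial>lborel) - (\<integral>y. u y * \<phi> (y - v) \<partial>lborel)"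
      using integrable_borel_L2_mult[OF u \<phi>2] integrable_borel_L2_mult[OF u borel_L2_translate[OF \<phi>2, of "- v"]]
      by (simp add: right_diff_distrib)
    also have "(\<integral>y. u y * \<phi> (y - v) \<partial>lborel) = (\<integral>y. u (y + v) * \<phi> y \<partial>lborel)"
      using integral_lborel_translate[of "\<lambda>y. u y * \<phi> (y - v)" v] by simp
    finally have *: "(\<integral>x. h x * \<phi> x \<partial>lborel) = (\<integral>y. u (y + v) * \<phi> y \<partial>lborel) - (\<integral>y. u y * \<phi> y \<partial>lborel)"
      by simp
    have "(\<integral>x. (u (x + v) - u x - h x) * \<phi> x \<partial>lborel)
        = (\<integral>x. u (x + v) * \<phi> x - u x * \<phi> x - h x * \<phi> x \<partial>lborel)"
      by (simp add: algebra_simps)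
    also have "\<dots> = (\<integral>y. u (y + v) * \<phi> y \<partial>lborel) - (\<integral>y. u y * \<phi> y \<partial>lborel) - (\<integral>x. h x * \<phi> x \<partial>lborel)"
      using integrable_borel_L2_mult[OF u \<phi>2] integrable_borel_L2_mult[OF uv \<phi>2] h_int[OF \<phi>2] by simp
    finally show "(\<integral>x. (u (x + v) - u x - h x) * \<phi> x \<partial>lborel) = 0" using * by simp
  qed
  then have "(\<integral>\<^sup>+x. ennreal ((cmod (u (x + v) - u x))\<^sup>2) \<partial>lborel) = (\<integral>\<^sup>+x. ennreal ((cmod (h x))\<^sup>2) \<partial>lborel)"
    by (intro nn_integral_cong_AE) (auto elim: AE_mp)
  also have "\<dots> \<le> (\<integral>\<^sup>+x. ennreal ((cmod (g x))\<^sup>2) \<partial>lborel)"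
    unfolding h_def by (rule nn_integral_segment_average_le[OF g])
  finally show ?thesis .
qed

section \<open>A Poincare inequality on grid cells\<close>

text \<open>The space is divided into half-open cubes of side \<^term>\<open>\<delta>\<close>, labelled by their integer
coordinates. The restriction to \<^const>\<open>Basis\<close> makes bounded sets of labels finite.\<close>

definition cell_index :: "real \<Rightarrow> 'a::euclidean_space \<Rightarrow> 'a \<Rightarrow> int" where
  "cell_index \<delta> x = (\<lambda>b\<in>Basis. \<lfloor>(x \<bullet> b) / \<delta>\<rfloor>)"

definition cell :: "real \<Rightarrow> ('a::euclidean_space \<Rightarrow> int) \<Rightarrow> 'a set" where
  "cell \<delta> k = {x. cell_index \<delta> x = k}"

definition cell_average :: "real \<Rightarrow> ('a::euclidean_space \<Rightarrow> complex) \<Rightarrow> ('a \<Rightarrow> int) \<Rightarrow> complex" where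
  "cell_average \<delta> u k = (1 / \<delta> ^ DIM('a)) *\<^sub>R (\<integral>y. indicator (cell \<delta> k) y *\<^sub>R u y \<partial>lborel)"

lemma cell_index_eq_iff:
  "cell_index \<delta> x = cell_index \<delta> y \<longleftrightarrow> (\<forall>b\<in>Basis. real_of_int \<lfloor>(x \<bullet> b) / \<delta>\<rfloor> = real_of_int \<lfloor>(y \<bullet> b) / \<delta>\<rfloor>)"
  by (auto simp: cell_index_def fun_eq_iff)

lemma pred_cell_index_eq [measurable]:
  "Measurable.pred (borel \<Otimes>\<^sub>M borel) (\<lambda>z. cell_index \<delta> (fst z :: 'a::euclidean_space) = cell_index \<delta> (snd z))"
proof -
  have "(\<lambda>z. real_of_int \<lfloor>(fst z \<bullet> b) / \<delta>\<rfloor>) \<in> borel_measurable (borel \<Otimes>\<^sub>M (borel :: 'a measure))"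
    "(\<lambda>z. real_of_int \<lfloor>(snd z \<bullet> b) / \<delta>\<rfloor>) \<in> borel_measurable ((borel :: 'a measure) \<Otimes>\<^sub>M borel)"
    for b :: 'a by measurable
  note meas_eq = borel_measurable_eq[OF this]
  show ?thesis unfolding cell_index_eq_iff
    by (intro pred_intros_finite finite_Basis) (unfold pred_def, rule meas_eq)
qed

lemma cell_borel [measurable]: "cell \<delta> k \<in> sets borel"
proof (cases "cell \<delta> k = {}")
  case False
  then obtain x where "k = cell_index \<delta> x" by (auto simp: cell_def)
  then have "cell \<delta> k = {y \<in> space borel. \<forall>b\<in>Basis. real_of_int \<lfloor>(y \<bullet> b) / \<delta>\<rfloor> = real_of_int \<lfloor>(x \<bullet> b) / \<delta>\<rfloor>}"
    using cell_index_eq_iff by (auto simp: cell_def)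
  also have "\<dots> \<in> sets borel" by measurable
  finally show ?thesis .
qed simp

lemma emeasure_cell:
  fixes k :: "'a::euclidean_space \<Rightarrow> int"
  assumes \<delta>: "\<delta> > 0" and k: "k \<in> extensional Basis"
  shows "emeasure lborel (cell \<delta> k) = ennreal (\<delta> ^ DIM('a))"
proof -
  define a where "a = (\<Sum>b\<in>Basis. (real_of_int (k b) * \<delta>) *\<^sub>R b)"
  have ab: "a \<bullet> b = real_of_int (k b) * \<delta>" if "b \<in> Basis" for b
    using that by (simp add: a_def inner_sum_left inner_Basis if_distrib cong: if_cong)
  have mem: "x \<in> cell \<delta> k \<longleftrightarrow> (\<forall>b\<in>Basis. a \<bullet> b \<le> x \<bullet> b \<and> x \<bullet> b < a \<bullet> b + \<delta>)" for x
  proof -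
    have "x \<in> cell \<delta> k \<longleftrightarrow> (\<forall>b\<in>Basis. \<lfloor>(x \<bullet> b) / \<delta>\<rfloor> = k b)"
      using k by (auto simp: cell_def cell_index_def fun_eq_iff extensional_def)
    also have "\<dots> \<longleftrightarrow> (\<forall>b\<in>Basis. a \<bullet> b \<le> x \<bullet> b \<and> x \<bullet> b < a \<bullet> b + \<delta>)"
      using \<delta> by (intro ball_cong refl) (simp add: floor_eq_iff ab field_simps)
    finally show ?thesis .
  qed
  have sub: "box a (a + \<delta> *\<^sub>R One) \<subseteq> cell \<delta> k" "cell \<delta> k \<subseteq> cbox a (a + \<delta> *\<^sub>R One)"
    by (auto simp: mem mem_box inner_add_left less_imp_le)
  have 1: "emeasure lborel (box a (a + \<delta> *\<^sub>R One)) = ennreal (\<delta> ^ DIM('a))"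
    using \<delta> by (subst emeasure_lborel_box) (auto simp: inner_add_left)
  have 2: "emeasure lborel (cbox a (a + \<delta> *\<^sub>R One)) = ennreal (\<delta> ^ DIM('a))"
    using \<delta> by (subst emeasure_lborel_cbox) (auto simp: inner_add_left)
  show ?thesis
  proof (rule antisym)
    show "emeasure lborel (cell \<delta> k) \<le> ennreal (\<delta> ^ DIM('a))"
      unfolding 2[symmetric] by (intro emeasure_mono sub) auto
    show "ennreal (\<delta> ^ DIM('a)) \<le> emeasure lborel (cell \<delta> k)"
      unfolding 1[symmetric] by (intro emeasure_mono sub) auto
  qed
qed

lemma cell_index_extensional [simp]: "cell_index \<delta> x \<in> extensional Basis"
  by (simp add: cell_index_def)

lemma borel_L2_indicator_cell:
  assumes "\<delta> > 0" "k \<in> extensional Basis" shows "borel_L2 (indicator (cell \<delta> k))"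
proof -
  have "(\<integral>\<^sup>+x. ennreal ((cmod (indicator (cell \<delta> k) x))\<^sup>2) \<partial>lborel) = (\<integral>\<^sup>+x. indicator (cell \<delta> k) x \<partial>lborel)"
    by (intro nn_integral_cong) (auto simp: indicator_def)
  also have "\<dots> < \<infinity>" using emeasure_cell[OF assms] by simp
  finally show ?thesis by (simp add: borel_L2_def)
qed

lemma integrable_on_cell:
  assumes "\<delta> > 0" "k \<in> extensional Basis" "borel_L2 u"
  shows "integrable lborel (\<lambda>y. indicator (cell \<delta> k) y *\<^sub>R u y)"
  using integrable_borel_L2_mult[OF borel_L2_indicator_cell[OF assms(1,2)] assms(3)]
  by (rule Bochner_Integration.integrable_cong[THEN iffD1, rotated -1]) (auto simp: indicator_def)

lemma norm_cell_average_le: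
  fixes u :: "'a::euclidean_space \<Rightarrow> complex"
  assumes \<delta>: "\<delta> > 0" and k: "k \<in> extensional Basis" and u: "borel_L2 u"
    and le: "(\<integral>\<^sup>+x. ennreal ((cmod (u x))\<^sup>2) \<partial>lborel) \<le> ennreal M" "M \<ge> 0"
  shows "cmod (cell_average \<delta> u k) \<le> (1 / \<delta> ^ DIM('a)) * (\<delta> ^ DIM('a) + M)"
proof -
  have "ennreal (cmod (\<integral>y. indicator (cell \<delta> k) y *\<^sub>R u y \<partial>lborel))
      \<le> (\<integral>\<^sup>+y. ennreal (norm (indicator (cell \<delta> k) y *\<^sub>R u y)) \<partial>lborel)"
    by (rule integral_norm_bound_ennreal) (rule integrable_on_cell[OF \<delta> k u])
  also have "\<dots> = (\<integral>\<^sup>+y. ennreal (cmod (indicator (cell \<delta> k) y * u y)) \<partial>lborel)"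
    by (intro nn_integral_cong) (auto simp: indicator_def)
  also have "\<dots> \<le> (\<integral>\<^sup>+x. ennreal ((cmod (indicator (cell \<delta> k) x))\<^sup>2) \<partial>lborel) + (\<integral>\<^sup>+x. ennreal ((cmod (u x))\<^sup>2) \<partial>lborel)"
    by (rule nn_integral_mult_le[OF borel_L2_indicator_cell[OF \<delta> k] u])
  also have "(\<integral>\<^sup>+x. ennreal ((cmod (indicator (cell \<delta> k) x))\<^sup>2) \<partial>lborel) = (\<integral>\<^sup>+x. indicator (cell \<delta> k) x \<partial>lborel)"
    by (intro nn_integral_cong) (auto simp: indicator_def)
  also have "\<dots> = ennreal (\<delta> ^ DIM('a))" using emeasure_cell[OF \<delta> k] by simp
  also have "ennreal (\<delta> ^ DIM('a)) + (\<integral>\<^sup>+x. ennreal ((cmod (u x))\<^sup>2) \<partial>lborel) \<le> ennreal (\<delta> ^ DIM('a)) + ennreal M"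
    by (intro add_left_mono le)
  also have "\<dots> = ennreal (\<delta> ^ DIM('a) + M)" using \<delta> le by simp
  finally have "cmod (\<integral>y. indicator (cell \<delta> k) y *\<^sub>R u y \<partial>lborel) \<le> \<delta> ^ DIM('a) + M"
    using \<delta> le by (subst (asm) ennreal_le_iff) auto
  then show ?thesis
    unfolding cell_average_def norm_scaleR using \<delta> by (simp add: mult_left_mono divide_right_mono)
qed

lemma cell_average_error_le:
  fixes u :: "'a::euclidean_space \<Rightarrow> complex"
  assumes \<delta>: "\<delta> > 0" and u: "borel_L2 u"
  shows "ennreal ((cmod (u x - cell_average \<delta> u (cell_index \<delta> x)))\<^sup>2)
    \<le> ennreal (1 / \<delta> ^ DIM('a)) *
       (\<integral>\<^sup>+y. indicator (cell \<delta> (cell_index \<delta> x)) y * ennreal ((cmod (u y - u x))\<^sup>2) \<partial>lborel)"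
proof -
  have [measurable]: "u \<in> borel_measurable borel" using u by (simp add: borel_L2_def)
  let ?c = "cell \<delta> (cell_index \<delta> x)" and ?v = "\<delta> ^ DIM('a)"
  let ?I = "indicator ?c :: 'a \<Rightarrow> ennreal"
  have v: "?v > 0" using \<delta> by simp
  have em: "emeasure lborel ?c = ennreal ?v" by (rule emeasure_cell[OF \<delta>]) simp
  then have meas: "measure lborel ?c = ?v" using v by (simp add: measure_def)
  have i1: "integrable lborel (\<lambda>y. indicator ?c y *\<^sub>R u y)"
    by (rule integrable_on_cell[OF \<delta> _ u]) simp
  have i2: "integrable lborel (\<lambda>y. indicator ?c y *\<^sub>R u x)"
    using em by (intro integrable_scaleR_left) (simp add: integrable_indicator_iff)
  have i3: "(\<integral>y. indicator ?c y *\<^sub>R u x \<partial>lborel) = ?v *\<^sub>R u x"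
    using em by (subst integral_scaleR_left) (simp_all add: integrable_indicator_iff meas)
  have "(\<integral>y. indicator ?c y *\<^sub>R (u y - u x) \<partial>lborel)
      = (\<integral>y. indicator ?c y *\<^sub>R u y \<partial>lborel) - ?v *\<^sub>R u x"
    using i1 i2 by (simp only: scaleR_diff_right Bochner_Integration.integral_diff i3)
  then have "u x - cell_average \<delta> u (cell_index \<delta> x) = - (1 / ?v) *\<^sub>R (\<integral>y. indicator ?c y *\<^sub>R (u y - u x) \<partial>lborel)"
    using v \<delta> by (simp add: cell_average_def scaleR_diff_right)
  then have "cmod (u x - cell_average \<delta> u (cell_index \<delta> x))
      = (1 / ?v) * cmod (\<integral>y. indicator ?c y *\<^sub>R (u y - u x) \<partial>lborel)"
    using v \<delta> by simp
  then have "ennreal ((cmod (u x - cell_average \<delta> u (cell_index \<delta> x)))\<^sup>2)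
      = ennreal ((1 / ?v)\<^sup>2) * (ennreal (cmod (\<integral>y. indicator ?c y *\<^sub>R (u y - u x) \<partial>lborel)))\<^sup>2"
    using v by (simp only: power_mult_distrib ennreal_power norm_ge_zero) (simp add: ennreal_mult)
  also have "\<dots> \<le> ennreal ((1 / ?v)\<^sup>2) * (\<integral>\<^sup>+y. ?I y * (?I y * ennreal (cmod (u y - u x))) \<partial>lborel)\<^sup>2"
  proof (intro mult_left_mono power_mono)
    have "integrable lborel (\<lambda>y. indicator ?c y *\<^sub>R (u y - u x))"
      unfolding scaleR_diff_right by (intro Bochner_Integration.integrable_diff i1 i2)
    then show "ennreal (cmod (\<integral>y. indicator ?c y *\<^sub>R (u y - u x) \<partial>lborel))
        \<le> (\<integral>\<^sup>+y. ?I y * (?I y * ennreal (cmod (u y - u x))) \<partial>lborel)"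
      by (rule order_trans[OF integral_norm_bound_ennreal])
        (auto intro!: nn_integral_mono simp: indicator_def)
  qed auto
  also have "\<dots> \<le> ennreal ((1 / ?v)\<^sup>2) * ((\<integral>\<^sup>+y. (?I y)\<^sup>2 \<partial>lborel) *
      (\<integral>\<^sup>+y. (?I y * ennreal (cmod (u y - u x)))\<^sup>2 \<partial>lborel))"
    by (intro mult_left_mono Cauchy_Schwarz_nn_integral) auto
  also have "(\<integral>\<^sup>+y. (?I y)\<^sup>2 \<partial>lborel) = (\<integral>\<^sup>+y. ?I y \<partial>lborel)"
    by (intro nn_integral_cong) (auto simp: indicator_def)
  also have "\<dots> = ennreal ?v" using em by simp
  also have "(\<integral>\<^sup>+y. (?I y * ennreal (cmod (u y - u x)))\<^sup>2 \<partial>lborel)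
      = (\<integral>\<^sup>+y. ?I y * ennreal ((cmod (u y - u x))\<^sup>2) \<partial>lborel)"
    by (intro nn_integral_cong) (auto simp: indicator_def ennreal_power)
  also have "ennreal ((1 / ?v)\<^sup>2) * (ennreal ?v * (\<integral>\<^sup>+y. ?I y * ennreal ((cmod (u y - u x))\<^sup>2) \<partial>lborel))
      = ennreal (1 / ?v) * (\<integral>\<^sup>+y. ?I y * ennreal ((cmod (u y - u x))\<^sup>2) \<partial>lborel)"
  proof -
    have "(1 / ?v)\<^sup>2 * ?v = 1 / ?v" using v by (simp add: power2_eq_square)
    then show ?thesis using v by (simp only: mult.assoc[symmetric] ennreal_mult[symmetric] zero_le_power2 less_imp_le)
  qed
  finally show ?thesis .
qed

text \<open>Inside a cell, \<open>u x\<close> minus the average of \<open>u\<close> is an average of differences \<open>u x - u y\<close>, where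
\<open>y = x + h\<close> with all coordinates of \<open>h\<close> at most \<^term>\<open>\<delta>\<close>. So control of translations by such \<open>h\<close>
controls the error of replacing \<open>u\<close> by its cell averages. The factor is the volume of the cube of all \<open>h\<close>
over that of a cell.\<close>

lemma piecewise_poincare:
  fixes u :: "'a::euclidean_space \<Rightarrow> complex"
  assumes \<delta>: "\<delta> > 0" and u: "borel_L2 u"
    and B: "\<And>h. (\<And>b. b \<in> Basis \<Longrightarrow> \<bar>h \<bullet> b\<bar> \<le> \<delta>) \<Longrightarrow>
      (\<integral>\<^sup>+x. ennreal ((cmod (u (x + h) - u x))\<^sup>2) \<partial>lborel) \<le> B"
  shows "(\<integral>\<^sup>+x. ennreal ((cmod (u x - cell_average \<delta> u (cell_index \<delta> x)))\<^sup>2) \<partial>lborel) \<le> 2 ^ DIM('a) * B"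
proof -
  have [measurable]: "u \<in> borel_measurable borel" using u by (simp add: borel_L2_def)
  let ?v = "\<delta> ^ DIM('a)"
  let ?Q = "cbox (- \<delta> *\<^sub>R One) (\<delta> *\<^sub>R One) :: 'a set"
  have v: "?v > 0" using \<delta> by simp
  have shift: "(\<integral>\<^sup>+y. indicator (cell \<delta> (cell_index \<delta> x)) y * ennreal ((cmod (u y - u x))\<^sup>2) \<partial>lborel)
      \<le> (\<integral>\<^sup>+h. indicator ?Q h * ennreal ((cmod (u (x + h) - u x))\<^sup>2) \<partial>lborel)" for x
  proof -
    have "(\<integral>\<^sup>+y. indicator (cell \<delta> (cell_index \<delta> x)) y * ennreal ((cmod (u y - u x))\<^sup>2) \<partial>lborel)
        = (\<integral>\<^sup>+h. indicator (cell \<delta> (cell_index \<delta> x)) (h + x) * ennreal ((cmod (u (h + x) - u x))\<^sup>2) \<partial>lborel)"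
      by (rule nn_integral_lborel_translate[symmetric]) measurable
    also have "\<dots> \<le> (\<integral>\<^sup>+h. indicator ?Q h * ennreal ((cmod (u (x + h) - u x))\<^sup>2) \<partial>lborel)"
    proof (intro nn_integral_mono)
      fix h
      have "h \<in> ?Q" if "h + x \<in> cell \<delta> (cell_index \<delta> x)"
      proof -
        have "\<bar>h \<bullet> b\<bar> \<le> \<delta>" if b: "b \<in> Basis" for b
        proof -
          have "\<lfloor>((h + x) \<bullet> b) / \<delta>\<rfloor> = \<lfloor>(x \<bullet> b) / \<delta>\<rfloor>"
            using \<open>h + x \<in> _\<close> b by (auto simp: cell_def cell_index_def fun_eq_iff restrict_def split: if_splits)
          then have "\<bar>((h + x) \<bullet> b) / \<delta> - (x \<bullet> b) / \<delta>\<bar> \<le> 1" by linarith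
          then show ?thesis using \<delta> by (simp add: inner_add_left diff_divide_distrib[symmetric])
        qed
        then show ?thesis by (force simp: mem_box abs_le_iff)
      qed
      then show "indicator (cell \<delta> (cell_index \<delta> x)) (h + x) * ennreal ((cmod (u (h + x) - u x))\<^sup>2)
          \<le> indicator ?Q h * ennreal ((cmod (u (x + h) - u x))\<^sup>2)"
        by (auto simp: indicator_def add.commute)
    qed
    finally show ?thesis .
  qed
  have "(\<integral>\<^sup>+x. ennreal ((cmod (u x - cell_average \<delta> u (cell_index \<delta> x)))\<^sup>2) \<partial>lborel)
      \<le> (\<integral>\<^sup>+x. ennreal (1 / ?v) * (\<integral>\<^sup>+h. indicator ?Q h * ennreal ((cmod (u (x + h) - u x))\<^sup>2) \<partial>lborel) \<partial>lborel)"
    by (intro nn_integral_mono order_trans[OF cell_average_error_le[OF \<delta> u]] mult_left_mono shift) auto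
  also have "\<dots> = ennreal (1 / ?v) * (\<integral>\<^sup>+x. (\<integral>\<^sup>+h. indicator ?Q h * ennreal ((cmod (u (x + h) - u x))\<^sup>2) \<partial>lborel) \<partial>lborel)"
    by (rule nn_integral_cmult) measurable
  also have "(\<integral>\<^sup>+x. (\<integral>\<^sup>+h. indicator ?Q h * ennreal ((cmod (u (x + h) - u x))\<^sup>2) \<partial>lborel) \<partial>lborel)
      = (\<integral>\<^sup>+h. (\<integral>\<^sup>+x. indicator ?Q h * ennreal ((cmod (u (x + h) - u x))\<^sup>2) \<partial>lborel) \<partial>lborel)"
    by (rule lborel_pair.Fubini'[symmetric]) measurable
  also have "\<dots> \<le> (\<integral>\<^sup>+h. B * indicator ?Q h \<partial>lborel)"
  proof (intro nn_integral_mono)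
    fix h :: 'a
    show "(\<integral>\<^sup>+x. indicator ?Q h * ennreal ((cmod (u (x + h) - u x))\<^sup>2) \<partial>lborel) \<le> B * indicator ?Q h"
    proof (cases "h \<in> ?Q")
      case True
      then have "\<bar>h \<bullet> b\<bar> \<le> \<delta>" if "b \<in> Basis" for b using that by (force simp: mem_box abs_le_iff)
      then show ?thesis using B[of h] True by simp
    qed simp
  qed
  also have "(\<integral>\<^sup>+h. B * indicator ?Q h \<partial>lborel) = B * emeasure lborel ?Q"
    by (rule nn_integral_cmult_indicator) simp
  also have "emeasure lborel ?Q = ennreal (2 ^ DIM('a) * ?v)"
  proof -
    have "(\<Prod>b\<in>(Basis :: 'a set). (\<delta> *\<^sub>R One - (- \<delta>) *\<^sub>R One) \<bullet> b) = (\<Prod>b\<in>(Basis :: 'a set). 2 * \<delta>)"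
      by (intro prod.cong) (auto simp: inner_diff_left inner_add_left)
    also have "\<dots> = 2 ^ DIM('a) * ?v" by (simp add: power_mult_distrib)
    finally show ?thesis using \<delta> by (subst emeasure_lborel_cbox) auto
  qed
  also have "ennreal (1 / ?v) * (B * ennreal (2 ^ DIM('a) * ?v)) = ennreal (1 / ?v * (2 ^ DIM('a) * ?v)) * B"
  proof -
    have "ennreal (1 / ?v * (2 ^ DIM('a) * ?v)) = ennreal (1 / ?v) * ennreal (2 ^ DIM('a) * ?v)"
      using v by (intro ennreal_mult) auto
    then show ?thesis by (simp only: mult_ac)
  qed
  also have "1 / ?v * (2 ^ DIM('a) * ?v) = 2 ^ DIM('a)" using \<delta> by simp
  also have "ennreal (2 ^ DIM('a)) = 2 ^ DIM('a)"
    by (metis ennreal_numeral ennreal_power zero_le_numeral)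
  finally show ?thesis by (simp add: mult_left_mono)
qed

section \<open>Weak derivatives of \<open>L\<^sup>2\<close> classes\<close>

lemma ex_borel_representative:
  "\<exists>f\<in>borel_measurable borel. AE x in lborel. rep_L2 u x = f x"
proof -
  have m: "(\<lambda>x. Re (rep_L2 u x)) \<in> borel_measurable (completion lborel)"
    "(\<lambda>x. Im (rep_L2 u x)) \<in> borel_measurable (completion lborel)"
    by measurable
  obtain p where p: "p \<in> borel_measurable lborel" "AE x in lborel. Re (rep_L2 u x) = p x"
    using completion_ex_borel_measurable_real[OF m(1)] by blast
  obtain q where q: "q \<in> borel_measurable lborel" "AE x in lborel. Im (rep_L2 u x) = q x"
    using completion_ex_borel_measurable_real[OF m(2)] by blast
  have [measurable]: "p \<in> borel_measurable borel" "q \<in> borel_measurable borel" using p q by simp_all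
  show ?thesis
  proof
    show "(\<lambda>x. complex_of_real (p x) + \<i> * complex_of_real (q x)) \<in> borel_measurable borel" by measurable
    show "AE x in lborel. rep_L2 u x = complex_of_real (p x) + \<i> * complex_of_real (q x)"
      using p(2) q(2) by eventually_elim (simp add: complex_eq_iff)
  qed
qed

definition borel_rep :: "'a::euclidean_space L2 \<Rightarrow> 'a \<Rightarrow> complex" where
  "borel_rep u = (SOME f. f \<in> borel_measurable borel \<and> (AE x in lborel. rep_L2 u x = f x))"

lemma borel_rep_measurable [measurable]: "borel_rep u \<in> borel_measurable borel"
  and AE_borel_rep: "AE x in lborel. rep_L2 u x = borel_rep u x"
proof -
  have "\<exists>f. f \<in> borel_measurable borel \<and> (AE x in lborel. rep_L2 u x = f x)"
    using ex_borel_representative[of u] by blast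
  from someI_ex[OF this, folded borel_rep_def]
  show "borel_rep u \<in> borel_measurable borel" "AE x in lborel. rep_L2 u x = borel_rep u x" by simp_all
qed

lemma nn_integral_borel_rep: "(\<integral>\<^sup>+x. ennreal ((cmod (borel_rep u x))\<^sup>2) \<partial>lborel) = ennreal ((norm u)\<^sup>2)"
proof -
  have "(\<integral>\<^sup>+x. ennreal ((cmod (borel_rep u x))\<^sup>2) \<partial>lborel) = (\<integral>\<^sup>+x. ennreal ((cmod (rep_L2 u x))\<^sup>2) \<partial>lborel)"
    using AE_borel_rep[of u] by (intro nn_integral_cong_AE) (auto elim: AE_mp)
  also have "\<dots> = ennreal ((norm u)\<^sup>2)"
    unfolding nn_integral_L2[symmetric] nn_integral_completion ..
  finally show ?thesis .
qed

lemma borel_L2_borel_rep: "borel_L2 (borel_rep u)"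
  by (simp add: borel_L2_def nn_integral_borel_rep)

lemma integral_rep_L2_mult:
  assumes [measurable]: "\<phi> \<in> borel_measurable borel"
  shows "(\<integral>x. rep_L2 u x * \<phi> x \<partial>lebesgue) = (\<integral>x. borel_rep u x * \<phi> x \<partial>lborel)"
proof -
  have [measurable]: "\<phi> \<in> borel_measurable lebesgue" "borel_rep u \<in> borel_measurable lebesgue"
    by (auto intro: measurable_completion)
  have "(\<integral>x. rep_L2 u x * \<phi> x \<partial>lebesgue) = (\<integral>x. borel_rep u x * \<phi> x \<partial>lebesgue)"
  proof (rule integral_cong_AE)
    show "AE x in lebesgue. rep_L2 u x * \<phi> x = borel_rep u x * \<phi> x"
      using AE_completion[OF AE_borel_rep[of u]] by eventually_elim simp
  qed measurable
  also have "\<dots> = (\<integral>x. borel_rep u x * \<phi> x \<partial>lborel)"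
    by (rule integral_completion) measurable
  finally show ?thesis .
qed

lemma weak_partial_borel_rep:
  assumes "weak_partial b u g" "\<phi> \<in> test_functions"
  shows "(\<integral>x. borel_rep u x * frechet_derivative \<phi> (at x) b \<partial>lborel) = - (\<integral>x. borel_rep g x * \<phi> x \<partial>lborel)"
proof -
  have "(\<lambda>x. frechet_derivative \<phi> (at x) b) \<in> borel_measurable borel" "\<phi> \<in> borel_measurable borel"
    using borel_L2_directional_derivative[OF assms(2)] borel_L2_test_function[OF assms(2)]
    by (simp_all add: borel_L2_def)
  from this[THEN integral_rep_L2_mult] assms show ?thesis
    unfolding weak_partial_def by metis
qed

text \<open>This makes \<^const>\<open>dpartial\<close>, hence the form of the Laplacian, meaningful.\<close>

lemma weak_partial_unique:
  assumes "weak_partial b u g" "weak_partial b u g'" shows "g = g'"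
proof -
  have "AE x in lborel. borel_rep g x - borel_rep g' x = 0"
  proof (rule fundamental_lemma)
    fix l r :: 'a
    have "integrable lborel (\<lambda>x. borel_rep g x * indicator (box l r) x - borel_rep g' x * indicator (box l r) x)"
      by (intro Bochner_Integration.integrable_diff integrable_borel_L2_mult borel_L2_borel_rep borel_L2_indicator_box)
    then show "integrable lborel (\<lambda>x. indicator (box l r) x *\<^sub>R (borel_rep g x - borel_rep g' x))"
      by (rule Bochner_Integration.integrable_cong[THEN iffD1, rotated -1]) (auto simp: indicator_def)
  next
    fix \<phi> :: "'a \<Rightarrow> complex" assume \<phi>: "\<phi> \<in> test_functions"
    have "(\<integral>x. borel_rep g x * \<phi> x \<partial>lborel) = (\<integral>x. borel_rep g' x * \<phi> x \<partial>lborel)"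
      using weak_partial_borel_rep[OF assms(1) \<phi>] weak_partial_borel_rep[OF assms(2) \<phi>] by simp
    then show "(\<integral>x. (borel_rep g x - borel_rep g' x) * \<phi> x \<partial>lborel) = 0"
      by (simp add: left_diff_distrib integrable_borel_L2_mult borel_L2_borel_rep borel_L2_test_function[OF \<phi>])
  qed measurable
  then have "AE x in lborel. rep_L2 g x = rep_L2 g' x"
    using AE_borel_rep[of g] AE_borel_rep[of g'] by eventually_elim simp
  then show ?thesis unfolding L2_eq_iff by (rule AE_completion)
qed

lemma weak_partial_dpartial:
  assumes "u \<in> sobolev_H1" "b \<in> Basis" shows "weak_partial b u (dpartial b u)"
proof -
  obtain g where g: "weak_partial b u g" using assms by (auto simp: sobolev_H1_def)
  show ?thesis unfolding dpartial_def
    by (rule theI[of _ g]) (use g weak_partial_unique in blast)+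
qed

text \<open>The derivative in direction \<^term>\<open>h\<close> is the combination of the partial derivatives with coefficients \<open>h \<bullet> b\<close>.\<close>

lemma sobolev_translation_estimate:
  fixes u :: "'a::euclidean_space L2"
  assumes u: "u \<in> sobolev_H1" and h: "\<And>b. b \<in> Basis \<Longrightarrow> \<bar>h \<bullet> b\<bar> \<le> \<delta>"
    and D: "(\<Sum>b\<in>Basis. (norm (dpartial b u))\<^sup>2) \<le> D"
  shows "(\<integral>\<^sup>+x. ennreal ((cmod (borel_rep u (x + h) - borel_rep u x))\<^sup>2) \<partial>lborel)
    \<le> ennreal (\<delta>\<^sup>2 * real DIM('a) * D)"
proof -
  define G where "G x = (\<Sum>b\<in>Basis. (h \<bullet> b) *\<^sub>R borel_rep (dpartial b u) x)" for x
  have [measurable]: "G \<in> borel_measurable borel" unfolding G_def by measurable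
  have le: "(cmod (G x))\<^sup>2 \<le> \<delta>\<^sup>2 * real DIM('a) * (\<Sum>b\<in>Basis. (cmod (borel_rep (dpartial b u) x))\<^sup>2)" for x
  proof -
    have "cmod (G x) \<le> (\<Sum>b\<in>Basis. \<delta> * cmod (borel_rep (dpartial b u) x))"
      unfolding G_def by (rule sum_norm_le) (use h in \<open>auto intro!: mult_right_mono\<close>)
    then have "(cmod (G x))\<^sup>2 \<le> (\<Sum>b\<in>Basis. \<delta> * cmod (borel_rep (dpartial b u) x))\<^sup>2"
      by (intro power_mono) auto
    also have "\<dots> \<le> (\<Sum>b\<in>(Basis :: 'a set). (\<delta> * cmod (borel_rep (dpartial b u) x))\<^sup>2) * real DIM('a)"
      by (rule sum_squared_le_sum_of_squares)
    also have "\<dots> = \<delta>\<^sup>2 * real DIM('a) * (\<Sum>b\<in>Basis. (cmod (borel_rep (dpartial b u) x))\<^sup>2)"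
      by (simp add: power_mult_distrib sum_distrib_left mult_ac)
    finally show ?thesis .
  qed
  have "(\<integral>\<^sup>+x. ennreal ((cmod (G x))\<^sup>2) \<partial>lborel)
      \<le> (\<integral>\<^sup>+x. ennreal (\<delta>\<^sup>2 * real DIM('a)) * (\<Sum>b\<in>Basis. ennreal ((cmod (borel_rep (dpartial b u) x))\<^sup>2)) \<partial>lborel)"
  proof (intro nn_integral_mono)
    fix x
    show "ennreal ((cmod (G x))\<^sup>2)
        \<le> ennreal (\<delta>\<^sup>2 * real DIM('a)) * (\<Sum>b\<in>Basis. ennreal ((cmod (borel_rep (dpartial b u) x))\<^sup>2))"
      using ennreal_leI[OF le[of x]] by (simp add: ennreal_mult sum_nonneg sum_ennreal)
  qed
  also have "\<dots> = ennreal (\<delta>\<^sup>2 * real DIM('a)) *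
      (\<Sum>b\<in>Basis. \<integral>\<^sup>+x. ennreal ((cmod (borel_rep (dpartial b u) x))\<^sup>2) \<partial>lborel)"
    by (subst nn_integral_cmult, measurable, subst nn_integral_sum, measurable)
  also have "\<dots> = ennreal (\<delta>\<^sup>2 * real DIM('a) * (\<Sum>b\<in>Basis. (norm (dpartial b u))\<^sup>2))"
    by (simp add: nn_integral_borel_rep sum_ennreal ennreal_mult sum_nonneg)
  also have "\<dots> \<le> ennreal (\<delta>\<^sup>2 * real DIM('a) * D)"
    by (intro ennreal_leI mult_left_mono D) auto
  finally have G_le: "(\<integral>\<^sup>+x. ennreal ((cmod (G x))\<^sup>2) \<partial>lborel) \<le> ennreal (\<delta>\<^sup>2 * real DIM('a) * D)" .
  then have G: "borel_L2 G" by (auto simp: borel_L2_def intro: le_less_trans)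
  have "(\<integral>\<^sup>+x. ennreal ((cmod (borel_rep u (x + h) - borel_rep u x))\<^sup>2) \<partial>lborel)
      \<le> (\<integral>\<^sup>+x. ennreal ((cmod (G x))\<^sup>2) \<partial>lborel)"
  proof (rule translation_estimate[OF borel_L2_borel_rep G])
    fix \<phi> :: "'a \<Rightarrow> complex" assume \<phi>: "\<phi> \<in> test_functions"
    have i: "integrable lborel (\<lambda>x. (h \<bullet> b) *\<^sub>R (borel_rep u x * frechet_derivative \<phi> (at x) b))"
      "integrable lborel (\<lambda>x. (h \<bullet> b) *\<^sub>R (borel_rep (dpartial b u) x * \<phi> x))" for b
      by (intro integrable_scaleR_right integrable_borel_L2_mult borel_L2_borel_rep
          borel_L2_directional_derivative[OF \<phi>] borel_L2_test_function[OF \<phi>])+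
    have "(\<integral>x. borel_rep u x * frechet_derivative \<phi> (at x) h \<partial>lborel)
        = (\<integral>x. (\<Sum>b\<in>Basis. (h \<bullet> b) *\<^sub>R (borel_rep u x * frechet_derivative \<phi> (at x) b)) \<partial>lborel)"
      by (subst directional_derivative_sum[OF \<phi>]) (simp add: sum_distrib_left)
    also have "\<dots> = (\<Sum>b\<in>Basis. (h \<bullet> b) *\<^sub>R (\<integral>x. borel_rep u x * frechet_derivative \<phi> (at x) b \<partial>lborel))"
      using i by (simp add: Bochner_Integration.integral_sum)
    also have "\<dots> = (\<Sum>b\<in>Basis. (h \<bullet> b) *\<^sub>R - (\<integral>x. borel_rep (dpartial b u) x * \<phi> x \<partial>lborel))"
      by (intro sum.cong refl) (simp add: weak_partial_borel_rep[OF weak_partial_dpartial[OF u] \<phi>])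
    also have "\<dots> = - (\<integral>x. (\<Sum>b\<in>Basis. (h \<bullet> b) *\<^sub>R (borel_rep (dpartial b u) x * \<phi> x)) \<partial>lborel)"
      using i by (simp add: Bochner_Integration.integral_sum sum_negf)
    also have "(\<integral>x. (\<Sum>b\<in>Basis. (h \<bullet> b) *\<^sub>R (borel_rep (dpartial b u) x * \<phi> x)) \<partial>lborel) = (\<integral>x. G x * \<phi> x \<partial>lborel)"
      by (simp add: G_def sum_distrib_right)
    finally show "(\<integral>x. borel_rep u x * frechet_derivative \<phi> (at x) h \<partial>lborel) = - (\<integral>x. G x * \<phi> x \<partial>lborel)" .
  qed
  also note G_le
  finally show ?thesis .
qed

section \<open>Compactness of energy balls\<close>

lemma compact_bounded_combinations:
  fixes e :: "'k \<Rightarrow> 'a::complex_hilbert_space"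
  assumes "finite K"
  shows "\<exists>C. compact C \<and> (\<forall>c. (\<forall>k\<in>K. cmod (c k) \<le> B) \<longrightarrow> (\<Sum>k\<in>K. c k *\<^sub>C e k) \<in> C)"
  using assms
proof (induction K)
  case empty
  show ?case by (rule exI[of _ "{0}"]) simp
next
  case (insert j K)
  then obtain C where C: "compact C" "\<And>c. (\<forall>k\<in>K. cmod (c k) \<le> B) \<Longrightarrow> (\<Sum>k\<in>K. c k *\<^sub>C e k) \<in> C" by blast
  let ?D = "(\<lambda>c. c *\<^sub>C e j) ` cball 0 B"
  have "compact ?D"
    by (intro compact_continuous_image compact_cball linear_continuous_on bounded_linear_scaleC_left)
  then have "compact {x + y | x y. x \<in> ?D \<and> y \<in> C}" using C(1) by (rule compact_sums)
  moreover have "(\<Sum>k\<in>insert j K. c k *\<^sub>C e k) \<in> {x + y | x y. x \<in> ?D \<and> y \<in> C}"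
    if "\<forall>k\<in>insert j K. cmod (c k) \<le> B" for c
  proof -
    have "c j *\<^sub>C e j \<in> ?D" using that by auto
    moreover have "(\<Sum>k\<in>K. c k *\<^sub>C e k) \<in> C" using that C(2) by simp
    ultimately show ?thesis using insert.hyps by auto
  qed
  ultimately show ?case by blast
qed

text \<open>A subset of a complete space that lies within every \<open>\<epsilon>\<close> of some compact set is totally bounded.\<close>

lemma compact_closure_approximable:
  fixes S :: "'a::complete_space set"
  assumes "\<And>\<epsilon>. \<epsilon> > 0 \<Longrightarrow> \<exists>C. compact C \<and> (\<forall>u\<in>S. \<exists>v\<in>C. dist u v \<le> \<epsilon>)"
  shows "compact (closure S)"
  unfolding compact_eq_totally_bounded
proof (intro conjI allI impI)
  show "complete (closure S)" by (simp add: complete_eq_closed)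
  fix \<epsilon> :: real assume "\<epsilon> > 0"
  then have e: "\<epsilon> / 3 > 0" by simp
  obtain C where C: "compact C" "\<And>u. u \<in> S \<Longrightarrow> \<exists>v\<in>C. dist u v \<le> \<epsilon> / 3" using assms[OF e] by blast
  obtain F where F: "finite F" "C \<subseteq> (\<Union>x\<in>F. ball x (\<epsilon> / 3))"
    using C(1) e unfolding compact_eq_totally_bounded by blast
  have "S \<subseteq> (\<Union>x\<in>F. cball x (2 * \<epsilon> / 3))"
  proof
    fix u assume "u \<in> S"
    then obtain v where v: "v \<in> C" "dist u v \<le> \<epsilon> / 3" using C(2) by blast
    then obtain x where x: "x \<in> F" "dist x v < \<epsilon> / 3" using F by (auto simp: subset_eq)
    have "dist x u \<le> 2 * \<epsilon> / 3"
      using dist_triangle[of x u v] v x by (simp add: dist_commute)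
    with x show "u \<in> (\<Union>x\<in>F. cball x (2 * \<epsilon> / 3))" by auto
  qed
  then have "closure S \<subseteq> (\<Union>x\<in>F. cball x (2 * \<epsilon> / 3))"
    by (rule closure_minimal) (use F in auto)
  also have "\<dots> \<subseteq> (\<Union>x\<in>F. ball x \<epsilon>)" using \<open>\<epsilon> > 0\<close> by (auto simp: dist_commute)
  finally show "\<exists>k. finite k \<and> closure S \<subseteq> (\<Union>x\<in>k. ball x \<epsilon>)" using F(1) by blast
qed

lemma square_integrable_borel_L2:
  assumes "borel_L2 f" shows "square_integrable f"
proof -
  have "f \<in> borel_measurable lborel" using assms by (simp add: borel_L2_def)
  then have [measurable]: "f \<in> borel_measurable lebesgue" by (rule measurable_completion)
  have "integrable lebesgue (\<lambda>x. (cmod (f x))\<^sup>2)"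
    using assms by (intro integrableI_nonneg) (auto simp: borel_L2_def nn_integral_completion)
  then show ?thesis by (simp add: square_integrable_def)
qed

lemma rep_L2_combination:
  assumes "finite K" "\<And>k. k \<in> K \<Longrightarrow> square_integrable (f k)"
  shows "AE x in lebesgue. rep_L2 (\<Sum>k\<in>K. c k *\<^sub>C abs_L2 (f k)) x = (\<Sum>k\<in>K. c k * f k x)"
  using assms
proof (induction K)
  case empty
  then show ?case using rep_zero_L2 by simp
next
  case (insert j K)
  have "AE x in lebesgue. rep_L2 (\<Sum>k\<in>K. c k *\<^sub>C abs_L2 (f k)) x = (\<Sum>k\<in>K. c k * f k x)"
    using insert by simp
  moreover have "AE x in lebesgue. rep_L2 (abs_L2 (f j)) x = f j x"
    using insert by (intro rep_abs_L2) simp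
  moreover note rep_plus_L2[of "c j *\<^sub>C abs_L2 (f j)" "\<Sum>k\<in>K. c k *\<^sub>C abs_L2 (f k)"]
    rep_scaleC_L2[of "c j" "abs_L2 (f j)"]
  ultimately show ?case by eventually_elim (use insert.hyps in simp)
qed

lemma cell_average_measurable [measurable]:
  assumes [measurable]: "u \<in> borel_measurable borel"
  shows "(\<lambda>x. cell_average \<delta> u (cell_index \<delta> x)) \<in> borel_measurable borel"
proof -
  have "(\<lambda>x. \<integral>y. (if cell_index \<delta> (fst (x, y)) = cell_index \<delta> (snd (x, y)) then 1 else 0) *\<^sub>R u y \<partial>lborel)
      \<in> borel_measurable borel"
    by (rule lborel.borel_measurable_lebesgue_integral) measurable
  also have "(\<lambda>x. \<integral>y. (if cell_index \<delta> (fst (x, y)) = cell_index \<delta> (snd (x, y)) then 1 else 0) *\<^sub>R u y \<partial>lborel)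
      = (\<lambda>x. \<integral>y. indicator (cell \<delta> (cell_index \<delta> x)) y *\<^sub>R u y \<partial>lborel)"
    by (intro ext Bochner_Integration.integral_cong) (auto simp: cell_def indicator_def)
  finally show ?thesis unfolding cell_average_def by measurable
qed

text \<open>Bounded subsets of the form domain, up to the choice of an equivalent norm: the three bounds control the cell
averages, the translates and the tails, respectively.\<close>

definition energy_ball :: "('a::euclidean_space \<Rightarrow> real) \<Rightarrow> real \<Rightarrow> 'a L2 set" where
  "energy_ball W M = {u \<in> sobolev_H1 \<inter> potential_form_domain W. (norm u)\<^sup>2 \<le> M \<and>
     (\<Sum>b\<in>Basis. (norm (dpartial b u))\<^sup>2) \<le> M \<and> (\<integral>x. W x * (cmod (rep_L2 u x))\<^sup>2 \<partial>lebesgue) \<le> M}"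

text \<open>Chebyshev's inequality, with the potential as weight.\<close>

lemma potential_tail_le:
  assumes W: "\<And>x. W x \<ge> 0" and dom: "u \<in> potential_form_domain W"
    and M: "(\<integral>x. W x * (cmod (rep_L2 u x))\<^sup>2 \<partial>lebesgue) \<le> M"
    and L: "\<Lambda> > 0" "\<And>x. r \<le> norm x \<Longrightarrow> \<Lambda> \<le> W x"
  shows "(\<integral>\<^sup>+x. indicator {x. r \<le> norm x} x * ennreal ((cmod (borel_rep u x))\<^sup>2) \<partial>lborel) \<le> ennreal (M / \<Lambda>)"
proof -
  have "(\<integral>\<^sup>+x. indicator {x. r \<le> norm x} x * ennreal ((cmod (borel_rep u x))\<^sup>2) \<partial>lborel)
      = (\<integral>\<^sup>+x. indicator {x. r \<le> norm x} x * ennreal ((cmod (rep_L2 u x))\<^sup>2) \<partial>lborel)"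
    using AE_borel_rep[of u] by (intro nn_integral_cong_AE) (auto elim: AE_mp)
  also have "\<dots> = (\<integral>\<^sup>+x. indicator {x. r \<le> norm x} x * ennreal ((cmod (rep_L2 u x))\<^sup>2) \<partial>lebesgue)"
    by (rule nn_integral_completion[symmetric])
  also have "\<dots> \<le> (\<integral>\<^sup>+x. ennreal ((1 / \<Lambda>) * (W x * (cmod (rep_L2 u x))\<^sup>2)) \<partial>lebesgue)"
  proof (intro nn_integral_mono)
    fix x
    show "indicator {x. r \<le> norm x} x * ennreal ((cmod (rep_L2 u x))\<^sup>2)
        \<le> ennreal ((1 / \<Lambda>) * (W x * (cmod (rep_L2 u x))\<^sup>2))"
    proof (cases "r \<le> norm x")
      case True
      then have "\<Lambda> * (cmod (rep_L2 u x))\<^sup>2 \<le> W x * (cmod (rep_L2 u x))\<^sup>2"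
        using L by (intro mult_right_mono) auto
      then show ?thesis using True L(1) by (auto intro!: ennreal_leI simp: field_simps)
    qed simp
  qed
  also have "\<dots> = ennreal (\<integral>x. (1 / \<Lambda>) * (W x * (cmod (rep_L2 u x))\<^sup>2) \<partial>lebesgue)"
    using dom W L by (intro nn_integral_eq_integral integrable_mult_right AE_I2) (auto simp: potential_form_domain_def)
  also have "\<dots> \<le> ennreal (M / \<Lambda>)"
    using M L by (intro ennreal_leI) (simp add: divide_right_mono)
  finally show ?thesis .
qed

text \<open>Rellich's theorem in the form suited to confining potentials. Replace \<open>u\<close> by its averages over
the cells near the origin and by 0 on the other cells. The error is small near the origin by the Poincare
inequality, if the cells are small, and elsewhere because little mass escapes to where the
potential is large. What remains is a bounded subset of a finite-dimensional space.\<close>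

lemma compact_closure_energy_ball:
  fixes W :: "'a::euclidean_space \<Rightarrow> real"
  assumes W: "\<And>x. W x \<ge> 0" and lim: "filterlim W at_top at_infinity"
  shows "compact (closure (energy_ball W M))"
proof (cases "M < 0")
  case True
  then have "energy_ball W M = {}" unfolding energy_ball_def by (force dest: order_trans[OF zero_le_power2])
  then show ?thesis by simp
next
  case False
  then have M: "M \<ge> 0" by simp
  let ?n = "DIM('a)"
  show ?thesis
  proof (rule compact_closure_approximable)
    fix \<epsilon> :: real assume e: "\<epsilon> > 0"
    \<comment> \<open>Half of \<open>\<epsilon>\<^sup>2\<close> is spent on the tail and half on the cells; \<open>M + 1\<close> instead of \<open>M\<close> avoids division by 0.\<close>
    define \<Lambda> where "\<Lambda> = 2 * (M + 1) / \<epsilon>\<^sup>2"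
    have L: "\<Lambda> > 0" "M / \<Lambda> \<le> \<epsilon>\<^sup>2 / 2" using M e by (auto simp: \<Lambda>_def field_simps)
    obtain r where r: "\<And>x. r \<le> norm x \<Longrightarrow> \<Lambda> \<le> W x"
      using lim unfolding filterlim_at_top eventually_at_infinity by blast
    define \<delta> where "\<delta> = \<epsilon> / sqrt (2 * 2 ^ ?n * real ?n * (M + 1))"
    have pos: "2 * 2 ^ ?n * real ?n * (M + 1) > 0" using M by simp
    then have d: "\<delta> > 0" using e by (simp add: \<delta>_def)
    have d2: "2 ^ ?n * (\<delta>\<^sup>2 * real ?n * M) \<le> \<epsilon>\<^sup>2 / 2"
    proof -
      define a where "a = 2 ^ ?n * real ?n"
      have "a > 0" by (simp add: a_def)
      have "\<delta>\<^sup>2 = \<epsilon>\<^sup>2 / (2 * a * (M + 1))"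
        using pos by (simp add: \<delta>_def a_def power_divide mult.assoc)
      then have "a * \<delta>\<^sup>2 * M = \<epsilon>\<^sup>2 / 2 * (M / (M + 1))"
        using M \<open>a > 0\<close> by simp
      then have "2 ^ ?n * (\<delta>\<^sup>2 * real ?n * M) = \<epsilon>\<^sup>2 / 2 * (M / (M + 1))"
        by (simp add: a_def mult_ac)
      also have "\<dots> \<le> \<epsilon>\<^sup>2 / 2 * 1"
        using M by (intro mult_left_mono) auto
      finally show ?thesis by simp
    qed
    \<comment> \<open>\<open>K\<close> labels finitely many cells that cover the ball of radius \<open>r\<close>.\<close>
    obtain N :: nat where N: "r / \<delta> \<le> real N" using real_arch_simple by blast
    define K where "K = (PiE Basis (\<lambda>_. {- int N..int N}) :: ('a \<Rightarrow> int) set)"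
    have K: "finite K" unfolding K_def by (intro finite_PiE) auto
    have K_ext: "k \<in> extensional Basis" if "k \<in> K" for k using that by (auto simp: K_def PiE_def)
    have outside: "r \<le> norm x" if x: "cell_index \<delta> x \<notin> K" for x :: 'a
    proof -
      from x obtain b where b: "b \<in> Basis" "\<lfloor>(x \<bullet> b) / \<delta>\<rfloor> \<notin> {- int N..int N}"
        by (auto simp: K_def cell_index_def PiE_def Pi_def)
      then have "\<lfloor>(x \<bullet> b) / \<delta>\<rfloor> < - int N \<or> int N < \<lfloor>(x \<bullet> b) / \<delta>\<rfloor>" by auto
      then have "real N \<le> \<bar>(x \<bullet> b) / \<delta>\<bar>" by linarith
      then have "real N * \<delta> \<le> \<bar>x \<bullet> b\<bar>" using d by (simp add: field_simps)
      moreover have "r \<le> real N * \<delta>" using N d by (simp add: field_simps)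
      moreover have "\<bar>x \<bullet> b\<bar> \<le> norm x" using b(1) by (rule Basis_le_norm)
      ultimately show ?thesis by linarith
    qed
    define e where "e k = abs_L2 (indicator (cell \<delta> k) :: 'a \<Rightarrow> complex)" for k
    obtain C where C: "compact C"
      "\<And>c. (\<forall>k\<in>K. cmod (c k) \<le> (1 / \<delta> ^ ?n) * (\<delta> ^ ?n + M)) \<Longrightarrow> (\<Sum>k\<in>K. c k *\<^sub>C e k) \<in> C"
      using compact_bounded_combinations[OF K, of "(1 / \<delta> ^ ?n) * (\<delta> ^ ?n + M)" e] by blast
    have "\<exists>v\<in>C. dist u v \<le> \<epsilon>" if u: "u \<in> energy_ball W M" for u
    proof -
      from u have H1: "u \<in> sobolev_H1" and dom: "u \<in> potential_form_domain W" and nu: "(norm u)\<^sup>2 \<le> M"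
        and D: "(\<Sum>b\<in>Basis. (norm (dpartial b u))\<^sup>2) \<le> M"
        and P: "(\<integral>x. W x * (cmod (rep_L2 u x))\<^sup>2 \<partial>lebesgue) \<le> M"
        by (auto simp: energy_ball_def)
      define c where "c = cell_average \<delta> (borel_rep u)"
      define v where "v = (\<Sum>k\<in>K. c k *\<^sub>C e k)"
      have "v \<in> C"
        unfolding v_def c_def using nu M
        by (intro C(2) ballI norm_cell_average_le d K_ext borel_L2_borel_rep)
          (auto simp: nn_integral_borel_rep intro: ennreal_leI)
      have rep_v: "AE x in lborel. rep_L2 v x = (\<Sum>k\<in>K. c k * indicator (cell \<delta> k) x)"
      proof -
        have "AE x in lebesgue. rep_L2 v x = (\<Sum>k\<in>K. c k * indicator (cell \<delta> k) x)"
          unfolding v_def e_def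
          by (rule rep_L2_combination[OF K]) (intro square_integrable_borel_L2 borel_L2_indicator_cell d K_ext)
        then show ?thesis by (simp add: AE_completion_iff)
      qed
      have step: "(\<Sum>k\<in>K. c k * indicator (cell \<delta> k) x) = (if cell_index \<delta> x \<in> K then c (cell_index \<delta> x) else 0)" for x
      proof -
        have "(\<Sum>k\<in>K. c k * indicator (cell \<delta> k) x) = (\<Sum>k\<in>K. if cell_index \<delta> x = k then c k else 0)"
          by (intro sum.cong) (auto simp: cell_def indicator_def)
        then show ?thesis using K by simp
      qed
      have "ennreal ((dist u v)\<^sup>2) = (\<integral>\<^sup>+x. ennreal ((cmod (rep_L2 u x - rep_L2 v x))\<^sup>2) \<partial>lborel)"
        unfolding nn_integral_L2_diff[symmetric] nn_integral_completion ..
      also have "\<dots> = (\<integral>\<^sup>+x. ennreal ((cmod (borel_rep u x - (if cell_index \<delta> x \<in> K then c (cell_index \<delta> x) else 0)))\<^sup>2) \<partial>lborel)"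
        using AE_borel_rep[of u] rep_v by (intro nn_integral_cong_AE, eventually_elim) (simp add: step)
      also have "\<dots> \<le> (\<integral>\<^sup>+x. ennreal ((cmod (borel_rep u x - cell_average \<delta> (borel_rep u) (cell_index \<delta> x)))\<^sup>2)
          + indicator {x. r \<le> norm x} x * ennreal ((cmod (borel_rep u x))\<^sup>2) \<partial>lborel)"
      proof (intro nn_integral_mono)
        fix x
        show "ennreal ((cmod (borel_rep u x - (if cell_index \<delta> x \<in> K then c (cell_index \<delta> x) else 0)))\<^sup>2)
            \<le> ennreal ((cmod (borel_rep u x - cell_average \<delta> (borel_rep u) (cell_index \<delta> x)))\<^sup>2)
              + indicator {x. r \<le> norm x} x * ennreal ((cmod (borel_rep u x))\<^sup>2)"
          by (cases "cell_index \<delta> x \<in> K") (simp_all add: c_def outside)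
      qed
      also have "\<dots> \<le> (\<integral>\<^sup>+x. ennreal ((cmod (borel_rep u x - cell_average \<delta> (borel_rep u) (cell_index \<delta> x)))\<^sup>2) \<partial>lborel)
          + (\<integral>\<^sup>+x. indicator {x. r \<le> norm x} x * ennreal ((cmod (borel_rep u x))\<^sup>2) \<partial>lborel)"
        by (subst nn_integral_add) auto
      also have "\<dots> \<le> 2 ^ ?n * ennreal (\<delta>\<^sup>2 * real ?n * M) + ennreal (M / \<Lambda>)"
        by (intro add_mono piecewise_poincare[OF d borel_L2_borel_rep] sobolev_translation_estimate[OF H1 _ D]
            potential_tail_le[OF W dom P L(1) r])
      also have "\<dots> = ennreal (2 ^ ?n * (\<delta>\<^sup>2 * real ?n * M) + M / \<Lambda>)"
      proof -
        have "2 ^ ?n * ennreal (\<delta>\<^sup>2 * real ?n * M) = ennreal (2 ^ ?n) * ennreal (\<delta>\<^sup>2 * real ?n * M)"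
          by (metis ennreal_numeral ennreal_power zero_le_numeral)
        also have "\<dots> = ennreal (2 ^ ?n * (\<delta>\<^sup>2 * real ?n * M))"
          using M by (subst ennreal_mult) auto
        finally show ?thesis using M L by (simp add: ennreal_plus[symmetric] del: ennreal_plus)
      qed
      also have "\<dots> \<le> ennreal (\<epsilon>\<^sup>2)"
        using d2 L(2) by (intro ennreal_leI) linarith
      finally have "(dist u v)\<^sup>2 \<le> \<epsilon>\<^sup>2" by (subst (asm) ennreal_le_iff) auto
      then have "dist u v \<le> \<epsilon>" by (rule power2_le_imp_le) (use \<open>\<epsilon> > 0\<close> in simp)
      with \<open>v \<in> C\<close> show ?thesis by blast
    qed
    with C(1) show "\<exists>C. compact C \<and> (\<forall>u\<in>energy_ball W M. \<exists>v\<in>C. dist u v \<le> \<epsilon>)" by blast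
  qed
qed

section \<open>Schroedinger operators\<close>

lemma Re_dirichlet_form: "Re (dirichlet_form u u) = (\<Sum>b\<in>Basis. (norm (dpartial b u))\<^sup>2)"
  by (simp add: dirichlet_form_def power2_norm_eq_inner inner_eq_Re_cinner)

lemma Re_potential_form: "Re (potential_form W u u) = (\<integral>x. W x * (cmod (rep_L2 u x))\<^sup>2 \<partial>lebesgue)"
proof -
  have "potential_form W u u = (\<integral>x. complex_of_real (W x * (cmod (rep_L2 u x))\<^sup>2) \<partial>lebesgue)"
    unfolding potential_form_def by (simp only: complex_norm_square[symmetric] of_real_mult)
  then show ?thesis by (simp only: integral_complex_of_real Re_complex_of_real)
qed

text \<open>Testing the defining equation with \<^term>\<open>u\<close> itself.\<close>

lemma schroedinger_energy:
  assumes "(u, f) \<in> schroedinger W"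
  shows "u \<in> sobolev_H1" "u \<in> potential_form_domain W"
    "(\<Sum>b\<in>Basis. (norm (dpartial b u))\<^sup>2) + (\<integral>x. W x * (cmod (rep_L2 u x))\<^sup>2 \<partial>lebesgue) = Re (cinner f u)"
proof -
  from assms have u: "u \<in> sobolev_H1 \<inter> potential_form_domain W"
    and eq: "dirichlet_form u u + potential_form W u u = cinner f u"
    by (auto simp: schroedinger_def form_operator_def)
  from u show "u \<in> sobolev_H1" "u \<in> potential_form_domain W" by auto
  show "(\<Sum>b\<in>Basis. (norm (dpartial b u))\<^sup>2) + (\<integral>x. W x * (cmod (rep_L2 u x))\<^sup>2 \<partial>lebesgue) = Re (cinner f u)"
    unfolding eq[symmetric] by (simp add: Re_dirichlet_form Re_potential_form)
qed

text \<open>The resolvent maps bounded sets to sets of bounded energy, because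
\<open>q u u = cinner (z *\<^sub>C u - f) u\<close> for \<open>u = (z - T)\<inverse> f\<close>, where \<open>q\<close> is the form of \<open>T = - \<Delta> + W\<close>.\<close>

lemma compact_resolvent_schroedinger:
  fixes W :: "'a::euclidean_space \<Rightarrow> real"
  assumes W: "\<And>x. W x \<ge> 0" and lim: "filterlim W at_top at_infinity"
    and z: "z \<in> resolvent_set (schroedinger W)"
  shows "compact_operator (resolvent z (schroedinger W))"
  unfolding compact_operator_def
proof (intro conjI allI impI)
  let ?R = "resolvent z (schroedinger W)"
  from z have be: "bounded_everywhere ?R" by (simp add: resolvent_set_def)
  then show "linear_operator ?R" "Domain ?R = UNIV" by (auto simp: bounded_everywhere_def)
  from be obtain C where "\<forall>(f, u) \<in> ?R. norm u \<le> C * norm f" by (auto simp: bounded_everywhere_def)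
  then have C: "norm u \<le> \<bar>C\<bar> * norm f" if "(f, u) \<in> ?R" for f u
    using that mult_right_mono[OF abs_ge_self[of C] norm_ge_zero[of f]] by fastforce
  fix B :: "'a L2 set" assume "bounded B"
  then obtain m where m: "\<And>f. f \<in> B \<Longrightarrow> norm f \<le> m" "m \<ge> 0"
    unfolding bounded_pos by (meson less_imp_le)
  \<comment> \<open>\<open>c\<close> bounds the norm of \<open>u\<close>, and \<open>cmod z * c + m\<close> that of \<open>T u = z *\<^sub>C u - f\<close>.\<close>
  define c where "c = \<bar>C\<bar> * m"
  define M where "M = max (c\<^sup>2) ((cmod z * c + m) * c)"
  have "?R `` B \<subseteq> energy_ball W M"
  proof
    fix u assume "u \<in> ?R `` B"
    then obtain f where f: "f \<in> B" "(f, u) \<in> ?R" by blast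
    then obtain y where y: "(u, y) \<in> schroedinger W" "f = z *\<^sub>C u - y"
      by (auto simp: resolvent_def shifted_def)
    have nu: "norm u \<le> c"
      using C[OF f(2)] mult_left_mono[OF m(1)[OF f(1)], of "\<bar>C\<bar>"] by (simp add: c_def)
    have c0: "c \<ge> 0" using nu norm_ge_zero[of u] by linarith
    have "norm y \<le> cmod z * norm u + norm f"
      using norm_triangle_ineq4[of "z *\<^sub>C u" f] y(2) by (simp add: norm_scaleC)
    also have "\<dots> \<le> cmod z * c + m" by (intro add_mono mult_left_mono nu m f) auto
    finally have ny: "norm y \<le> cmod z * c + m" .
    have "Re (cinner y u) \<le> norm y * norm u" by (rule Re_cinner_le)
    also have "\<dots> \<le> (cmod z * c + m) * c"
      using ny nu c0 m(2) by (intro mult_mono) auto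
    finally have "Re (cinner y u) \<le> M" by (simp add: M_def)
    moreover have "(norm u)\<^sup>2 \<le> M"
      using power_mono[OF nu norm_ge_zero, of 2] by (simp add: M_def)
    moreover have "0 \<le> (\<Sum>b\<in>Basis. (norm (dpartial b u))\<^sup>2)" by (intro sum_nonneg) simp
    moreover have "0 \<le> (\<integral>x. W x * (cmod (rep_L2 u x))\<^sup>2 \<partial>lebesgue)"
      using W by (intro integral_nonneg_AE AE_I2) simp
    ultimately show "u \<in> energy_ball W M"
      using schroedinger_energy[OF y(1)] by (simp add: energy_ball_def)
  qed
  then have "closure (?R `` B) \<subseteq> closure (energy_ball W M)" by (rule closure_mono)
  then show "compact (closure (?R `` B))"
    using closed_Int_compact[OF closed_closure compact_closure_energy_ball[OF W lim, of M]]
    by (metis Int_absorb2)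
qed

text \<open>Multiplication by an imaginary function is skew-symmetric, so it does not affect accretivity.\<close>

lemma Re_cinner_mult_op_imaginary:
  assumes "(u, g) \<in> mult_op (\<lambda>x. \<i> * complex_of_real (m x))"
  shows "Re (cinner g u) = 0"
proof -
  have "Re (cinner g u) = (\<integral>x. Re (rep_L2 g x * cnj (rep_L2 u x)) \<partial>lebesgue)"
    unfolding cinner_L2_def by (rule integral_Re[symmetric]) (simp add: square_integrable_mult_integrable)
  also have "\<dots> = 0"
  proof (rule integral_eq_zero_AE)
    have "AE x in lebesgue. rep_L2 g x = \<i> * complex_of_real (m x) * rep_L2 u x"
      using assms by (simp add: mult_op_def)
    then show "AE x in lebesgue. Re (rep_L2 g x * cnj (rep_L2 u x)) = 0"
      by eventually_elim simp
  qed
  finally show ?thesis .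
qed

theorem theorem1p1:
  fixes V :: "real ^ 'n \<Rightarrow> complex"
  assumes "V \<in> borel_measurable lebesgue"
    and "\<And>x. Re (V x) \<ge> 0"
    and "filterlim (\<lambda>x. Re (V x)) at_top at_infinity"
    and "relatively_compact (mult_op (\<lambda>x. \<i> * complex_of_real (Im (V x))))
           (schroedinger (\<lambda>x. Re (V x)))"
  shows "purely_discrete_spectrum
           (op_plus (schroedinger (\<lambda>x. Re (V x)))
              (mult_op (\<lambda>x. \<i> * complex_of_real (Im (V x)))))"
proof -
  let ?T = "schroedinger (\<lambda>x. Re (V x))" and ?A = "mult_op (\<lambda>x. \<i> * complex_of_real (Im (V x)))"
  from assms(4) obtain z where T: "linear_operator ?T" and A: "linear_operator ?A"
    and z: "z \<in> resolvent_set ?T" and AR: "compact_operator (resolvent z ?T O ?A)"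
    unfolding relatively_compact_def by blast
  show ?thesis
  proof (rule purely_discrete_spectrum_accretive_perturbation[OF T A _ AR])
    show "compact_operator (resolvent z ?T)"
      by (rule compact_resolvent_schroedinger[OF assms(2,3) z])
    fix u f assume "(u, f) \<in> op_plus ?T ?A"
    then obtain y g where y: "(u, y) \<in> ?T" and g: "(u, g) \<in> ?A" and f: "f = y + g"
      by (auto simp: op_plus_def)
    have "Re (cinner f u) = Re (cinner y u)"
      by (simp add: f cinner_add_left Re_cinner_mult_op_imaginary[OF g])
    also have "\<dots> \<ge> 0"
      unfolding schroedinger_energy(3)[OF y, symmetric]
      using assms(2) by (intro add_nonneg_nonneg sum_nonneg integral_nonneg_AE AE_I2) simp_all
    finally show "Re (cinner f u) \<ge> 0" .
  qed
qed

end
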